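(* Let $\mathcal{P} = \langle a_1, \ldots, a_{n} \mid r_1, \ldots, r_k \rangle$ be a presentation, with cyclically reduced relators, of a group $G$ such that $H_1(G)$ is nontrivial free abelian of rank $n-k$. Let $\varphi : G\to \mathbb{Z}$ be a surjective homomorphism. If $\{r_1,\ldots,r_k\}$ is weakly concatenable with respect to $\varphi$, then $G$ is locally indicable.
   Context: A group $G$ is locally indicable if each of its finitely generated nontrivial subgroups admits a surjective homomorphism onto $\mathbb{Z}$. Convention: given a surjective homomorphism $\varphi:G\to\mathbb{Z}$, each generator $a$ of the presentation with $\varphi(a)<0$ is replaced by its inverse (the relators being rewritten accordingly), so that $\varphi(a)\geq 0$ for every generator $a$. The definitions below are made under this convention. For a word $w$ in the generators, its weight is $\varphi(w)$, where $w$ is viewed as an element of $G$. The initial subwords of $r=x_1^{\varepsilon_1}\cdots x_l^{\varepsilon_l}$ (each $x_i$ a generator, $\varepsilon_i\in\{\pm1\}$) are the words $x_1^{\varepsilon_1}\cdots x_i^{\varepsilon_i}$ with $1\leq i\leq l$. Multiset of minima with respect to $\varphi$: let $r$ be a relator and let $m$ be the minimum of the weights of its initial subwords. The multiset $m_\varphi(r)$ contains one copy of the generator $a$ for every initial subword of $r$ of the form $wa^{-1}$ with weight $m$ and one copy of $a$ for every initial subword of $r$ of the form $wa$ with weight $m+\varphi(a)$. $I$-values: the sequence of $I$-values of a word $r$ with respect to $\varphi$ assigns to each initial subword of $r$ of the form $\tilde w x$ ($x$ a generator) the value $\varphi(\tilde w)$ and to each initial subword of $r$ of the form $\tilde w x^{-1}$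 the value $\varphi(\tilde w x^{-1})$. (The generators at which the minimum $I$-value of a relator $r$ is attained form exactly the multiset $m_\varphi(r)$.) Weakly concatenable: a family of relators $\{r_1,\ldots,r_k\}$ is weakly concatenable with respect to $\varphi$ if there is an ordering $m_{\varphi}(r_{i_1}), \ldots, m_{\varphi}(r_{i_k})$ of their multisets of minima such that, for every $1 \leq j \leq k$, there exists an element $x \in m_{\varphi}(r_{i_j})$ such that $x \notin \bigcup_{s=1}^{j-1} m_{\varphi}(r_{i_s})$ and, if $m$ denotes the minimum $I$-value of $r_{i_j}$, the number of initial subwords of $r_{i_j}$ of the form $wx^{-1}$ with $I$-value $m$ is different from the number of initial subwords of $r_{i_j}$ of the form $wx$ with $I$-value $m$. *)

theory Defs
  imports "HOL-Algebra.Free_Abelian_Groups" "HOL-Algebra.Generated_Groups"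
    "HOL-Library.Multiset" "HOL-Library.Sublist"
    "HOL-Combinatorics.Permutations"
begin

section \<open>Words and free groups\<close>

text \<open>A letter \<open>(x, True)\<close> stands for the generator \<open>x\<close>, a letter \<open>(x, False)\<close> for its inverse.\<close>

type_synonym 'a word = "('a \<times> bool) list"

definition inv_letter :: "'a \<times> bool \<Rightarrow> 'a \<times> bool" where
  "inv_letter l = (fst l, \<not> snd l)"

definition reduced :: "'a word \<Rightarrow> bool" where
  "reduced w \<longleftrightarrow> successively (\<lambda>l l'. l' \<noteq> inv_letter l) w"

definition cyclically_reduced :: "'a word \<Rightarrow> bool" where
  "cyclically_reduced w \<longleftrightarrow> reduced w \<and> (w \<noteq> [] \<longrightarrow> hd w \<noteq> inv_letter (last w))"

fun cons_red :: "'a \<times> bool \<Rightarrow> 'a word \<Rightarrow> 'a word" where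
  "cons_red l [] = [l]"
| "cons_red l (l' # w) = (if l' = inv_letter l then w else l # l' # w)"

text \<open>Elements of the free group are reduced words; the product is concatenation followed by
  free reduction.\<close>

definition free_group :: "'a set \<Rightarrow> 'a word monoid" where
  "free_group X = \<lparr>carrier = {w. reduced w \<and> fst ` set w \<subseteq> X},
     monoid.mult = (\<lambda>u v. foldr cons_red u v), one = []\<rparr>"

lemma reduced_Nil [simp]: "reduced []"
  by (simp add: reduced_def)

lemma reduced_Cons: "reduced (l # w) \<longleftrightarrow> reduced w \<and> (w \<noteq> [] \<longrightarrow> hd w \<noteq> inv_letter l)"
  by (auto simp: reduced_def successively_Cons)

lemma inv_letter_inv_letter [simp]: "inv_letter (inv_letter l) = l"
  by (simp add: inv_letter_def)

lemma reduced_cons_red: "reduced w \<Longrightarrow> reduced (cons_red l w)"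
  by (cases w) (auto simp: reduced_Cons)

lemma reduced_foldr_cons_red: "reduced v \<Longrightarrow> reduced (foldr cons_red u v)"
  by (induction u) (auto intro: reduced_cons_red)

lemma cons_red_inv_letter: "reduced w \<Longrightarrow> cons_red l (cons_red (inv_letter l) w) = w"
  by (cases w; cases "tl w") (auto simp: reduced_Cons)

lemma set_cons_red: "set (cons_red l w) \<subseteq> insert l (set w)"
  by (cases w) auto

lemma set_foldr_cons_red: "set (foldr cons_red u v) \<subseteq> set u \<union> set v"
  by (induction u) (use set_cons_red in fastforce)+

lemma fst_set_foldr_cons_red:
  "fst ` set u \<subseteq> X \<Longrightarrow> fst ` set v \<subseteq> X \<Longrightarrow> fst ` set (foldr cons_red u v) \<subseteq> X"
  using set_foldr_cons_red[of u v] by blast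

lemma foldr_cons_red_cons_red:
  "reduced w \<Longrightarrow> foldr cons_red (cons_red l v) w = cons_red l (foldr cons_red v w)"
  by (cases v) (auto simp: cons_red_inv_letter reduced_foldr_cons_red)

lemma foldr_cons_red_assoc:
  "reduced w \<Longrightarrow> foldr cons_red (foldr cons_red u v) w = foldr cons_red u (foldr cons_red v w)"
  by (induction u) (auto simp: foldr_cons_red_cons_red)

lemma foldr_cons_red_Nil: "reduced u \<Longrightarrow> foldr cons_red u [] = u"
proof (induction u)
  case (Cons l u)
  then show ?case by (cases u) (auto simp: reduced_Cons)
qed simp

lemma foldr_cons_red_inverse:
  "foldr cons_red (map inv_letter (rev u)) (foldr cons_red u v) = v" if "reduced v"
  using that
proof (induction u arbitrary: v)
  case (Cons l u)
  then show ?case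
    using cons_red_inv_letter[of "foldr cons_red u v" "inv_letter l"]
    by (simp add: reduced_foldr_cons_red)
qed simp

lemma group_free_group: "group (free_group X)"
proof (rule groupI)
  fix u assume u: "u \<in> carrier (free_group X)"
  let ?i = "foldr cons_red (map inv_letter (rev u)) []"
  have "foldr cons_red ?i u = []"
    using u foldr_cons_red_inverse[of "[]" u]
    by (simp add: free_group_def foldr_cons_red_assoc foldr_cons_red_Nil)
  moreover have "fst ` set (map inv_letter (rev u)) \<subseteq> X"
    using u by (auto simp: free_group_def inv_letter_def)
  then have "?i \<in> carrier (free_group X)"
    using fst_set_foldr_cons_red[of "map inv_letter (rev u)" X "[]"]
    by (simp add: free_group_def reduced_foldr_cons_red)
  ultimately show "\<exists>i\<in>carrier (free_group X). i \<otimes>\<^bsub>free_group X\<^esub> u = \<one>\<^bsub>free_group X\<^esub>"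
    by (auto simp: free_group_def)
next
  fix u v assume "u \<in> carrier (free_group X)" "v \<in> carrier (free_group X)"
  then show "u \<otimes>\<^bsub>free_group X\<^esub> v \<in> carrier (free_group X)"
    using fst_set_foldr_cons_red[of u X v] by (simp add: free_group_def reduced_foldr_cons_red)
qed (auto simp: free_group_def foldr_cons_red_assoc)


section \<open>Presentations\<close>

definition normal_closure :: "('g, 'm) monoid_scheme \<Rightarrow> 'g set \<Rightarrow> 'g set" where
  "normal_closure G R = generate G {g \<otimes>\<^bsub>G\<^esub> r \<otimes>\<^bsub>G\<^esub> inv\<^bsub>G\<^esub> g | g r. g \<in> carrier G \<and> r \<in> R}"

definition word_eval :: "('g, 'm) monoid_scheme \<Rightarrow> ('a \<Rightarrow> 'g) \<Rightarrow> 'a word \<Rightarrow> 'g" where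
  "word_eval G a w =
     foldr (\<lambda>(x, e) g. (if e then a x else inv\<^bsub>G\<^esub> (a x)) \<otimes>\<^bsub>G\<^esub> g) w \<one>\<^bsub>G\<^esub>"

text \<open>\<open>G\<close> is presented by the generators \<open>X\<close> and relators \<open>R\<close>, where the symbol \<open>x \<in> X\<close> names the
  element \<open>a x\<close> of \<open>G\<close>: the induced homomorphism from the free group on \<open>X\<close> is onto and its kernel
  is the normal closure of \<open>R\<close>.\<close>

definition presents ::
    "('g, 'm) monoid_scheme \<Rightarrow> ('a \<Rightarrow> 'g) \<Rightarrow> 'a set \<Rightarrow> 'a word set \<Rightarrow> bool" where
  "presents G a X R \<longleftrightarrow>
     group G \<and> a \<in> X \<rightarrow> carrier G \<and> R \<subseteq> carrier (free_group X) \<and>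
     word_eval G a \<in> epi (free_group X) G \<and>
     kernel (free_group X) G (word_eval G a) = normal_closure (free_group X) R"

text \<open>The first integral homology of a group, that is, its abelianization.\<close>

definition H1 :: "('g, 'm) monoid_scheme \<Rightarrow> 'g set monoid" where
  "H1 G = G Mod (derived G (carrier G))"

definition locally_indicable :: "('g, 'm) monoid_scheme \<Rightarrow> bool" where
  "locally_indicable G \<longleftrightarrow>
     (\<forall>A. finite A \<and> A \<subseteq> carrier G \<and> \<not> trivial_group (subgroup_generated G A) \<longrightarrow>
        (\<exists>f. f \<in> epi (subgroup_generated G A) integer_group))"


section \<open>Multisets of minima and weak concatenability\<close>

definition initial_subwords :: "'a word \<Rightarrow> 'a word set" where
  "initial_subwords r = {u. u \<noteq> [] \<and> prefix u r}"

text \<open>Below, \<open>wt\<close> is the weight function on words; the weight of a generator \<open>x\<close> is that of the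
  one-letter word \<open>[(x, True)]\<close>.\<close>

definition min_multiset :: "('a word \<Rightarrow> int) \<Rightarrow> 'a word \<Rightarrow> 'a multiset" where
  "min_multiset wt r =
     (let m = Min (wt ` initial_subwords r) in
      image_mset (\<lambda>u. fst (last u)) (mset_set {u \<in> initial_subwords r.
        (\<exists>w x. u = w @ [(x, False)] \<and> wt u = m) \<or>
        (\<exists>w x. u = w @ [(x, True)] \<and> wt u = m + wt [(x, True)])}))"

definition I_value :: "('a word \<Rightarrow> int) \<Rightarrow> 'a word \<Rightarrow> int" where
  "I_value wt u = (if snd (last u) then wt (butlast u) else wt u)"

definition min_I_value :: "('a word \<Rightarrow> int) \<Rightarrow> 'a word \<Rightarrow> int" where
  "min_I_value wt r = Min (I_value wt ` initial_subwords r)"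

text \<open>The number of initial subwords of \<open>r\<close> ending in the letter \<open>(x, e)\<close> at which the minimum
  \<open>I\<close>-value is attained.\<close>

definition min_count :: "('a word \<Rightarrow> int) \<Rightarrow> 'a word \<Rightarrow> 'a \<Rightarrow> bool \<Rightarrow> nat" where
  "min_count wt r x e =
     card {u \<in> initial_subwords r. (\<exists>w. u = w @ [(x, e)]) \<and> I_value wt u = min_I_value wt r}"

text \<open>The following is for weight functions that are nonnegative on generators.\<close>

definition weakly_concatenable_wt :: "('a word \<Rightarrow> int) \<Rightarrow> nat \<Rightarrow> (nat \<Rightarrow> 'a word) \<Rightarrow> bool" where
  "weakly_concatenable_wt wt k r \<longleftrightarrow>
     (\<exists>p. p permutes {1..k} \<and>
       (\<forall>j\<in>{1..k}. \<exists>x. x \<in># min_multiset wt (r (p j)) \<and>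
          x \<notin> (\<Union>s\<in>{1..<j}. set_mset (min_multiset wt (r (p s)))) \<and>
          min_count wt (r (p j)) x False \<noteq> min_count wt (r (p j)) x True))"

text \<open>Replacing every generator of negative weight by its inverse, and rewriting words
  accordingly.\<close>

definition orient_gens ::
    "('g, 'm) monoid_scheme \<Rightarrow> ('g \<Rightarrow> int) \<Rightarrow> ('a \<Rightarrow> 'g) \<Rightarrow> 'a \<Rightarrow> 'g" where
  "orient_gens G \<phi> a x = (if \<phi> (a x) < 0 then inv\<^bsub>G\<^esub> (a x) else a x)"

definition orient_word :: "('g \<Rightarrow> int) \<Rightarrow> ('a \<Rightarrow> 'g) \<Rightarrow> 'a word \<Rightarrow> 'a word" where
  "orient_word \<phi> a w = map (\<lambda>(x, e). (x, if \<phi> (a x) < 0 then \<not> e else e)) w"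

definition weakly_concatenable ::
    "('g, 'm) monoid_scheme \<Rightarrow> ('g \<Rightarrow> int) \<Rightarrow> ('a \<Rightarrow> 'g) \<Rightarrow> nat \<Rightarrow> (nat \<Rightarrow> 'a word) \<Rightarrow> bool" where
  "weakly_concatenable G \<phi> a k r \<longleftrightarrow>
     weakly_concatenable_wt (\<lambda>w. \<phi> (word_eval G (orient_gens G \<phi> a) w)) k
       (\<lambda>j. orient_word \<phi> a (r j))"


section \<open>Evaluation of words is a homomorphism\<close>

lemma word_eval_closed:
  assumes "group G" "a \<in> X \<rightarrow> carrier G" "fst ` set w \<subseteq> X"
  shows "word_eval G a w \<in> carrier G"
proof -
  interpret group G by fact
  show ?thesis using assms(2,3)
    by (induction w) (auto simp: word_eval_def Pi_iff)
qed

lemma word_eval_hom: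
  assumes "group G" "a \<in> X \<rightarrow> carrier G"
  shows "word_eval G a \<in> hom (free_group X) G"
proof -
  interpret group G by fact
  let ?E = "word_eval G a"
  let ?l = "\<lambda>(x, e). if e then a x else inv\<^bsub>G\<^esub> (a x)"
  have step: "?E (l # w) = ?l l \<otimes>\<^bsub>G\<^esub> ?E w" for l w
    by (simp add: word_eval_def split: prod.splits)
  have l: "?l l \<in> carrier G" if "fst l \<in> X" for l
    using that assms(2) by (auto simp: Pi_iff split: prod.splits)
  have linv: "?l l \<otimes>\<^bsub>G\<^esub> ?l (inv_letter l) = \<one>\<^bsub>G\<^esub>" if "fst l \<in> X" for l
    using that assms(2) by (auto simp: Pi_iff inv_letter_def split: prod.splits)
  have cr: "?E (cons_red l w) = ?l l \<otimes>\<^bsub>G\<^esub> ?E w" if "fst l \<in> X" "fst ` set w \<subseteq> X" for l w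
  proof (cases "w \<noteq> [] \<and> hd w = inv_letter l")
    case True
    then obtain v where w: "w = inv_letter l # v" by (cases w) auto
    then have v: "fst ` set v \<subseteq> X" and i: "fst (inv_letter l) \<in> X" using that by auto
    have E: "?E v \<in> carrier G" by (rule word_eval_closed[OF assms v])
    have "?l l \<otimes>\<^bsub>G\<^esub> ?E w = ?l l \<otimes>\<^bsub>G\<^esub> (?l (inv_letter l) \<otimes>\<^bsub>G\<^esub> ?E v)"
      unfolding w step ..
    also have "\<dots> = (?l l \<otimes>\<^bsub>G\<^esub> ?l (inv_letter l)) \<otimes>\<^bsub>G\<^esub> ?E v"
      by (rule m_assoc[symmetric, OF l[OF that(1)] l[OF i] E])
    also have "\<dots> = ?E v"
      unfolding linv[OF that(1)] by (rule l_one[OF E])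
    finally show ?thesis by (simp add: w)
  next
    case False
    then have "cons_red l w = l # w" by (cases w) auto
    then show ?thesis by (simp add: step)
  qed
  have "?E (foldr cons_red u v) = ?E u \<otimes>\<^bsub>G\<^esub> ?E v"
    if "fst ` set u \<subseteq> X" "fst ` set v \<subseteq> X" for u v
    using that
  proof (induction u)
    case Nil
    then show ?case using word_eval_closed[OF assms] by (simp add: word_eval_def)
  next
    case (Cons x u)
    have x: "fst x \<in> X" and u: "fst ` set u \<subseteq> X" using Cons.prems by auto
    have "?E (foldr cons_red (x # u) v) = ?l x \<otimes>\<^bsub>G\<^esub> ?E (foldr cons_red u v)"
      using cr[OF x fst_set_foldr_cons_red[OF u Cons.prems(2)]] by simp
    also have "\<dots> = ?l x \<otimes>\<^bsub>G\<^esub> (?E u \<otimes>\<^bsub>G\<^esub> ?E v)"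
      by (simp only: Cons.IH[OF u Cons.prems(2)])
    also have "\<dots> = ?E (x # u) \<otimes>\<^bsub>G\<^esub> ?E v"
      unfolding step by (rule m_assoc[symmetric, OF l[OF x] word_eval_closed[OF assms u]
            word_eval_closed[OF assms Cons.prems(2)]])
    finally show ?case .
  qed
  then show ?thesis
    using word_eval_closed[OF assms] by (auto simp: hom_def free_group_def)
qed

end

theory Submission
  imports Defs "HOL-Computational_Algebra.Primes"
begin

text \<open>The infinite cyclic cover defined by \<open>\<phi>\<close> has a letter \<open>(y, i)\<close> for every generator \<open>y\<close> and level
  \<open>i\<close>, and its relators are the lifts of the \<open>r j\<close>. The hypothesis on the first homology group makes the
  exponent vectors of the relators independent modulo every prime, and this passes to the cover.
  Order the lifted relators by their minimal level, starting from above, and within a level as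
  weak concatenability prescribes. Then every relator contains a letter with nonzero exponent sum that
  occurs in no earlier relator, and it suffices to show that adding a relator \<open>r\<close> with such a letter
  \<open>x\<close> preserves local indicability.

  A finitely generated subgroup without characters lifts through Howie's tower of cyclic covers to a
  finite labelled graph without rational cohomology, with an order on its vertices that the labels
  respect. The exponent vectors of the cells of this graph are still independent modulo every
  prime. The largest \<open>x\<close>-edge of the top cell over \<open>r\<close> lies on no other cell. Its exponent sum in
  that cell is nonzero, hence \<open>\<plusminus>1\<close>, and removing it together with the cell leaves a graph of
  the same kind. By induction, all closed paths in the graph are trivial in the group.\<close>

section \<open>Words modulo relators\<close>

text \<open>The crux is that the top \<open>x\<close>-edge \<open>M\<close> of the top cell has
  nonzero exponent sum: \<open>expo x r\<close> only controls the sum over all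
  \<open>x\<close>-edges of a cell. If the sum at \<open>M\<close> were zero, \<open>M\<close> would
  separate the graph, and one side would again be without cohomology. On that side the induction is
  used upside down. The lowest \<open>x\<close>-edges of its cells have nonzero exponent sum and
  miss the top cell, so cochains can be corrected there to become cocycles, and every loop formed on
  that side by edges of the top cell has exponent sum zero at each \<open>x\<close>-edge. Cutting at
  such edges ends with an \<open>x\<close>-free loop between \<open>x\<close> and its inverse,
  against the reducedness of \<open>r\<close>. This exchange of top and bottom is why signs
  \<open>\<sigma>\<close> and \<open>\<tau>\<close> are carried along.

  The sum is a unit because some loop crosses \<open>M\<close> exactly once. Its exponent vector is
  a rational combination of those of the cells, an integral one by independence modulo all primes,
  and only the top cell contributes at \<open>M\<close>. Rational independence would not be enough
  here.\<close>

definition winv :: "'a word \<Rightarrow> 'a word" where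
  "winv w = map inv_letter (rev w)"

lemma winv_simps [simp]:
  "winv [] = []" "winv (u @ v) = winv v @ winv u" "winv (l # w) = winv w @ [inv_letter l]"
  "winv (winv w) = w" "length (winv w) = length w"
  by (auto simp: winv_def rev_map comp_def)

lemma fst_inv_letter [simp]: "fst (inv_letter l) = fst l"
  by (simp add: inv_letter_def)

lemma fst_set_winv [simp]: "fst ` set (winv w) = fst ` set w"
  by (force simp: winv_def image_image)

section \<open>Weights and exponent sums of words\<close>

definition word_sum :: "('a \<Rightarrow> 'r::comm_ring_1) \<Rightarrow> 'a word \<Rightarrow> 'r" where
  "word_sum h w = (\<Sum>(y, s)\<leftarrow>w. if s then h y else - h y)"

definition expo :: "'a \<Rightarrow> 'a word \<Rightarrow> int" where
  "expo y = word_sum (\<lambda>z. of_bool (z = y))"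

lemma word_sum_simps [simp]:
  "word_sum h [] = 0" "word_sum h (u @ v) = word_sum h u + word_sum h v"
  "word_sum h ((y, s) # w) = (if s then h y else - h y) + word_sum h w"
  by (auto simp: word_sum_def)

lemma word_sum_Cons: "word_sum h (l # w) = (if snd l then h (fst l) else - h (fst l)) + word_sum h w"
  by (cases l) simp

lemma word_sum_winv [simp]: "word_sum h (winv w) = - word_sum h w"
  by (induction w) (auto simp: inv_letter_def)

lemma expo_simps [simp]:
  "expo y [] = 0" "expo y (u @ v) = expo y u + expo y v" "expo y (winv w) = - expo y w"
  "expo y ((z, s) # w) = (if z = y then if s then 1 else -1 else 0) + expo y w"
  by (auto simp: expo_def)

lemma word_sum_cong:
  "(\<And>y. y \<in> fst ` set w \<Longrightarrow> h y = h' y) \<Longrightarrow> word_sum h w = word_sum h' w"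
  by (induction w) (auto simp: word_sum_Cons)

lemma expo_eq_0: "y \<notin> fst ` set w \<Longrightarrow> expo y w = 0"
  by (induction w) auto

lemma word_sum_expo:
  assumes "finite Y" "fst ` set w \<subseteq> Y"
  shows "word_sum h w = (\<Sum>y\<in>Y. h y * of_int (expo y w))"
  using assms(2)
proof (induction w)
  case (Cons l w)
  obtain y s where l: "l = (y, s)" by (cases l)
  have "(\<Sum>z\<in>Y. h z * of_int (expo z (l # w)))
      = (\<Sum>z\<in>Y. if y = z then h z * (if s then 1 else -1) else 0) + (\<Sum>z\<in>Y. h z * of_int (expo z w))"
    unfolding sum.distrib[symmetric] by (rule sum.cong) (auto simp: l algebra_simps)
  also have "(\<Sum>z\<in>Y. if y = z then h z * (if s then 1 else -1) else 0) = (if s then h y else - h y)"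
    using Cons.prems assms(1) by (subst sum.delta') (auto simp: l)
  finally show ?case using Cons by (simp add: l)
qed simp

lemma word_sum_single: "word_sum (\<lambda>z. if z = y then c else 0) w = c * of_int (expo y w)"
  by (induction w) (auto simp: algebra_simps)

lemma word_sum_linear:
  "word_sum (\<lambda>z. a * h z + b * h' z) w = a * word_sum h w + b * word_sum h' w"
  by (induction w) (auto simp: algebra_simps)

lemma word_sum_upd:
  "word_sum (h(y := c)) w = word_sum h w + (c - h y) * of_int (expo y w)"
  by (induction w) (auto simp: algebra_simps)

lemma word_sum_of_int: "word_sum (\<lambda>z. of_int (h z)) w = of_int (word_sum h w)"
  by (induction w) auto

text \<open>Triviality in the group with relators \<open>R\<close>, as rewriting from the empty
  word. Words need not be reduced and all elements of the type are letters, so enlarging the set of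
  generators is invisible. Each move is listed with its inverse.\<close>

inductive null_word :: "'a word set \<Rightarrow> 'a word \<Rightarrow> bool" for R where
  null_Nil: "null_word R []"
| null_cancel: "null_word R (u @ v) \<Longrightarrow> null_word R (u @ [l, inv_letter l] @ v)"
| null_uncancel: "null_word R (u @ [l, inv_letter l] @ v) \<Longrightarrow> null_word R (u @ v)"
| null_insert: "null_word R (u @ v) \<Longrightarrow> r \<in> R \<Longrightarrow> null_word R (u @ r @ v)"
| null_delete: "null_word R (u @ r @ v) \<Longrightarrow> r \<in> R \<Longrightarrow> null_word R (u @ v)"

lemma null_word_insert: "null_word R v \<Longrightarrow> null_word R (u @ w) \<Longrightarrow> null_word R (u @ v @ w)"
proof (induction rule: null_word.induct)
  case (null_cancel u' v' l)
  then show ?case using null_word.null_cancel[of R "u @ u'" "v' @ w" l] by simp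
next
  case (null_uncancel u' l v')
  then show ?case using null_word.null_uncancel[of R "u @ u'" l "v' @ w"] by simp
next
  case (null_insert u' v' r)
  then show ?case using null_word.null_insert[of R "u @ u'" "v' @ w" r] by simp
next
  case (null_delete u' r v')
  then show ?case using null_word.null_delete[of R "u @ u'" r "v' @ w"] by simp
qed simp

text \<open>The derivation of \<open>v\<close> is replayed between \<open>u\<close> and
  \<open>w\<close>, each move being answered by its inverse; this is where the uncancelling and
  deleting rules are essential.\<close>

lemma null_word_delete: "null_word R v \<Longrightarrow> null_word R (u @ v @ w) \<Longrightarrow> null_word R (u @ w)"
proof (induction rule: null_word.induct)
  case (null_cancel u' v' l)
  then show ?case using null_word.null_uncancel[of R "u @ u'" l "v' @ w"] by simp
next
  case (null_uncancel u' l v')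
  then show ?case using null_word.null_cancel[of R "u @ u'" "v' @ w" l] by simp
next
  case (null_insert u' v' r)
  then show ?case using null_word.null_delete[of R "u @ u'" r "v' @ w"] by simp
next
  case (null_delete u' r v')
  then show ?case using null_word.null_insert[of R "u @ u'" "v' @ w" r] by simp
qed simp

lemma null_word_insert_iff: "null_word R v \<Longrightarrow> null_word R (u @ v @ w) \<longleftrightarrow> null_word R (u @ w)"
  using null_word_insert null_word_delete by blast

lemma null_word_append: "null_word R u \<Longrightarrow> null_word R v \<Longrightarrow> null_word R (u @ v)"
  using null_word_insert[of R v u "[]"] by simp

lemma null_word_relator: "r \<in> R \<Longrightarrow> null_word R r"
  using null_insert[of R "[]" "[]" r] null_Nil[of R] by simp

lemma null_word_cancel_iff: "null_word R (u @ [l, inv_letter l] @ v) \<longleftrightarrow> null_word R (u @ v)"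
  using null_cancel null_uncancel by blast

lemma null_word_winv: "null_word R (v @ winv v)"
proof (induction v)
  case (Cons l v)
  then have "null_word R ([l] @ (v @ winv v) @ [inv_letter l])"
    using null_word_insert[of R "v @ winv v" "[l]" "[inv_letter l]"]
      null_cancel[of R "[]" "[]" l] null_Nil[of R] by simp
  then show ?case by simp
qed (simp add: null_Nil)

lemma null_word_winv': "null_word R (winv v @ v)"
  using null_word_winv[of R "winv v"] by simp

text \<open>Conjugation: inserting \<open>u @ v\<close> into \<open>v @ winv v\<close> gives a null
  word, from whose end \<open>v @ winv v\<close> can be deleted.\<close>

lemma null_word_rotate: "null_word R (u @ v) \<Longrightarrow> null_word R (v @ u)"
  using null_word_insert[of R "u @ v" v "winv v"] null_word_winv[of R v]
    null_word_delete[OF null_word_winv[of R v], of "v @ u" "[]"] by simp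

lemma null_word_winvI: "null_word R w \<Longrightarrow> null_word R (winv w)"
  using null_word_delete[of R w "[]" "winv w"] null_word_winv[of R w] by simp

lemma null_word_trans:
  assumes "null_word R w" "\<And>r. r \<in> R \<Longrightarrow> null_word R' r"
  shows "null_word R' w"
  using assms(1)
proof induction
  case (null_insert u v r)
  then show ?case using assms(2) null_word_insert by blast
next
  case (null_delete u r v)
  then show ?case using assms(2) null_word_delete by blast
qed (auto intro: null_word.intros(1-3) simp: null_word_cancel_iff[simplified])

lemma null_word_mono: "null_word R w \<Longrightarrow> R \<subseteq> R' \<Longrightarrow> null_word R' w"
  by (erule null_word_trans) (auto intro: null_word_relator)

text \<open>A derivation mentions finitely many relators. This brings the infinitely many relators
  of a cyclic cover down to finite sets.\<close>

lemma null_word_finite: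
  assumes "null_word R w"
  shows "\<exists>R'\<subseteq>R. finite R' \<and> null_word R' w"
  using assms
proof induction
  case null_Nil
  then show ?case using null_word.null_Nil by blast
next
  case (null_cancel u v l)
  then show ?case using null_word.null_cancel by blast
next
  case (null_uncancel u l v)
  then show ?case using null_word.null_uncancel by blast
next
  case (null_insert u v r)
  then obtain R' where "R' \<subseteq> R" "finite R'" "null_word R' (u @ v)" by blast
  then show ?case using null_insert(2)
    by (intro exI[of _ "insert r R'"])
      (auto intro!: null_word.null_insert[of "insert r R'"] elim: null_word_mono)
next
  case (null_delete u r v)
  then obtain R' where "R' \<subseteq> R" "finite R'" "null_word R' (u @ r @ v)" by blast
  then show ?case using null_delete(2)
    by (intro exI[of _ "insert r R'"])
      (auto intro!: null_word.null_delete[of "insert r R'" u r v] elim: null_word_mono)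
qed

text \<open>\<open>\<mu> s\<close> counts the insertions of \<open>s\<close> in a derivation, minus
  its deletions.\<close>

lemma null_word_expo:
  assumes "null_word R w" "finite R"
  shows "\<exists>\<mu>. \<forall>y. expo y w = (\<Sum>s\<in>R. \<mu> s * expo y s)"
  using assms(1)
proof induction
  case null_Nil
  then show ?case by (intro exI[of _ "\<lambda>_. 0"]) simp
next
  case (null_cancel u v l)
  moreover have "expo y (u @ [l, inv_letter l] @ v) = expo y (u @ v)" for y
    by (cases l) (auto simp: inv_letter_def)
  ultimately show ?case by simp
next
  case (null_uncancel u l v)
  moreover have "expo y (u @ [l, inv_letter l] @ v) = expo y (u @ v)" for y
    by (cases l) (auto simp: inv_letter_def)
  ultimately show ?case by simp
next
  case (null_insert u v r)
  then obtain \<mu> where \<mu>: "\<And>y. expo y (u @ v) = (\<Sum>s\<in>R. \<mu> s * expo y s)" by blast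
  have "(\<Sum>s\<in>R. (\<mu> s + of_bool (s = r)) * expo y s) = expo y (u @ r @ v)" for y
    using \<mu>[of y] null_insert(2) assms(2)
    by (simp add: algebra_simps sum.distrib of_bool_def if_distrib[of "\<lambda>t. t * _"]
        if_distrib[of "\<lambda>t. _ * t"] cong: if_cong)
  then show ?case by metis
next
  case (null_delete u r v)
  then obtain \<mu> where \<mu>: "\<And>y. expo y (u @ r @ v) = (\<Sum>s\<in>R. \<mu> s * expo y s)" by blast
  have "(\<Sum>s\<in>R. (\<mu> s - of_bool (s = r)) * expo y s) = expo y (u @ v)" for y
    using \<mu>[of y] null_delete(2) assms(2)
    by (simp add: algebra_simps sum_subtractf of_bool_def if_distrib[of "\<lambda>t. t * _"]
        if_distrib[of "\<lambda>t. _ * t"] cong: if_cong)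
  then show ?case by metis
qed

text \<open>Also used with words as letters: \<open>subst (\<lambda>g. g)\<close> multiplies out a
  word whose letters are themselves words.\<close>

definition subst :: "('b \<Rightarrow> 'a word) \<Rightarrow> 'b word \<Rightarrow> 'a word" where
  "subst \<sigma> w = concat (map (\<lambda>(y, s). if s then \<sigma> y else winv (\<sigma> y)) w)"

lemma subst_simps [simp]:
  "subst \<sigma> [] = []" "subst \<sigma> (u @ v) = subst \<sigma> u @ subst \<sigma> v"
  "subst \<sigma> ((y, s) # w) = (if s then \<sigma> y else winv (\<sigma> y)) @ subst \<sigma> w"
  by (auto simp: subst_def)

lemma null_word_subst:
  assumes "null_word R w" "\<And>r. r \<in> R \<Longrightarrow> null_word R' (subst \<sigma> r)"
  shows "null_word R' (subst \<sigma> w)"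
  using assms(1)
proof induction
  case null_Nil
  then show ?case by (simp add: null_word.null_Nil)
next
  case (null_cancel u v l)
  then show ?case using null_word_insert[of R' "subst \<sigma> [l] @ winv (subst \<sigma> [l])" "subst \<sigma> u" "subst \<sigma> v"]
      null_word_winv[of R' "subst \<sigma> [l]"] by (cases l) (auto simp: inv_letter_def)
next
  case (null_uncancel u l v)
  then show ?case using null_word_delete[of R' "subst \<sigma> [l] @ winv (subst \<sigma> [l])" "subst \<sigma> u" "subst \<sigma> v"]
      null_word_winv[of R' "subst \<sigma> [l]"] by (cases l) (auto simp: inv_letter_def split: if_splits)
next
  case (null_insert u v r)
  then show ?case using assms(2) by (auto intro: null_word_insert)
next
  case (null_delete u r v)
  then show ?case using assms(2)[of r] null_word_delete by auto
qed

lemma word_sum_subst: "word_sum h (subst \<sigma> w) = word_sum (\<lambda>y. word_sum h (\<sigma> y)) w"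
  by (induction w) auto

section \<open>Linear algebra over words\<close>

text \<open>For \<open>p = 0\<close> this is independence over the rationals.\<close>

definition indep :: "int \<Rightarrow> 'c set \<Rightarrow> 'y set \<Rightarrow> ('c \<Rightarrow> 'y \<Rightarrow> int) \<Rightarrow> bool" where
  "indep p C Y co \<longleftrightarrow>
     (\<forall>k. (\<forall>y\<in>Y. p dvd (\<Sum>c\<in>C. k c * co c y)) \<longrightarrow> (\<forall>c\<in>C. p dvd k c))"

lemma indepD: "indep p C Y co \<Longrightarrow> (\<And>y. y \<in> Y \<Longrightarrow> p dvd (\<Sum>c\<in>C. k c * co c y)) \<Longrightarrow> c \<in> C \<Longrightarrow> p dvd k c"
  unfolding indep_def by blast

lemma indep_subset:
  assumes "indep p C Y co" "C' \<subseteq> C" "finite C"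
  shows "indep p C' Y co"
  unfolding indep_def
proof (intro allI impI ballI)
  fix k c assume l: "\<forall>y\<in>Y. p dvd (\<Sum>c\<in>C'. k c * co c y)" and c: "c \<in> C'"
  have "(\<Sum>c\<in>C. (if c \<in> C' then k c else 0) * co c y) = (\<Sum>c\<in>C'. k c * co c y)" for y
    using assms(2,3) by (intro sum.mono_neutral_cong_right) auto
  then show "p dvd k c"
    using indepD[OF assms(1), of "\<lambda>c. if c \<in> C' then k c else 0" c] l c assms(2) by auto
qed

text \<open>The span of finitely many vectors is the annihilator of its annihilator. Vectors are
  added one at a time, with corrections of the target and of the functional.\<close>

lemma combination_or_functional:
  fixes z :: "'y \<Rightarrow> rat" and v :: "'c \<Rightarrow> 'y \<Rightarrow> rat"
  assumes "finite C" "finite Y"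
  shows "(\<exists>q. \<forall>y\<in>Y. z y = (\<Sum>c\<in>C. q c * v c y)) \<or>
    (\<exists>h. (\<forall>c\<in>C. (\<Sum>y\<in>Y. h y * v c y) = 0) \<and> (\<Sum>y\<in>Y. h y * z y) \<noteq> 0)"
  using assms(1)
proof (induction C arbitrary: z)
  case empty
  show ?case
  proof (cases "\<forall>y\<in>Y. z y = 0")
    case False
    then obtain y0 where y0: "y0 \<in> Y" "z y0 \<noteq> 0" by blast
    then have "(\<Sum>y\<in>Y. of_bool (y = y0) * z y) \<noteq> 0"
      using assms(2) by (simp add: of_bool_def if_distrib[of "\<lambda>t. t * _"] cong: if_cong)
    then show ?thesis by fastforce
  qed simp
next
  case (insert c C)
  let ?p = "\<lambda>h u. \<Sum>y\<in>Y. h y * u y"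
  show ?case
  proof (cases "\<exists>q. \<forall>y\<in>Y. z y = (\<Sum>c\<in>C. q c * v c y)")
    case True
    then obtain q where q: "\<forall>y\<in>Y. z y = (\<Sum>c\<in>C. q c * v c y)" by blast
    have "(\<Sum>d\<in>insert c C. (q(c := 0)) d * v d y) = (\<Sum>c\<in>C. q c * v c y)" for y
      using insert(1,2) by (simp, intro sum.cong) auto
    then show ?thesis using q by metis
  next
    case False
    then obtain h where h: "\<forall>c\<in>C. ?p h (v c) = 0" "?p h z \<noteq> 0" using insert.IH[of z] by blast
    show ?thesis
    proof (cases "?p h (v c) = 0")
      case True
      then show ?thesis using h by blast
    next
      case hc: False
      \<comment> \<open>With this \<open>t\<close> the functional \<open>h\<close> kills
        \<open>?z\<close>, so subtracting multiples of \<open>h\<close> from \<open>h'\<close> does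
        not change the value at \<open>?z\<close>.\<close>
      define t where "t = ?p h z / ?p h (v c)"
      let ?z = "\<lambda>y. z y - t * v c y"
      have "\<not> (\<exists>q. \<forall>y\<in>Y. ?z y = (\<Sum>c\<in>C. q c * v c y)) \<or>
        (\<exists>q. \<forall>y\<in>Y. z y = (\<Sum>c\<in>insert c C. q c * v c y))"
      proof -
        { fix q assume q: "\<forall>y\<in>Y. ?z y = (\<Sum>c\<in>C. q c * v c y)"
          have "(\<Sum>d\<in>insert c C. (q(c := t)) d * v d y) = t * v c y + (\<Sum>c\<in>C. q c * v c y)" for y
            using insert(1,2) by (simp, intro sum.cong) auto
          then have "\<forall>y\<in>Y. z y = (\<Sum>d\<in>insert c C. (q(c := t)) d * v d y)"
            using q by (metis add.commute diff_add_cancel) }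
        then show ?thesis by blast
      qed
      then consider "\<exists>q. \<forall>y\<in>Y. z y = (\<Sum>c\<in>insert c C. q c * v c y)"
        | h' where "\<forall>c\<in>C. ?p h' (v c) = 0" "?p h' ?z \<noteq> 0"
        using insert.IH[of ?z] by blast
      then show ?thesis
      proof cases
        case 2
        \<comment> \<open>Chosen so that \<open>?g\<close> kills the new vector \<open>v c\<close>
          too.\<close>
        define s where "s = ?p h' (v c) / ?p h (v c)"
        let ?g = "\<lambda>y. h' y - s * h y"
        have lin: "?p ?g u = ?p h' u - s * ?p h u" for u
          by (simp add: sum_distrib_left sum_subtractf[symmetric] algebra_simps)
        have "?p h' ?z = ?p h' z - t * ?p h' (v c)"
          by (simp add: sum_distrib_left sum_subtractf[symmetric] algebra_simps)
        then have "?p ?g z = ?p h' ?z" unfolding lin by (simp add: s_def t_def)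
        moreover have "?p ?g (v d) = 0" if "d \<in> insert c C" for d
          unfolding lin using that 2(1) h(1) hc by (auto simp: s_def)
        ultimately show ?thesis using 2(2) by metis
      qed blast
    qed
  qed
qed

lemma common_denominator:
  fixes q :: "'a \<Rightarrow> rat"
  assumes "finite A"
  shows "\<exists>d>0. \<exists>f::'a \<Rightarrow> int. \<forall>a\<in>A. of_int d * q a = of_int (f a)"
  using assms
proof (induction A)
  case empty
  show ?case by (intro exI[of _ 1]) simp
next
  case (insert a A)
  then obtain d f where d: "d > 0" "\<forall>a\<in>A. of_int d * q a = of_int (f a)" by blast
  obtain m n where mn: "q a = of_int m / of_int n" "n > 0"
    by (metis quotient_of_div quotient_of_denom_pos surj_pair)
  have "of_int (d * n) * q b = of_int (if b = a then d * m else n * f b)" if "b \<in> insert a A" for b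
    using that d(2) mn by (cases "b = a") (auto simp: algebra_simps)
  then show ?case using d(1) mn(2)
    by (intro exI[of _ "d * n"] conjI exI[of _ "\<lambda>b. if b = a then d * m else n * f b"]) auto
qed

text \<open>Divisibility by \<open>0\<close> means being \<open>0\<close>, so expressing
  \<open>co d\<close> rationally by the others contradicts independence once denominators are
  cleared. The functionals obtained from this form a dual basis.\<close>

lemma dual_functional:
  assumes "indep 0 C Y co" "finite C" "finite Y"
  shows "\<exists>h::'y \<Rightarrow> rat. \<forall>c\<in>C. (\<Sum>y\<in>Y. h y * of_int (co c y)) = b c"
proof -
  have "\<exists>h::'y \<Rightarrow> rat. (\<forall>c\<in>C - {d}. (\<Sum>y\<in>Y. h y * of_int (co c y)) = 0) \<and> (\<Sum>y\<in>Y. h y * of_int (co d y)) = 1"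
    if d: "d \<in> C" for d
  proof -
    have "\<not> (\<exists>q. \<forall>y\<in>Y. of_int (co d y) = (\<Sum>c\<in>C - {d}. q c * of_int (co c y) :: rat))"
    proof
      assume "\<exists>q. \<forall>y\<in>Y. of_int (co d y) = (\<Sum>c\<in>C - {d}. q c * of_int (co c y) :: rat)"
      then obtain q :: "'a \<Rightarrow> rat"
        where q: "\<forall>y\<in>Y. of_int (co d y) = (\<Sum>c\<in>C - {d}. q c * of_int (co c y))" by blast
      obtain e f where e: "e > 0" "\<forall>c\<in>C - {d}. of_int e * q c = (of_int (f c) :: rat)"
        using common_denominator[of "C - {d}" q] assms(2) by blast
      have "(\<Sum>c\<in>C. (if c = d then e else - f c) * co c y) = 0" if y: "y \<in> Y" for y
      proof -
        have "of_int (\<Sum>c\<in>C. (if c = d then e else - f c) * co c y)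
            = (of_int e * of_int (co d y) - (\<Sum>c\<in>C - {d}. of_int (f c) * of_int (co c y)) :: rat)"
          using assms(2) d by (simp add: sum.remove sum_negf[symmetric])
        also have "(\<Sum>c\<in>C - {d}. of_int (f c) * of_int (co c y)) = of_int e * (\<Sum>c\<in>C - {d}. q c * of_int (co c y))"
          unfolding sum_distrib_left by (rule sum.cong) (auto simp: e(2)[rule_format, symmetric])
        also have "\<dots> = of_int e * of_int (co d y)" using q y by simp
        finally show ?thesis by (simp only: of_int_eq_0_iff diff_self)
      qed
      then show False using indepD[OF assms(1), of "\<lambda>c. if c = d then e else - f c" d] d e(1) by auto
    qed
    then obtain h :: "'y \<Rightarrow> rat" where h: "\<forall>c\<in>C - {d}. (\<Sum>y\<in>Y. h y * of_int (co c y)) = 0"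
      "(\<Sum>y\<in>Y. h y * of_int (co d y)) \<noteq> 0"
      using combination_or_functional[of "C - {d}" Y "\<lambda>y. of_int (co d y)" "\<lambda>c y. of_int (co c y)"] assms by auto
    let ?s = "\<Sum>y\<in>Y. h y * of_int (co d y)"
    have "(\<Sum>y\<in>Y. (h y / ?s) * of_int (co c y)) = (\<Sum>y\<in>Y. h y * of_int (co c y)) / ?s" for c
      by (simp add: sum_divide_distrib)
    then show ?thesis using h by (intro exI[of _ "\<lambda>y. h y / ?s"]) simp
  qed
  then obtain H :: "'a \<Rightarrow> 'y \<Rightarrow> rat" where H: "\<And>d. d \<in> C \<Longrightarrow> (\<forall>c\<in>C - {d}. (\<Sum>y\<in>Y. H d y * of_int (co c y)) = 0)"
    "\<And>d. d \<in> C \<Longrightarrow> (\<Sum>y\<in>Y. H d y * of_int (co d y)) = 1" by metis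
  have "(\<Sum>y\<in>Y. (\<Sum>d\<in>C. b d * H d y) * of_int (co c y)) = b c" if c: "c \<in> C" for c
  proof -
    have "(\<Sum>y\<in>Y. (\<Sum>d\<in>C. b d * H d y) * of_int (co c y)) = (\<Sum>d\<in>C. b d * (\<Sum>y\<in>Y. H d y * of_int (co c y)))"
      unfolding sum_distrib_left sum_distrib_right by (subst sum.swap) (simp add: algebra_simps)
    also have "\<dots> = (\<Sum>d\<in>C. if d = c then b c else 0)"
      using H c by (intro sum.cong) auto
    finally show ?thesis using assms(2) c by simp
  qed
  then show ?thesis by (intro exI[of _ "\<lambda>y. \<Sum>d\<in>C. b d * H d y"]) blast
qed

text \<open>By independence modulo every prime, the combinations of the \<open>co c\<close> form a pure subgroup.\<close>

lemma integral_combination: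
  fixes co :: "'c \<Rightarrow> 'y \<Rightarrow> int" and z :: "'y \<Rightarrow> int"
  assumes "\<And>p. prime p \<Longrightarrow> indep p C Y co"
    and "d > 0" "\<And>y. y \<in> Y \<Longrightarrow> d * z y = (\<Sum>c\<in>C. f c * co c y)"
  shows "\<exists>g. \<forall>y\<in>Y. z y = (\<Sum>c\<in>C. g c * co c y)"
  using assms(2,3)
proof (induction "nat d" arbitrary: d f rule: less_induct)
  case less
  show ?case
  proof (cases "d = 1")
    case True
    then show ?thesis using less.prems by auto
  next
    case False
    then obtain p where p: "prime p" "p dvd d"
      using less.prems(1) prime_divisor_exists[of d] by auto
    then obtain d' where d': "d = p * d'" by blast
    have p1: "p > 1" using p(1) prime_gt_1_int by blast
    \<comment> \<open>Modulo \<open>p\<close> the left side \<open>d * z y\<close> vanishes, so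
      independence makes every coefficient divisible by \<open>p\<close>, and one factor
      \<open>p\<close> of \<open>d\<close> can be cancelled.\<close>
    have "p dvd f c" if "c \<in> C" for c
      by (rule indepD[OF assms(1)[OF p(1)] _ that]) (use less.prems(2) p(2) in \<open>metis dvd_mult2\<close>)
    then obtain f' where f': "\<And>c. c \<in> C \<Longrightarrow> f c = p * f' c" unfolding dvd_def by metis
    have d'0: "d' > 0" using less.prems(1) p1 d' by (simp add: zero_less_mult_iff)
    have "d' * z y = (\<Sum>c\<in>C. f' c * co c y)" if "y \<in> Y" for y
    proof -
      have "p * (d' * z y) = p * (\<Sum>c\<in>C. f' c * co c y)"
        using less.prems(2)[OF that] f' by (simp add: d' sum_distrib_left mult.assoc cong: sum.cong)
      then show ?thesis using p1 by simp
    qed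
    then show ?thesis using less.hyps[of d' f'] d'0 d' p1 by simp
  qed
qed

text \<open>Linear conditions on a finite-dimensional space follow from finitely many of them. Each
  new coordinate costs at most one more word \<open>l\<close>.\<close>

lemma finite_annihilator:
  fixes L :: "'a word set"
  assumes "finite A"
  shows "\<exists>L0\<subseteq>L. finite L0 \<and> (\<forall>\<psi>::'a \<Rightarrow> rat. (\<forall>a. a \<notin> A \<longrightarrow> \<psi> a = 0) \<longrightarrow>
    (\<forall>w\<in>L0. word_sum \<psi> w = 0) \<longrightarrow> (\<forall>w\<in>L. word_sum \<psi> w = 0))"
  using assms
proof (induction A)
  case empty
  have "word_sum \<psi> w = 0" if "\<forall>a. \<psi> a = 0" for \<psi> :: "'a \<Rightarrow> rat" and w
    using that by (induction w) (auto simp: word_sum_Cons)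
  then show ?case by auto
next
  case (insert a A)
  then obtain L0 where L0: "L0 \<subseteq> L" "finite L0"
    "\<And>\<psi>::'a \<Rightarrow> rat. (\<forall>a. a \<notin> A \<longrightarrow> \<psi> a = 0) \<Longrightarrow> (\<forall>w\<in>L0. word_sum \<psi> w = 0) \<Longrightarrow> (\<forall>w\<in>L. word_sum \<psi> w = 0)"
    by meson
  show ?case
  proof (cases "\<forall>\<psi>::'a \<Rightarrow> rat. (\<forall>b. b \<notin> insert a A \<longrightarrow> \<psi> b = 0) \<longrightarrow>
      (\<forall>w\<in>L0. word_sum \<psi> w = 0) \<longrightarrow> (\<forall>w\<in>L. word_sum \<psi> w = 0)")
    case True
    then show ?thesis using L0 by blast
  next
    case False
    then obtain \<psi>0 :: "'a \<Rightarrow> rat" and l where p: "\<forall>b. b \<notin> insert a A \<longrightarrow> \<psi>0 b = 0"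
      "\<forall>w\<in>L0. word_sum \<psi>0 w = 0" "l \<in> L" "word_sum \<psi>0 l \<noteq> 0" by blast
    have a0: "\<psi>0 a \<noteq> 0"
    proof
      assume "\<psi>0 a = 0"
      then have "\<forall>b. b \<notin> A \<longrightarrow> \<psi>0 b = 0" using p(1) by auto
      then show False using L0(3) p by blast
    qed
    have K: "\<forall>w\<in>L. word_sum \<psi> w = 0"
      if s: "\<forall>b. b \<notin> insert a A \<longrightarrow> \<psi> b = 0" "\<forall>w\<in>insert l L0. word_sum \<psi> w = 0" for \<psi> :: "'a \<Rightarrow> rat"
    proof -
      \<comment> \<open>This multiple of \<open>\<psi>0\<close> cancels the coordinate at
        \<open>a\<close>, so the hypothesis for \<open>A\<close> applies to the difference;
        evaluation at \<open>l\<close> then gives \<open>t = 0\<close>.\<close>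
      define t where "t = \<psi> a / \<psi>0 a"
      define \<psi>' where "\<psi>' = (\<lambda>b. 1 * \<psi> b + (- t) * \<psi>0 b)"
      have ws: "word_sum \<psi>' w = word_sum \<psi> w - t * word_sum \<psi>0 w" for w
        unfolding \<psi>'_def word_sum_linear by simp
      have "\<forall>b. b \<notin> A \<longrightarrow> \<psi>' b = 0"
      proof (intro allI impI)
        fix b assume "b \<notin> A"
        then show "\<psi>' b = 0" using s(1) p(1) a0 by (cases "b = a") (auto simp: \<psi>'_def t_def)
      qed
      then have z: "\<forall>w\<in>L. word_sum \<psi>' w = 0" using L0(3)[of \<psi>'] s(2) p(2) by (auto simp: ws)
      then have "t = 0" using p(3,4) s(2) by (auto simp: ws)
      then show ?thesis using z by (simp add: ws)
    qed
    show ?thesis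
    proof (intro exI[of _ "insert l L0"] conjI allI impI)
      fix \<psi> :: "'a \<Rightarrow> rat"
      assume "\<forall>b. b \<notin> insert a A \<longrightarrow> \<psi> b = 0" "\<forall>w\<in>insert l L0. word_sum \<psi> w = 0"
      then show "\<forall>w\<in>L. word_sum \<psi> w = 0" by (rule K)
    qed (use L0(1,2) p(3) in auto)
  qed
qed

text \<open>\<open>expo_at h y d w\<close> counts, with sign, the occurrences of the letter \<open>y\<close> in \<open>w\<close> whose lower
  end lies at height \<open>d\<close>, where \<open>w\<close> starts at height \<open>0\<close> and a letter \<open>z\<close> climbs by \<open>h z\<close>. These
  numbers are the coefficients of the lift of \<open>w\<close> to an infinite cyclic cover.\<close>

fun expo_at :: "('a \<Rightarrow> int) \<Rightarrow> 'a \<Rightarrow> int \<Rightarrow> 'a word \<Rightarrow> int" where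
  "expo_at h y d [] = 0"
| "expo_at h y d ((z, True) # w) = of_bool (z = y \<and> d = 0) + expo_at h y (d - h z) w"
| "expo_at h y d ((z, False) # w) = - of_bool (z = y \<and> d = - h z) + expo_at h y (d + h z) w"

lemma expo_at_bound: "\<exists>B\<ge>0. \<forall>y d. expo_at h y d w \<noteq> 0 \<longrightarrow> \<bar>d\<bar> \<le> B"
proof (induction w)
  case (Cons l w)
  then obtain B where B: "B \<ge> 0" "\<And>y d. expo_at h y d w \<noteq> 0 \<Longrightarrow> \<bar>d\<bar> \<le> B" by blast
  obtain z s where l: "l = (z, s)" by (cases l)
  have "\<bar>d\<bar> \<le> B + \<bar>h z\<bar>" if "expo_at h y d (l # w) \<noteq> 0" for y d
    using that B(1) B(2)[of y "d - h z"] B(2)[of y "d + h z"] unfolding l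
    by (cases s; cases "d = 0"; cases "d = - h z") force+
  then show ?case using B(1) by (metis abs_ge_zero add_nonneg_nonneg)
qed (auto intro: exI[of _ 0])

text \<open>Forgetting heights projects a lift back to the word. The window of heights has to widen
  with every letter, because a first letter shifts all later heights.\<close>

lemma sum_expo_at:
  assumes "\<And>d. expo_at h y d w \<noteq> 0 \<Longrightarrow> d \<in> D" "finite D"
  shows "(\<Sum>d\<in>D. expo_at h y d w) = expo y w"
proof -
  have shift: "(\<Sum>d\<in>{-C..C}. expo_at h y (d - t) w) = (\<Sum>d\<in>{-B..B}. expo_at h y d w)"
    if "\<forall>d. expo_at h y d w \<noteq> 0 \<longrightarrow> \<bar>d\<bar> \<le> B" "C \<ge> B + \<bar>t\<bar>" for B C t w
  proof -
    have "(\<Sum>d\<in>{-C..C}. expo_at h y (d - t) w) = (\<Sum>d\<in>{-C - t..C - t}. expo_at h y d w)"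
      by (rule sum.reindex_bij_witness[of _ "\<lambda>d. d + t" "\<lambda>d. d - t"]) auto
    also have "\<dots> = (\<Sum>d\<in>{-B..B}. expo_at h y d w)"
    proof (rule sum.mono_neutral_right)
      show "{-B..B} \<subseteq> {-C - t..C - t}" using that(2) by auto
      show "\<forall>d\<in>{-C - t..C - t} - {-B..B}. expo_at h y d w = 0" using that(1) by fastforce
    qed simp
    finally show ?thesis .
  qed
  have main: "\<exists>B\<ge>0. (\<forall>d. expo_at h y d w \<noteq> 0 \<longrightarrow> \<bar>d\<bar> \<le> B) \<and> (\<Sum>d\<in>{-B..B}. expo_at h y d w) = expo y w" for w
  proof (induction w)
    case (Cons l w)
    then obtain B where B: "B \<ge> 0" "\<forall>d. expo_at h y d w \<noteq> 0 \<longrightarrow> \<bar>d\<bar> \<le> B"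
      "(\<Sum>d\<in>{-B..B}. expo_at h y d w) = expo y w" by blast
    obtain z s where l: "l = (z, s)" by (cases l)
    let ?C = "B + \<bar>h z\<bar>"
    have "\<bar>d\<bar> \<le> ?C" if "expo_at h y d (l # w) \<noteq> 0" for d
      using that B(1) B(2)[rule_format, of "d - h z"] B(2)[rule_format, of "d + h z"] unfolding l
      by (cases s; cases "d = 0"; cases "d = - h z") force+
    moreover have "(\<Sum>d\<in>{-?C..?C}. expo_at h y d (l # w)) = expo y (l # w)"
    proof (cases s)
      case True
      have "(\<Sum>d\<in>{-?C..?C}. of_bool (z = y \<and> d = 0) :: int) = of_bool (z = y)"
        using B(1) by (cases "z = y") (auto simp: of_bool_def)
      then show ?thesis using shift[OF B(2), of "h z" ?C] B(3) True by (simp add: l sum.distrib)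
    next
      case False
      have "(\<Sum>d\<in>{-?C..?C}. of_bool (z = y \<and> d = - h z) :: int) = of_bool (z = y)"
        using B(1) by (cases "z = y") (auto simp: of_bool_def)
      then show ?thesis using shift[OF B(2), of "- h z" ?C] B(3) False by (simp add: l sum_subtractf)
    qed
    ultimately show ?case using B(1) by (intro exI[of _ ?C]) auto
  qed (auto intro: exI[of _ 0])
  then obtain B where B: "\<forall>d. expo_at h y d w \<noteq> 0 \<longrightarrow> \<bar>d\<bar> \<le> B"
    "(\<Sum>d\<in>{-B..B}. expo_at h y d w) = expo y w" by metis
  have "(\<Sum>d\<in>D. expo_at h y d w) = (\<Sum>d\<in>{-B..B}. expo_at h y d w)"
  proof (rule sum.mono_neutral_cong)
    show "expo_at h y d w = 0" if "d \<in> D - {- B..B}" for d using that B(1) by force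
    show "expo_at h y d w = 0" if "d \<in> {- B..B} - D" for d using that assms(1) by blast
  qed (use assms(2) in auto)
  then show ?thesis using B(2) by simp
qed

text \<open>Independence modulo \<open>p\<close> passes to infinite cyclic covers: a relation between the lifts is
  divisible by \<open>t - 1\<close> because it projects to a relation downstairs, and the quotient \<open>\<mu>\<close> is
  again a relation, with smaller support.\<close>

lemma indep_cover:
  fixes k :: "'a word \<Rightarrow> int \<Rightarrow> int"
  assumes ind: "indep p C Y (\<lambda>c y. expo y c)" and "finite C" "finite D"
    and D: "\<And>c y d. c \<in> C \<Longrightarrow> expo_at h y d c \<noteq> 0 \<Longrightarrow> d \<in> D"
    and "\<And>c t. c \<in> C \<Longrightarrow> t \<notin> {a..<a + int n} \<Longrightarrow> p dvd k c t"
    and "\<And>y s. y \<in> Y \<Longrightarrow> p dvd (\<Sum>c\<in>C. \<Sum>d\<in>D. expo_at h y d c * k c (s - d))"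
    and "c \<in> C"
  shows "p dvd k c t"
  using assms(5-)
proof (induction n arbitrary: k c t)
  case 0
  then show ?case by simp
next
  case (Suc n)
  obtain B where B: "\<And>d. d \<in> D \<Longrightarrow> \<bar>d\<bar> \<le> B" "B \<ge> 0"
    using finite_imageI[OF \<open>finite D\<close>, of abs] bdd_above_finite
    by (metis abs_ge_zero bdd_above.unfold imageI max.cobounded1 max.coboundedI2)
  \<comment> \<open>From below \<open>lo\<close> no displacement in \<open>D\<close> reaches the
    window where \<open>k\<close> may be nonzero modulo \<open>p\<close>.\<close>
  define lo where "lo = a - B"
  \<comment> \<open>Division by \<open>t - 1\<close> amounts to summation from below;
    \<open>k\<close> is recovered from consecutive values of \<open>\<mu>\<close>.\<close>
  define \<mu> where "\<mu> c t = (\<Sum>j\<in>{a..t}. k c j)" for c t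
  have out: "p dvd (\<Sum>j\<in>J. k c j)" if "c \<in> C" "J \<inter> {a..<a + int (Suc n)} = {}" for c J
    using Suc.prems(1)[OF that(1)] that(2) by (intro dvd_sum) blast
  have psum: "p dvd (\<Sum>c\<in>C. \<Sum>d\<in>D. expo_at h y d c * \<mu> c (s - d))" if y: "y \<in> Y" for y s
  proof -
    have "p dvd (\<Sum>s'\<in>{lo..s}. k c (s' - d)) - \<mu> c (s - d)" if "c \<in> C" "d \<in> D" for c d
    proof -
      have "(\<Sum>s'\<in>{lo..s}. k c (s' - d)) = (\<Sum>j\<in>{lo - d..s - d}. k c j)"
        by (rule sum.reindex_bij_witness[of _ "\<lambda>j. j + d" "\<lambda>s. s - d"]) auto
      moreover have "lo - d \<le> a" using B(1)[OF that(2)] by (simp add: lo_def)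
      then have "(\<Sum>j\<in>{lo - d..s - d}. k c j) - \<mu> c (s - d) = (\<Sum>j\<in>{lo - d..s - d} - {a..s - d}. k c j)"
        unfolding \<mu>_def by (subst sum_diff) auto
      ultimately show ?thesis using out[OF that(1), of "{lo - d..s - d} - {a..s - d}"] by force
    qed
    then have "p dvd (\<Sum>c\<in>C. \<Sum>d\<in>D. expo_at h y d c * ((\<Sum>s'\<in>{lo..s}. k c (s' - d)) - \<mu> c (s - d)))"
      by (intro dvd_sum dvd_mult) auto
    also have "\<dots> = (\<Sum>s'\<in>{lo..s}. \<Sum>c\<in>C. \<Sum>d\<in>D. expo_at h y d c * k c (s' - d))
        - (\<Sum>c\<in>C. \<Sum>d\<in>D. expo_at h y d c * \<mu> c (s - d))"
      by (simp add: right_diff_distrib sum_subtractf sum_distrib_left sum.swap[of _ _ "{lo..s}"])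
    finally show ?thesis
      using dvd_diff_right_iff[of p] dvd_sum[of "{lo..s}" p] Suc.prems(2)[OF y]
      by (metis (no_types, lifting))
  qed
  define T where "T c = (\<Sum>j\<in>{a..<a + int (Suc n)}. k c j)" for c
  have tot: "p dvd T c" if c: "c \<in> C" for c
  proof (rule indepD[OF ind _ c, of "T"])
    fix y assume y: "y \<in> Y"
    \<comment> \<open>At this height every displaced partial sum has passed the whole window, hence
      equals the total \<open>T c\<close> modulo \<open>p\<close>.\<close>
    have "p dvd \<mu> c (a + int n + B - d) - T c" if "c \<in> C" "d \<in> D" for c d
    proof -
      have "a + int n \<le> a + int n + B - d" using B(1)[OF that(2)] by linarith
      then have "\<mu> c (a + int n + B - d) - T c
          = (\<Sum>j\<in>{a..a + int n + B - d} - {a..<a + int (Suc n)}. k c j)"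
        unfolding \<mu>_def T_def by (subst sum_diff) auto
      then show ?thesis
        using out[OF that(1), of "{a..a + int n + B - d} - {a..<a + int (Suc n)}"]
        by (metis Diff_disjoint inf_commute)
    qed
    then have "p dvd (\<Sum>c\<in>C. \<Sum>d\<in>D. expo_at h y d c * (\<mu> c (a + int n + B - d) - T c))"
      by (intro dvd_sum dvd_mult) auto
    also have "\<dots> = (\<Sum>c\<in>C. \<Sum>d\<in>D. expo_at h y d c * \<mu> c (a + int n + B - d))
        - (\<Sum>c\<in>C. T c * (\<Sum>d\<in>D. expo_at h y d c))"
      by (simp add: right_diff_distrib sum_subtractf sum_distrib_left mult.commute)
    also have "(\<Sum>c\<in>C. T c * (\<Sum>d\<in>D. expo_at h y d c))
        = (\<Sum>c\<in>C. T c * expo y c)"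
      using D \<open>finite D\<close> by (intro sum.cong refl arg_cong2[of _ _ _ _ "(*)"] sum_expo_at) auto
    finally show "p dvd (\<Sum>c\<in>C. T c * expo y c)"
      using psum[OF y] dvd_diff_right_iff by blast
  qed
  \<comment> \<open>From \<open>a + int n\<close> on the partial sums agree with \<open>T c\<close>
    modulo \<open>p\<close>, so they are divisible by \<open>p\<close>: the window has lost its last
    place.\<close>
  have "p dvd \<mu> c t" if c: "c \<in> C" for c t
  proof (rule Suc.IH[OF _ psum c])
    fix c t assume c: "c \<in> C" and t: "t \<notin> {a..<a + int n}"
    show "p dvd \<mu> c t"
    proof (cases "t < a")
      case False
      then have "\<mu> c t = T c + (\<Sum>j\<in>{a..t} - {a..<a + int (Suc n)}. k c j)"
        unfolding \<mu>_def T_def using t by (subst sum_diff) auto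
      then show ?thesis using tot[OF c] out[OF c, of "{a..t} - {a..<a + int (Suc n)}"] by fastforce
    qed (simp add: \<mu>_def)
  qed
  then have "p dvd \<mu> c t - \<mu> c (t - 1)" using Suc.prems(3) by simp
  moreover have "k c t = \<mu> c t - \<mu> c (t - 1)" if "t \<ge> a"
  proof -
    have "{a..t} = insert t {a..t - 1}" using that by auto
    then show ?thesis by (simp add: \<mu>_def)
  qed
  ultimately show ?case using Suc.prems(1)[OF Suc.prems(3), of t] by fastforce
qed

section \<open>Labelled graphs and towers of cyclic covers\<close>

text \<open>An edge \<open>(i, e, j)\<close> runs from the vertex \<open>i\<close> to the vertex \<open>j\<close> and carries the label \<open>e\<close>;
  an edge path is a word in the edges.\<close>

type_synonym 'e edge = "int \<times> 'e \<times> int"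

definition esrc :: "'e edge \<Rightarrow> int" where "esrc y = fst y"
definition elab :: "'e edge \<Rightarrow> 'e" where "elab y = fst (snd y)"
definition etgt :: "'e edge \<Rightarrow> int" where "etgt y = snd (snd y)"

lemma edge_simps [simp]: "esrc (i, e, j) = i" "elab (i, e, j) = e" "etgt (i, e, j) = j"
  by (auto simp: esrc_def elab_def etgt_def)

lemma edge_collapse: "(esrc y, elab y, etgt y) = y"
  by (cases y) auto

fun path :: "int \<Rightarrow> 'e edge word \<Rightarrow> int \<Rightarrow> bool" where
  "path i [] j \<longleftrightarrow> i = j"
| "path i ((y, s) # \<pi>) j \<longleftrightarrow>
     (if s then i = esrc y \<and> path (etgt y) \<pi> j else i = etgt y \<and> path (esrc y) \<pi> j)"

definition lab :: "'e edge word \<Rightarrow> 'e word" where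
  "lab \<pi> = map (\<lambda>(y, s). (elab y, s)) \<pi>"

lemma lab_simps [simp]:
  "lab [] = []" "lab (\<pi> @ \<pi>') = lab \<pi> @ lab \<pi>'" "lab ((y, s) # \<pi>) = (elab y, s) # lab \<pi>"
  "lab (winv \<pi>) = winv (lab \<pi>)" "length (lab \<pi>) = length \<pi>"
  by (auto simp: lab_def winv_def rev_map inv_letter_def comp_def case_prod_beta)

lemma path_append: "path i (\<pi> @ \<pi>') j \<longleftrightarrow> (\<exists>k. path i \<pi> k \<and> path k \<pi>' j)"
  by (induction i \<pi> j rule: path.induct) auto

lemma path_winv: "path i \<pi> j \<Longrightarrow> path j (winv \<pi>) i"
  by (induction i \<pi> j rule: path.induct) (auto simp: path_append inv_letter_def split: if_splits)

lemma word_sum_coboundary: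
  assumes "path i \<pi> j" "\<And>y. y \<in> fst ` set \<pi> \<Longrightarrow> h y = f (etgt y) - f (esrc y)"
  shows "word_sum h \<pi> = f j - f i"
  using assms by (induction i \<pi> j rule: path.induct) (auto split: if_splits)

lemma expo_lab: "finite Y \<Longrightarrow> fst ` set \<pi> \<subseteq> Y \<Longrightarrow> expo e (lab \<pi>) = (\<Sum>y\<in>{y\<in>Y. elab y = e}. expo y \<pi>)"
proof (induction \<pi>)
  case (Cons l \<pi>)
  obtain y s where l: "l = (y, s)" by (cases l)
  have "(\<Sum>z\<in>{z\<in>Y. elab z = e}. if y = z then if s then 1 else -1 else 0) =
      (if elab y = e then if s then 1 else -1 else (0::int))"
    using Cons.prems by (subst sum.delta') (auto simp: l)
  then show ?case using Cons by (simp add: l sum.distrib)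
qed simp

text \<open>Each label acts as a strictly increasing partial map on the vertices. In particular the
  graph is folded: a label and one end determine the edge.\<close>

definition monotone_edges :: "'e edge set \<Rightarrow> bool" where
  "monotone_edges D \<longleftrightarrow>
     (\<forall>y\<in>D. \<forall>z\<in>D. elab y = elab z \<longrightarrow> (esrc y < esrc z \<longleftrightarrow> etgt y < etgt z))"

lemma monotone_edges_less:
  "monotone_edges D \<Longrightarrow> y \<in> D \<Longrightarrow> z \<in> D \<Longrightarrow> elab y = elab z \<Longrightarrow> esrc y < esrc z \<longleftrightarrow> etgt y < etgt z"
  unfolding monotone_edges_def by blast

lemma monotone_edges_eq:
  "monotone_edges D \<Longrightarrow> y \<in> D \<Longrightarrow> z \<in> D \<Longrightarrow> elab y = elab z \<Longrightarrow> esrc y = esrc z \<longleftrightarrow> etgt y = etgt z"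
  using monotone_edges_less[of D y z] monotone_edges_less[of D z y] by force

lemma path_unique:
  assumes "monotone_edges D" "path i \<pi> j" "path i \<pi>' j'" "fst ` set \<pi> \<subseteq> D" "fst ` set \<pi>' \<subseteq> D"
    "lab \<pi> = lab \<pi>'"
  shows "\<pi> = \<pi>'"
  using assms(2-)
proof (induction \<pi> arbitrary: i \<pi>')
  case Nil
  then show ?case by (cases \<pi>') (auto simp: lab_def)
next
  case (Cons l \<pi>)
  obtain y s where l: "l = (y, s)" by (cases l)
  obtain z \<pi>2 where p': "\<pi>' = (z, s) # \<pi>2" "elab y = elab z" "lab \<pi> = lab \<pi>2"
    using Cons.prems(5) by (cases \<pi>') (auto simp: l lab_def)
  have "y \<in> D" "z \<in> D" using Cons.prems by (auto simp: l p')
  then have "esrc y = esrc z \<longleftrightarrow> etgt y = etgt z"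
    by (rule monotone_edges_eq[OF assms(1) _ _ p'(2)])
  then have "y = z"
    using Cons.prems(1,2) p' by (metis edge_collapse l path.simps(2))
  then show ?case using Cons p' by (auto simp: l split: if_splits)
qed

text \<open>Cells are recorded as closed paths with a base point; in a folded graph a nonempty
  relator and its start determine the cell.\<close>

definition cells :: "'e edge set \<Rightarrow> 'e word set \<Rightarrow> 'e edge word set" where
  "cells D R = {\<pi>. fst ` set \<pi> \<subseteq> D \<and> lab \<pi> \<in> R \<and> (\<exists>i. path i \<pi> i)}"

text \<open>The empty path is closed at every vertex, so its arbitrary \<open>pstart\<close> is
  harmless in \<open>cells_path\<close>.\<close>

definition pstart :: "'e edge word \<Rightarrow> int" where
  "pstart \<pi> = (case hd \<pi> of (y, s) \<Rightarrow> if s then esrc y else etgt y)"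

lemma path_pstart: "path i \<pi> j \<Longrightarrow> \<pi> \<noteq> [] \<Longrightarrow> i = pstart \<pi>"
  by (cases \<pi>) (auto simp: pstart_def split: if_splits)

lemma cells_path: "\<pi> \<in> cells D R \<Longrightarrow> path (pstart \<pi>) \<pi> (pstart \<pi>)"
  using path_pstart[of _ \<pi>] by (cases "\<pi> = []") (force simp: cells_def)+

lemma finite_cells:
  assumes "finite D" "finite R"
  shows "finite (cells D R)"
proof (rule finite_subset)
  have "finite {\<pi>. set \<pi> \<subseteq> D \<times> (UNIV :: bool set) \<and> length \<pi> = n}" for n
    using assms(1) by (intro finite_lists_length_eq) simp
  then show "finite (\<Union>n\<in>length ` R. {\<pi>. set \<pi> \<subseteq> D \<times> (UNIV :: bool set) \<and> length \<pi> = n})"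
    using assms(2) by simp
  show "cells D R \<subseteq> (\<Union>n\<in>length ` R. {\<pi>. set \<pi> \<subseteq> D \<times> UNIV \<and> length \<pi> = n})"
  proof
    fix \<pi> assume "\<pi> \<in> cells D R"
    then have "set \<pi> \<subseteq> D \<times> UNIV" "lab \<pi> \<in> R" by (auto simp: cells_def image_subset_iff)
    then show "\<pi> \<in> (\<Union>n\<in>length ` R. {\<pi>. set \<pi> \<subseteq> D \<times> UNIV \<and> length \<pi> = n})"
      by (intro UN_I[of "length \<pi>"] image_eqI[of _ _ "lab \<pi>"]) auto
  qed
qed

lemma cells_mono: "D \<subseteq> D' \<Longrightarrow> R \<subseteq> R' \<Longrightarrow> cells D R \<subseteq> cells D' R'"
  unfolding cells_def by blast

text \<open>The first rational cohomology of the complex with edges \<open>S\<close> and all cells over \<open>R\<close>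
  vanishes.\<close>

definition H1_trivial :: "'e word set \<Rightarrow> 'e edge set \<Rightarrow> bool" where
  "H1_trivial R S \<longleftrightarrow> (\<forall>h::'e edge \<Rightarrow> rat. (\<forall>\<pi>\<in>cells S R. word_sum h \<pi> = 0) \<longrightarrow>
     (\<exists>f. \<forall>y\<in>S. h y = f (etgt y) - f (esrc y)))"

section \<open>Finite balls of words and their labelled quotients\<close>

definition words_upto :: "nat \<Rightarrow> 'e set \<Rightarrow> 'e word set" where
  "words_upto n E = {w. length w \<le> n \<and> fst ` set w \<subseteq> E}"

lemma finite_words_upto: "finite E \<Longrightarrow> finite (words_upto n E)"
  by (rule finite_subset[OF _ finite_lists_length_le[of "E \<times> UNIV" n]])
    (auto simp: words_upto_def image_subset_iff)

lemma words_upto_append: "u @ v \<in> words_upto n E \<Longrightarrow> u \<in> words_upto n E"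
  by (auto simp: words_upto_def)

text \<open>A vertex labelling \<open>\<rho>\<close> of the words in \<open>P\<close>, a subtree of the Cayley tree of the free group,
  turns its quotient by the fibres of \<open>\<rho>\<close> into a labelled graph.\<close>

definition word_edge :: "('e word \<Rightarrow> int) \<Rightarrow> 'e word \<Rightarrow> 'e \<times> bool \<Rightarrow> 'e edge" where
  "word_edge \<rho> p l = (if snd l then (\<rho> p, fst l, \<rho> (p @ [l])) else (\<rho> (p @ [l]), fst l, \<rho> p))"

definition word_graph :: "'e word set \<Rightarrow> ('e word \<Rightarrow> int) \<Rightarrow> 'e edge set" where
  "word_graph P \<rho> = {word_edge \<rho> p l | p l. p @ [l] \<in> P}"

lemma word_graphI: "p @ [l] \<in> P \<Longrightarrow> word_edge \<rho> p l \<in> word_graph P \<rho>"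
  unfolding word_graph_def by blast

fun word_path :: "('e word \<Rightarrow> int) \<Rightarrow> 'e word \<Rightarrow> 'e word \<Rightarrow> 'e edge word" where
  "word_path \<rho> p [] = []"
| "word_path \<rho> p (l # w) = (word_edge \<rho> p l, snd l) # word_path \<rho> (p @ [l]) w"

lemma word_path_append: "word_path \<rho> p (u @ v) = word_path \<rho> p u @ word_path \<rho> (p @ u) v"
  by (induction u arbitrary: p) auto

lemma path_word_path: "path (\<rho> p) (word_path \<rho> p w) (\<rho> (p @ w))"
proof (induction w arbitrary: p)
  case (Cons l w)
  then show ?case using Cons[of "p @ [l]"] by (auto simp: word_edge_def)
qed simp

lemma lab_word_path: "lab (word_path \<rho> p w) = w"
  by (induction w arbitrary: p) (auto simp: word_edge_def)

lemma finite_word_graph: "finite P \<Longrightarrow> finite (word_graph P \<rho>)"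
proof -
  assume "finite P"
  have "word_graph P \<rho> \<subseteq> (\<lambda>w. word_edge \<rho> (butlast w) (last w)) ` P"
    unfolding word_graph_def by force
  then show ?thesis using \<open>finite P\<close> finite_surj by blast
qed

text \<open>The second condition makes every relator close up wherever it can be read inside
  \<open>P\<close>, so the quotient graph carries the corresponding cells.\<close>

definition good_labelling :: "'e word set \<Rightarrow> 'e word set \<Rightarrow> ('e word \<Rightarrow> int) \<Rightarrow> bool" where
  "good_labelling R P \<rho> \<longleftrightarrow> monotone_edges (word_graph P \<rho>) \<and>
     (\<forall>u r. r \<in> R \<longrightarrow> u @ r \<in> P \<longrightarrow> \<rho> (u @ r) = \<rho> u)"

lemma word_path_graph:
  assumes "p @ w \<in> words_upto n E"
  shows "fst ` set (word_path \<rho> p w) \<subseteq> word_graph (words_upto n E) \<rho>"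
  using assms
proof (induction w arbitrary: p)
  case (Cons l w)
  have "p @ [l] \<in> words_upto n E" using Cons.prems words_upto_append[of "p @ [l]" w] by simp
  then show ?case using Cons.IH[of "p @ [l]"] Cons.prems by (simp add: word_graphI)
qed simp

lemma good_step:
  assumes g: "good_labelling R P \<rho>" and "\<rho> p = \<rho> q" "p @ [l] \<in> P" "q @ [l] \<in> P"
  shows "\<rho> (p @ [l]) = \<rho> (q @ [l])"
proof -
  have "word_edge \<rho> p l \<in> word_graph P \<rho>" "word_edge \<rho> q l \<in> word_graph P \<rho>"
    using assms(3,4) by (simp_all add: word_graphI)
  moreover have "monotone_edges (word_graph P \<rho>)" using g by (simp add: good_labelling_def)
  ultimately show ?thesis
    using monotone_edges_eq[of "word_graph P \<rho>" "word_edge \<rho> p l" "word_edge \<rho> q l"] assms(2)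
    by (auto simp: word_edge_def split: if_splits)
qed

text \<open>The edges for \<open>l\<close> and for the way back have the same label and share the
  vertex \<open>\<rho> (p @ [l])\<close>; in a folded graph their other ends agree.\<close>

lemma good_back:
  assumes g: "good_labelling R (words_upto n E) \<rho>" and "p @ [l, inv_letter l] \<in> words_upto n E"
  shows "\<rho> (p @ [l, inv_letter l]) = \<rho> p"
proof -
  have "p @ [l] \<in> words_upto n E" using assms(2) words_upto_append[of "p @ [l]" "[inv_letter l]"] by simp
  then have "word_edge \<rho> p l \<in> word_graph (words_upto n E) \<rho>"
    "word_edge \<rho> (p @ [l]) (inv_letter l) \<in> word_graph (words_upto n E) \<rho>"
    using assms(2) by (auto intro!: word_graphI)
  moreover have "monotone_edges (word_graph (words_upto n E) \<rho>)" using g by (simp add: good_labelling_def)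
  ultimately show ?thesis
    using monotone_edges_eq[of "word_graph (words_upto n E) \<rho>" "word_edge \<rho> p l" "word_edge \<rho> (p @ [l]) (inv_letter l)"]
    by (auto simp: word_edge_def inv_letter_def split: if_splits)
qed

lemma good_append:
  assumes g: "good_labelling R (words_upto n E) \<rho>" and "\<rho> p = \<rho> q"
    "p @ w \<in> words_upto n E" "q @ w \<in> words_upto n E"
  shows "\<rho> (p @ w) = \<rho> (q @ w) \<and> word_path \<rho> p w = word_path \<rho> q w"
  using assms(2-)
proof (induction w arbitrary: p q)
  case (Cons l w)
  have "p @ [l] \<in> words_upto n E" "q @ [l] \<in> words_upto n E"
    using Cons.prems words_upto_append[of "p @ [l]" w] words_upto_append[of "q @ [l]" w] by auto
  then have "\<rho> (p @ [l]) = \<rho> (q @ [l])" by (rule good_step[OF g Cons.prems(1)])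
  then show ?case using Cons.IH[of "p @ [l]" "q @ [l]"] Cons.prems by (simp add: word_edge_def)
qed simp

lemma good_cancel:
  assumes g: "good_labelling R (words_upto n E) \<rho>" and "p @ w @ winv w \<in> words_upto n E"
  shows "\<rho> (p @ w @ winv w) = \<rho> p \<and> word_sum h (word_path \<rho> p (w @ winv w)) = 0"
  using assms(2)
proof (induction w arbitrary: p)
  case (Cons l w)
  have P: "p @ [l] @ w @ winv w @ [inv_letter l] \<in> words_upto n E" using Cons.prems by simp
  then have P1: "(p @ [l]) @ w @ winv w \<in> words_upto n E"
    using words_upto_append[of "(p @ [l]) @ w @ winv w" "[inv_letter l]"] by simp
  have P2: "p @ [l, inv_letter l] \<in> words_upto n E"
    using P by (auto simp: words_upto_def)
  note IH = Cons.IH[OF P1]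
  have st: "\<rho> (((p @ [l]) @ w @ winv w) @ [inv_letter l]) = \<rho> ((p @ [l]) @ [inv_letter l])
     \<and> word_path \<rho> ((p @ [l]) @ w @ winv w) [inv_letter l] = word_path \<rho> (p @ [l]) [inv_letter l]"
    using P P2 by (intro good_append[OF g]) (use IH in auto)
  have b: "\<rho> (p @ [l, inv_letter l]) = \<rho> p" by (rule good_back[OF g P2])
  have "word_sum h (word_path \<rho> p ((l # w) @ winv (l # w)))
     = word_sum h [(word_edge \<rho> p l, snd l)] + word_sum h (word_path \<rho> (p @ [l]) (w @ winv w))
      + word_sum h (word_path \<rho> ((p @ [l]) @ w @ winv w) [inv_letter l])"
    by (simp add: word_path_append word_sum_Cons)
  also have "word_sum h (word_path \<rho> ((p @ [l]) @ w @ winv w) [inv_letter l])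
      = - word_sum h [(word_edge \<rho> p l, snd l)]"
    unfolding conjunct2[OF st] using b by (auto simp: word_edge_def inv_letter_def word_sum_Cons)
  finally show ?case using st b IH by simp
qed simp

text \<open>A derivation passes through finitely many words. Once the ball contains them all,
  foldedness and closed relators force \<open>w\<close> to close up, whatever the labelling; hence
  one ball can be fixed for the whole tower.\<close>

lemma good_null_word:
  assumes "null_word R w"
  shows "\<exists>n0 E0. finite E0 \<and>
    (\<forall>n E \<rho>. n0 \<le> n \<longrightarrow> E0 \<subseteq> E \<longrightarrow> good_labelling R (words_upto n E) \<rho> \<longrightarrow> \<rho> w = \<rho> [])"
    (is "\<exists>n0 E0. ?Q w n0 E0")
proof -
  have ext: "\<exists>n0 E0. ?Q w' n0 E0"
    if ex: "\<exists>n0 E0. ?Q w n0 E0"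
      and eq: "\<And>n E \<rho>. good_labelling R (words_upto n E) \<rho> \<Longrightarrow> w \<in> words_upto n E \<Longrightarrow> w' \<in> words_upto n E \<Longrightarrow> \<rho> w' = \<rho> w"
    for w w'
  proof -
    obtain n0 E0 where 1: "?Q w n0 E0" using ex by (elim exE)
    have "?Q w' (n0 + length w + length w') (E0 \<union> fst ` set w \<union> fst ` set w')"
    proof (intro conjI allI impI)
      fix n E \<rho>
      assume n: "n0 + length w + length w' \<le> n" and E: "E0 \<union> fst ` set w \<union> fst ` set w' \<subseteq> E"
        and g: "good_labelling R (words_upto n E) \<rho>"
      have "\<rho> w' = \<rho> w" by (rule eq[OF g]) (use n E in \<open>auto simp: words_upto_def\<close>)
      also have "\<rho> w = \<rho> []" by (rule 1[THEN conjunct2, rule_format, OF _ _ g]) (use n E in auto)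
      finally show "\<rho> w' = \<rho> []" .
    qed (use 1 in simp)
    then show ?thesis by (intro exI)
  qed
  have mid: "\<rho> (u @ m @ v) = \<rho> (u @ v)"
    if "good_labelling R (words_upto n E) \<rho>" "u @ v \<in> words_upto n E" "u @ m @ v \<in> words_upto n E" "\<rho> (u @ m) = \<rho> u"
    for n E \<rho> u m v
    using good_append[OF that(1,4), of v] that(2,3) by simp
  have bk: "\<rho> (u @ [l, inv_letter l]) = \<rho> u"
    if "good_labelling R (words_upto n E) \<rho>" "u @ [l, inv_letter l] @ v \<in> words_upto n E" for n E \<rho> u l v
    using good_back[OF that(1)] words_upto_append[of "u @ [l, inv_letter l]" v] that(2) by simp
  have rl: "\<rho> (u @ r) = \<rho> u"
    if "good_labelling R (words_upto n E) \<rho>" "r \<in> R" "u @ r @ v \<in> words_upto n E" for n E \<rho> u r v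
    using that words_upto_append[of "u @ r" v] by (simp add: good_labelling_def)
  show ?thesis
    using assms
  proof induction
    case null_Nil
    show ?case by (intro exI[of _ 0] exI[of _ "{}"]) simp
  next
    case (null_cancel u v l)
    show ?case by (rule ext[OF null_cancel.IH]) (rule mid; (assumption | erule (1) bk))
  next
    case (null_uncancel u l v)
    show ?case by (rule ext[OF null_uncancel.IH], rule mid[symmetric]) (assumption | erule (1) bk)+
  next
    case (null_insert u v r)
    show ?case by (rule ext[OF null_insert.IH]) (rule mid; (assumption | erule (1) rl[OF _ null_insert.hyps(2)]))
  next
    case (null_delete u r v)
    show ?case by (rule ext[OF null_delete.IH], rule mid[symmetric]) (assumption | erule (1) rl[OF _ null_delete.hyps(2)])+
  qed
qed

text \<open>Quantifying over \<open>p\<close>, \<open>X\<close> and \<open>R'\<close> lets one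
  inherited property yield both the independence of all cells modulo primes and the rational
  independence of the \<open>x\<close>-parts of the cells over one relator.\<close>

definition label_indep :: "'e word set \<Rightarrow> 'e edge set \<Rightarrow> bool" where
  "label_indep R D \<longleftrightarrow> (\<forall>p X R'. R' \<subseteq> R \<longrightarrow> indep p R' X (\<lambda>r e. expo e r) \<longrightarrow>
     indep p (cells D R') {y\<in>D. elab y \<in> X} (\<lambda>\<pi> y. expo y \<pi>))"

text \<open>One storey of the tower: \<open>f\<close> integrates the cocycle \<open>h\<close>, so that \<open>C * \<rho> + f\<close> labels the
  cyclic cover defined by \<open>h\<close>, its vertices being ordered lexicographically.\<close>

locale cyclic_cover =
  fixes R :: "'e word set" and n :: nat and E :: "'e set" and \<rho> :: "'e word \<Rightarrow> int"
    and h :: "'e edge \<Rightarrow> int"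
  assumes fin: "finite R" "finite E"
    and good: "good_labelling R (words_upto n E) \<rho>"
    and cocycle: "\<pi> \<in> cells (word_graph (words_upto n E) \<rho>) R \<Longrightarrow> word_sum h \<pi> = 0"
begin

abbreviation "P \<equiv> words_upto n E"
abbreviation "D \<equiv> word_graph P \<rho>"

definition f :: "'e word \<Rightarrow> int" where "f p = word_sum h (word_path \<rho> [] p)"
text \<open>On the ball \<open>f\<close> takes values between \<open>-B\<close> and
  \<open>B\<close>, a range of \<open>C\<close> integers. So an integer \<open>i\<close> encodes a
  pair: \<open>q i\<close> is the vertex below and \<open>F i\<close> the height in the
  cover.\<close>

definition B :: int where "B = Max (insert 0 ((\<lambda>p. \<bar>f p\<bar>) ` P))"
definition C :: int where "C = 2 * B + 1"
definition \<rho>' :: "'e word \<Rightarrow> int" where "\<rho>' p = C * \<rho> p + f p"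
definition q :: "int \<Rightarrow> int" where "q i = (i + B) div C"
definition F :: "int \<Rightarrow> int" where "F i = i - C * q i"
definition qe :: "'e edge \<Rightarrow> 'e edge" where "qe y = (q (esrc y), elab y, q (etgt y))"
definition qp :: "'e edge word \<Rightarrow> 'e edge word" where "qp = map (\<lambda>(y, s). (qe y, s))"

abbreviation "D' \<equiv> word_graph P \<rho>'"

lemma finite_P: "finite P"
  by (rule finite_words_upto[OF fin(2)])

lemma f_bound: "p \<in> P \<Longrightarrow> \<bar>f p\<bar> \<le> B"
  unfolding B_def using finite_P by (intro Max_ge) auto

lemma B_nonneg: "B \<ge> 0"
  unfolding B_def using finite_P by (intro Max_ge) auto

lemma C_pos: "C > 0"
  using B_nonneg by (simp add: C_def)

lemma f_append: "f (p @ w) = f p + word_sum h (word_path \<rho> p w)"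
  by (simp add: f_def word_path_append)

lemma q_\<rho>' [simp]: "p \<in> P \<Longrightarrow> q (\<rho>' p) = \<rho> p"
proof -
  assume "p \<in> P"
  then have "0 \<le> f p + B" "f p + B < C" using f_bound[of p] by (auto simp: C_def)
  moreover have "q (\<rho>' p) = ((f p + B) + \<rho> p * C) div C"
    by (simp add: q_def \<rho>'_def algebra_simps)
  ultimately show ?thesis using C_pos by simp
qed

lemma F_\<rho>' [simp]: "p \<in> P \<Longrightarrow> F (\<rho>' p) = f p"
  by (simp add: F_def) (simp add: \<rho>'_def)

lemma F_bound: "\<bar>F i\<bar> \<le> B"
proof -
  have "F i = (i + B) mod C - B" by (simp add: F_def q_def minus_mult_div_eq_mod[symmetric])
  moreover have "0 \<le> (i + B) mod C" "(i + B) mod C < C" using C_pos by auto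
  ultimately show ?thesis unfolding C_def by linarith
qed

lemma q_F: "C * q i + F i = i"
  by (simp add: F_def)

lemma less_iff: "i < j \<longleftrightarrow> q i < q j \<or> q i = q j \<and> F i < F j"
proof -
  have *: "i < j" if "q i < q j" for i j
  proof -
    have "C * (q i + 1) \<le> C * q j" using that B_nonneg by (intro mult_left_mono) (auto simp: C_def)
    then show ?thesis using q_F[of i] q_F[of j] F_bound[of i] F_bound[of j]
      by (simp add: algebra_simps C_def)
  qed
  consider "q i < q j" | "q j < q i" | "q i = q j" by linarith
  then show ?thesis using *[of i j] *[of j i] q_F[of i] q_F[of j] by cases force+
qed

lemma D'E:
  assumes "y \<in> D'"
  shows "qe y \<in> D" "F (etgt y) = F (esrc y) + h (qe y)"
proof -
  obtain p l where pl: "y = word_edge \<rho>' p l" "p @ [l] \<in> P" using assms by (auto simp: word_graph_def)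
  have p: "p \<in> P" using words_upto_append pl(2) by blast
  have qey: "qe y = word_edge \<rho> p l" using pl p by (auto simp: qe_def word_edge_def)
  then show "qe y \<in> D" using pl(2) by (simp add: word_graphI)
  show "F (etgt y) = F (esrc y) + h (qe y)"
    unfolding qey using pl p f_append[of p "[l]"] by (auto simp: word_edge_def word_sum_Cons)
qed

lemma elab_qe [simp]: "elab (qe y) = elab y" "esrc (qe y) = q (esrc y)" "etgt (qe y) = q (etgt y)"
  by (auto simp: qe_def)

lemma monotone_D: "monotone_edges D"
  using good by (simp add: good_labelling_def)

text \<open>The vertices below decide first. If they agree, both edges lie over the same edge, and
  along it both heights change by the same amount \<open>h\<close>.\<close>

lemma monotone_D': "monotone_edges D'"
  unfolding monotone_edges_def
proof (intro ballI impI)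
  fix y z assume yz: "y \<in> D'" "z \<in> D'" "elab y = elab z"
  have 1: "q (esrc y) < q (esrc z) \<longleftrightarrow> q (etgt y) < q (etgt z)"
    "q (esrc y) = q (esrc z) \<longleftrightarrow> q (etgt y) = q (etgt z)"
    using monotone_edges_less[OF monotone_D, of "qe y" "qe z"]
      monotone_edges_eq[OF monotone_D, of "qe y" "qe z"] D'E(1) yz by auto
  have 2: "F (etgt y) - F (esrc y) = F (etgt z) - F (esrc z)" if "q (esrc y) = q (esrc z)"
  proof -
    have "qe y = qe z" using that 1(2) yz(3) by (simp add: qe_def)
    then show ?thesis using D'E(2)[OF yz(1)] D'E(2)[OF yz(2)] by simp
  qed
  show "esrc y < esrc z \<longleftrightarrow> etgt y < etgt z"
    unfolding less_iff[of "esrc y"] less_iff[of "etgt y"] using 1 2 by auto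
qed

text \<open>Reading \<open>r\<close> at \<open>u\<close> traces a cell, on which the cocycle
  vanishes.\<close>

lemma relator_closed:
  assumes "r \<in> R" "u @ r \<in> P"
  shows "\<rho> (u @ r) = \<rho> u" "f (u @ r) = f u"
proof -
  show *: "\<rho> (u @ r) = \<rho> u" using good assms by (simp add: good_labelling_def)
  have "word_path \<rho> u r \<in> cells D R"
    unfolding cells_def using word_path_graph[OF assms(2)] assms(1) path_word_path[of \<rho> u r] *
    by (auto simp: lab_word_path)
  then show "f (u @ r) = f u" using cocycle by (simp add: f_append)
qed

lemma good': "good_labelling R P \<rho>'"
  unfolding good_labelling_def using monotone_D' relator_closed by (simp add: \<rho>'_def)

text \<open>Heights in \<open>expo_at\<close> are relative to the start of the path, which lies at
  height \<open>F i\<close>; hence the argument \<open>s - F i\<close> for edges whose source has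
  absolute height \<open>s\<close>.\<close>

lemma expo_at_qp:
  assumes "path i \<pi> j" "fst ` set \<pi> \<subseteq> D'"
  shows "expo_at h y (s - F i) (qp \<pi>) = word_sum (\<lambda>z. of_bool (qe z = y \<and> F (esrc z) = s)) \<pi>"
  using assms
proof (induction i \<pi> j rule: path.induct)
  case (1 i j)
  then show ?case by (simp add: qp_def)
next
  case (2 i z t \<pi> j)
  have F: "F (etgt z) = F (esrc z) + h (qe z)" using 2(4) D'E(2)[of z] by simp
  show ?case
  proof (cases t)
    case True
    then show ?thesis using 2 F by (auto simp: qp_def algebra_simps)
  next
    case False
    then show ?thesis using 2 F by (auto simp: qp_def algebra_simps)
  qed
qed

lemma path_qp: "path i \<pi> j \<Longrightarrow> path (q i) (qp \<pi>) (q j)"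
  by (induction i \<pi> j rule: path.induct) (auto simp: qp_def split: if_splits)

lemma lab_qp [simp]: "lab (qp \<pi>) = lab \<pi>"
  by (auto simp: lab_def qp_def)

lemma qp_cells:
  assumes "\<pi> \<in> cells D' R'"
  shows "qp \<pi> \<in> cells D R'"
proof -
  have "fst ` set (qp \<pi>) = qe ` fst ` set \<pi>" by (force simp: qp_def)
  then have "fst ` set (qp \<pi>) \<subseteq> D" using assms D'E(1) by (auto simp: cells_def)
  moreover have "path (q (pstart \<pi>)) (qp \<pi>) (q (pstart \<pi>))" by (rule path_qp[OF cells_path[OF assms]])
  ultimately show ?thesis using assms by (auto simp: cells_def)
qed

lemma qp_inj:
  assumes "\<pi>1 \<in> cells D' R'" "\<pi>2 \<in> cells D' R'" "qp \<pi>1 = qp \<pi>2" "F (pstart \<pi>1) = F (pstart \<pi>2)"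
  shows "\<pi>1 = \<pi>2"
proof -
  have "q (pstart \<pi>1) = q (pstart \<pi>2)" if "\<pi>1 \<noteq> []"
  proof -
    have "\<pi>2 \<noteq> []" using that assms(3) by (auto simp: qp_def)
    then show ?thesis
      using that path_pstart[OF path_qp[OF cells_path[OF assms(1)]]]
        path_pstart[OF path_qp[OF cells_path[OF assms(2)]]] assms(3) by (simp add: qp_def)
  qed
  then have "pstart \<pi>1 = pstart \<pi>2 \<or> \<pi>1 = []" using q_F assms(4) by metis
  moreover have "lab \<pi>1 = lab \<pi>2" using assms(3) lab_qp by metis
  ultimately show ?thesis
    using path_unique[OF monotone_D', of "pstart \<pi>1" \<pi>1 "pstart \<pi>1" \<pi>2 "pstart \<pi>2"]
      cells_path[OF assms(1)] cells_path[OF assms(2)] assms(1,2)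
    by (cases "\<pi>1 = []") (auto simp: cells_def lab_def)
qed

text \<open>A relation between cells upstairs is read as a relation between translates of cells
  downstairs, to which \<open>indep_cover\<close> applies.\<close>

lemma indep_D':
  assumes ind: "indep p (cells D R') {y\<in>D. elab y \<in> X} (\<lambda>\<pi> y. expo y \<pi>)" and "finite R'"
  shows "indep p (cells D' R') {y\<in>D'. elab y \<in> X} (\<lambda>\<pi> y. expo y \<pi>)"
  unfolding indep_def
proof (intro allI impI ballI)
  fix k \<pi>0
  assume k: "\<forall>y\<in>{y \<in> D'. elab y \<in> X}. p dvd (\<Sum>\<pi>\<in>cells D' R'. k \<pi> * expo y \<pi>)"
    and \<pi>0: "\<pi>0 \<in> cells D' R'"
  let ?C = "cells D R'" and ?C' = "cells D' R'"
  have finC: "finite ?C" "finite ?C'"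
    using finite_cells[OF finite_word_graph[OF finite_P] assms(2)] by auto
  define bd where "bd c = (SOME b. b \<ge> 0 \<and> (\<forall>y d. expo_at h y d c \<noteq> 0 \<longrightarrow> \<bar>d\<bar> \<le> b))" for c
  have bd: "expo_at h y d c \<noteq> 0 \<Longrightarrow> \<bar>d\<bar> \<le> bd c" for y d c
    using someI_ex[OF expo_at_bound[of h c]] unfolding bd_def by blast
  define T where "T = (\<Union>c\<in>?C. {- bd c..bd c})"
  have finT: "finite T" using finC by (simp add: T_def)
  have T: "d \<in> T" if "c \<in> ?C" "expo_at h y d c \<noteq> 0" for c y d
    using bd[OF that(2)] that(1) by (force simp: T_def)
  \<comment> \<open>Coefficients are indexed by the cell below and the starting height. By
    \<open>qp_inj\<close> each of these sums has at most one term.\<close>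
  define K where "K c t = (\<Sum>\<pi>\<in>{\<pi>\<in>?C'. qp \<pi> = c \<and> F (pstart \<pi>) = t}. k \<pi>)" for c t
  have "p dvd K (qp \<pi>0) (F (pstart \<pi>0))"
  proof (rule indep_cover[where k = K and c = "qp \<pi>0" and t = "F (pstart \<pi>0)" and n = "nat (2 * B + 1)" and a = "- B" and h = h, OF ind finC(1) finT])
    show "d \<in> T" if "c \<in> ?C" "expo_at h y d c \<noteq> 0" for c y d
      using that by (rule T)
  next
    fix c t assume "t \<notin> {- B..<- B + int (nat (2 * B + 1))}"
    then have "F i \<noteq> t" for i using F_bound[of i] B_nonneg by auto
    then show "p dvd K c t" by (simp add: K_def)
  next
    fix y s assume y: "y \<in> {y \<in> D. elab y \<in> X}"
    have K': "K c t = (\<Sum>\<pi>\<in>?C'. if qp \<pi> = c \<and> F (pstart \<pi>) = t then k \<pi> else 0)" for c t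
      unfolding K_def by (rule sum.inter_filter[OF finC(2)])
    have inner: "(\<Sum>c\<in>?C. \<Sum>d\<in>T. expo_at h y d c * (if qp \<pi> = c \<and> F (pstart \<pi>) = s - d then k \<pi> else 0))
        = k \<pi> * word_sum (\<lambda>z. of_bool (qe z = y \<and> F (esrc z) = s)) \<pi>" if \<pi>: "\<pi> \<in> ?C'" for \<pi>
    proof -
      have "(\<Sum>c\<in>?C. \<Sum>d\<in>T. expo_at h y d c * (if qp \<pi> = c \<and> F (pstart \<pi>) = s - d then k \<pi> else 0))
         = (\<Sum>c\<in>?C. if qp \<pi> = c then (\<Sum>d\<in>T. if s - F (pstart \<pi>) = d then expo_at h y d c * k \<pi> else 0) else 0)"
        by (intro sum.cong refl) (auto intro!: sum.cong)
      also have "\<dots> = (\<Sum>d\<in>T. if s - F (pstart \<pi>) = d then expo_at h y d (qp \<pi>) * k \<pi> else 0)"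
        using qp_cells[OF \<pi>] finC(1) by (simp add: sum.delta)
      also have "\<dots> = expo_at h y (s - F (pstart \<pi>)) (qp \<pi>) * k \<pi>"
        using finT T[OF qp_cells[OF \<pi>], of y "s - F (pstart \<pi>)"] by (subst sum.delta') auto
      finally show ?thesis
        using expo_at_qp[OF cells_path[OF \<pi>]] \<pi> by (simp add: cells_def mult.commute)
    qed
    have "(\<Sum>c\<in>?C. \<Sum>d\<in>T. expo_at h y d c * K c (s - d))
        = (\<Sum>c\<in>?C. \<Sum>\<pi>\<in>?C'. \<Sum>d\<in>T. expo_at h y d c * (if qp \<pi> = c \<and> F (pstart \<pi>) = s - d then k \<pi> else 0))"
      unfolding K' sum_distrib_left by (intro sum.cong refl sum.swap)
    also have "\<dots> = (\<Sum>\<pi>\<in>?C'. \<Sum>c\<in>?C. \<Sum>d\<in>T. expo_at h y d c * (if qp \<pi> = c \<and> F (pstart \<pi>) = s - d then k \<pi> else 0))"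
      by (rule sum.swap)
    also have "\<dots> = (\<Sum>\<pi>\<in>?C'. k \<pi> * word_sum (\<lambda>z. of_bool (qe z = y \<and> F (esrc z) = s)) \<pi>)"
      using inner by (rule sum.cong[OF refl])
    finally have eq: "(\<Sum>c\<in>?C. \<Sum>d\<in>T. expo_at h y d c * K c (s - d)) = \<dots>" .
    \<comment> \<open>Either exactly one edge of the cover lies over \<open>y\<close> with source at
      height \<open>s\<close>, and the given relation at that edge applies, or there is none and all
      terms vanish.\<close>
    show "p dvd (\<Sum>c\<in>?C. \<Sum>d\<in>T. expo_at h y d c * K c (s - d))"
    proof (cases "\<exists>y'\<in>D'. qe y' = y \<and> F (esrc y') = s")
      case True
      then obtain y' where y': "y' \<in> D'" "qe y' = y" "F (esrc y') = s" by blast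
      have uniq: "z = y'" if "z \<in> D'" "qe z = y" "F (esrc z) = s" for z
      proof -
        have "q (esrc z) = q (esrc y')" "q (etgt z) = q (etgt y')" "elab z = elab y'"
          using that y' elab_qe by metis+
        moreover have "F (etgt z) = F (etgt y')" using D'E(2)[OF that(1)] D'E(2)[OF y'(1)] that y' by simp
        ultimately show ?thesis using q_F that(3) y'(3) by (metis edge_collapse)
      qed
      have "word_sum (\<lambda>z. of_bool (qe z = y \<and> F (esrc z) = s)) \<pi> = expo y' \<pi>" if "\<pi> \<in> ?C'" for \<pi>
        unfolding expo_def using that y' uniq by (intro word_sum_cong) (fastforce simp: cells_def)
      then have "(\<Sum>\<pi>\<in>?C'. k \<pi> * word_sum (\<lambda>z. of_bool (qe z = y \<and> F (esrc z) = s)) \<pi>) = (\<Sum>\<pi>\<in>?C'. k \<pi> * expo y' \<pi>)"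
        by (intro sum.cong) auto
      moreover have "y' \<in> {y \<in> D'. elab y \<in> X}" using y y' by auto
      then have "p dvd (\<Sum>\<pi>\<in>?C'. k \<pi> * expo y' \<pi>)" using k by blast
      ultimately show ?thesis by (simp only: eq)
    next
      case False
      have "word_sum (\<lambda>z. of_bool (qe z = y \<and> F (esrc z) = s)) \<pi> = (0::int)" if "\<pi> \<in> ?C'" for \<pi>
      proof -
        have "fst ` set \<pi> \<subseteq> D'" using that by (simp add: cells_def)
        then have "word_sum (\<lambda>z. of_bool (qe z = y \<and> F (esrc z) = s)) \<pi> = word_sum (\<lambda>z. 0::int) \<pi>"
          using False by (intro word_sum_cong) (simp, blast)
        also have "\<dots> = 0" by (induction \<pi>) (auto simp: word_sum_Cons)
        finally show ?thesis .
      qed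
      then show ?thesis by (simp only: eq) simp
    qed
  qed (rule qp_cells[OF \<pi>0])
  moreover have "{\<pi>\<in>?C'. qp \<pi> = qp \<pi>0 \<and> F (pstart \<pi>) = F (pstart \<pi>0)} = {\<pi>0}"
    using qp_inj[OF _ \<pi>0] \<pi>0 by auto
  ultimately show "p dvd k \<pi>0" by (simp add: K_def)
qed

lemma label_indep':
  assumes "label_indep R D"
  shows "label_indep R D'"
  unfolding label_indep_def
proof (intro allI impI)
  fix p :: int and X :: "'e set" and R'
  assume R': "R' \<subseteq> R" and ind: "indep p R' X (\<lambda>r e. expo e r)"
  have "indep p (cells D R') {y\<in>D. elab y \<in> X} (\<lambda>\<pi> y. expo y \<pi>)"
    by (rule assms[unfolded label_indep_def, rule_format, OF R' ind])
  then show "indep p (cells D' R') {y\<in>D'. elab y \<in> X} (\<lambda>\<pi> y. expo y \<pi>)"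
    using finite_subset[OF R' fin(1)] by (rule indep_D')
qed

text \<open>Along a product of loops the increments of \<open>f\<close> add up. Reading
  \<open>winv g\<close> at the common base vertex is the same as reading it after \<open>g\<close>,
  that is, retracing \<open>g\<close>; this is why the ball has to contain
  \<open>g @ winv g\<close>.\<close>

lemma subst_closed:
  assumes "fst ` set W \<subseteq> gs" "\<And>g. g \<in> gs \<Longrightarrow> \<rho> g = \<rho> [] \<and> g @ winv g \<in> P" "subst (\<lambda>g. g) W \<in> P"
  shows "\<rho> (subst (\<lambda>g. g) W) = \<rho> [] \<and> f (subst (\<lambda>g. g) W) = f [] + word_sum (\<lambda>g. f g - f []) W"
  using assms(1,3)
proof (induction W rule: rev_induct)
  case (snoc l W)
  obtain g s where l: "l = (g, s)" by (cases l)
  have g: "\<rho> g = \<rho> []" "g @ winv g \<in> P" using assms(2)[of g] snoc.prems l by auto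
  then have gP: "g \<in> P" using words_upto_append by blast
  have W: "subst (\<lambda>g. g) W \<in> P" using snoc.prems(2) words_upto_append by (simp only: subst_simps) blast
  have IH: "\<rho> (subst (\<lambda>g. g) W) = \<rho> []" "f (subst (\<lambda>g. g) W) = f [] + word_sum (\<lambda>g. f g - f []) W"
    using snoc.IH W snoc.prems by auto
  show ?case
  proof (cases s)
    case True
    have "\<rho> (subst (\<lambda>g. g) W @ g) = \<rho> ([] @ g) \<and> word_path \<rho> (subst (\<lambda>g. g) W) g = word_path \<rho> [] g"
      using snoc.prems IH(1) gP by (intro good_append[OF good]) (auto simp: l True)
    then show ?thesis using IH g(1) f_append[of "subst (\<lambda>g. g) W" g] f_append[of "[]" g]
      by (simp add: l True)
  next
    case False
    have "\<rho> (subst (\<lambda>g. g) W @ winv g) = \<rho> (g @ winv g) \<and> word_path \<rho> (subst (\<lambda>g. g) W) (winv g) = word_path \<rho> g (winv g)"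
      using snoc.prems IH(1) g by (intro good_append[OF good]) (auto simp: l False)
    moreover have "\<rho> ([] @ g @ winv g) = \<rho> [] \<and> word_sum h (word_path \<rho> [] (g @ winv g)) = 0"
      using g(2) by (intro good_cancel[OF good]) simp
    moreover have "f (g @ winv g) = f g + word_sum h (word_path \<rho> g (winv g))" by (rule f_append)
    ultimately show ?thesis using IH g(1) f_append[of "subst (\<lambda>g. g) W" "winv g"]
      by (simp add: l False) (simp add: f_def)
  qed
qed simp

end

text \<open>With one vertex the edges are letters and distinct cells have distinct labels, so
  independence of the cells is that of the relators themselves.\<close>

lemma label_indep_base:
  fixes R :: "'e word set"
  assumes "finite R" "finite P"
  shows "label_indep R (word_graph P (\<lambda>_. 0))"
  unfolding label_indep_def
proof (intro allI impI)
  fix p :: int and X and R' :: "'e word set"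
  assume R': "R' \<subseteq> R" and ind: "indep p R' X (\<lambda>r e. expo e r)"
  let ?D = "word_graph P (\<lambda>_. 0)"
  have D0: "esrc y = 0 \<and> etgt y = 0" if "y \<in> ?D" for y :: "'e edge"
    using that by (auto simp: word_graph_def word_edge_def)
  have fin: "finite R'" "finite ?D" "finite (cells ?D R')"
    using finite_subset[OF R' assms(1)] finite_word_graph[OF assms(2)] by (simp_all add: finite_cells)
  have mono: "monotone_edges ?D" unfolding monotone_edges_def using D0 by auto
  have inj: "\<pi> = \<pi>'" if "\<pi> \<in> cells ?D R'" "\<pi>' \<in> cells ?D R'" "lab \<pi> = lab \<pi>'" for \<pi> \<pi>'
  proof -
    have "pstart \<pi> = 0" if "\<pi> \<in> cells ?D R'" "\<pi> \<noteq> []" for \<pi> :: "'e edge word"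
      using that D0 by (cases \<pi>) (auto simp: pstart_def cells_def)
    then show ?thesis
      using that path_unique[OF mono, of "pstart \<pi>" \<pi> "pstart \<pi>" \<pi>' "pstart \<pi>'"] cells_path[OF that(1)]
        cells_path[OF that(2)]
      by (cases "\<pi> = []"; cases "\<pi>' = []") (auto simp: cells_def lab_def)
  qed
  show "indep p (cells ?D R') {y\<in>?D. elab y \<in> X} (\<lambda>\<pi> y. expo y \<pi>)"
    unfolding indep_def
  proof (intro allI impI ballI)
    fix k \<pi>0
    assume k: "\<forall>y\<in>{y \<in> ?D. elab y \<in> X}. p dvd (\<Sum>\<pi>\<in>cells ?D R'. k \<pi> * expo y \<pi>)" and \<pi>0: "\<pi>0 \<in> cells ?D R'"
    define K where "K r = (\<Sum>\<pi>\<in>{\<pi>\<in>cells ?D R'. lab \<pi> = r}. k \<pi>)" for r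
    have "p dvd (\<Sum>r\<in>R'. K r * expo e r)" if e: "e \<in> X" for e
    proof -
      have "(\<Sum>r\<in>R'. K r * expo e r) = (\<Sum>r\<in>R'. \<Sum>\<pi>\<in>{\<pi>\<in>cells ?D R'. lab \<pi> = r}. k \<pi> * expo e (lab \<pi>))"
        unfolding K_def sum_distrib_right by (intro sum.cong refl) simp
      also have "\<dots> = (\<Sum>\<pi>\<in>cells ?D R'. k \<pi> * expo e (lab \<pi>))"
        by (rule sum.group[OF fin(3,1)]) (auto simp: cells_def)
      also have "\<dots> = (\<Sum>\<pi>\<in>cells ?D R'. k \<pi> * (\<Sum>y\<in>{y\<in>?D. elab y = e}. expo y \<pi>))"
        using fin(2) by (intro sum.cong refl arg_cong2[of _ _ _ _ "(*)"] expo_lab) (auto simp: cells_def)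
      also have "\<dots> = (\<Sum>y\<in>{y\<in>?D. elab y = e}. \<Sum>\<pi>\<in>cells ?D R'. k \<pi> * expo y \<pi>)"
        unfolding sum_distrib_left by (rule sum.swap)
      finally have "(\<Sum>r\<in>R'. K r * expo e r) = \<dots>" .
      moreover have "p dvd (\<Sum>y\<in>{y\<in>?D. elab y = e}. \<Sum>\<pi>\<in>cells ?D R'. k \<pi> * expo y \<pi>)"
        by (rule dvd_sum) (use k e in blast)
      ultimately show ?thesis by (simp only:)
    qed
    moreover have "lab \<pi>0 \<in> R'" using \<pi>0 unfolding cells_def by blast
    ultimately have "p dvd K (lab \<pi>0)" by (rule indepD[OF ind])
    moreover have "{\<pi>\<in>cells ?D R'. lab \<pi> = lab \<pi>0} = {\<pi>0}" using inj[OF _ \<pi>0] \<pi>0 by auto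
    ultimately show "p dvd k \<pi>0" by (simp add: K_def)
  qed
qed

text \<open>Local indicability of the group \<open>\<langle>E | R\<rangle>\<close>, phrased through the functionals that
  vanish on the relations of a finitely generated subgroup.\<close>

definition loc_indicable :: "'e word set \<Rightarrow> bool" where
  "loc_indicable R \<longleftrightarrow> (\<forall>gs. finite gs \<longrightarrow>
     (\<forall>\<psi>::'e word \<Rightarrow> rat. (\<forall>W. fst ` set W \<subseteq> gs \<longrightarrow> null_word R (subst (\<lambda>g. g) W) \<longrightarrow> word_sum \<psi> W = 0) \<longrightarrow>
        (\<forall>g\<in>gs. \<psi> g = 0)) \<longrightarrow>
     (\<forall>g\<in>gs. null_word R g))"

text \<open>Among the labellings of a fixed finite ball that satisfy \<open>Inv\<close>, one with
  the most vertices is taken. A cocycle that is not a coboundary would define a cyclic cover with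
  more vertices, to which the loops \<open>gs\<close> lift because no character detects
  them.\<close>

lemma tower:
  fixes R :: "'e word set"
  assumes finR: "finite R" and fings: "finite gs"
    and func: "\<And>\<psi>::'e word \<Rightarrow> rat. (\<And>W. fst ` set W \<subseteq> gs \<Longrightarrow> null_word R (subst (\<lambda>g. g) W) \<Longrightarrow> word_sum \<psi> W = 0)
      \<Longrightarrow> \<forall>g\<in>gs. \<psi> g = 0"
  shows "\<exists>D. finite D \<and> monotone_edges D \<and> label_indep R D \<and> H1_trivial R D \<and>
    (\<forall>g\<in>gs. \<exists>i \<pi>. path i \<pi> i \<and> fst ` set \<pi> \<subseteq> D \<and> lab \<pi> = g)"
proof -
  define L where "L = {W. fst ` set W \<subseteq> gs \<and> null_word R (subst (\<lambda>g. g) W)}"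
  obtain L0 where L0: "L0 \<subseteq> L" "finite L0"
    and ann: "\<And>\<psi>::'e word \<Rightarrow> rat. (\<forall>g. g \<notin> gs \<longrightarrow> \<psi> g = 0) \<Longrightarrow> (\<forall>w\<in>L0. word_sum \<psi> w = 0) \<Longrightarrow>
      (\<forall>w\<in>L. word_sum \<psi> w = 0)"
    using finite_annihilator[OF fings, of L] by (elim exE conjE) (erule (1) that, simp)
  have "\<forall>W\<in>L0. \<exists>n0 E0. finite (E0) \<and> (\<forall>n E \<rho>. n0 \<le> n \<longrightarrow> E0 \<subseteq> E \<longrightarrow> good_labelling R (words_upto n E) \<rho> \<longrightarrow>
      \<rho> (subst (\<lambda>g. g) W) = \<rho> [])"
  proof
    fix W assume "W \<in> L0"
    then have "null_word R (subst (\<lambda>g. g) W)" using L0(1) by (auto simp: L_def)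
    then show "\<exists>n0 E0. finite (E0) \<and> (\<forall>n E \<rho>. n0 \<le> n \<longrightarrow> E0 \<subseteq> E \<longrightarrow> good_labelling R (words_upto n E) \<rho> \<longrightarrow>
      \<rho> (subst (\<lambda>g. g) W) = \<rho> [])"
      by (rule good_null_word)
  qed
  from bchoice[OF this] obtain n0 where "\<forall>W\<in>L0. \<exists>E0. finite (E0) \<and> (\<forall>n E \<rho>. n0 W \<le> n \<longrightarrow> E0 \<subseteq> E \<longrightarrow> good_labelling R (words_upto n E) \<rho> \<longrightarrow>
      \<rho> (subst (\<lambda>g. g) W) = \<rho> [])"
    by (elim exE)
  from bchoice[OF this] obtain E0 where n0E0: "\<forall>W\<in>L0. finite (E0 W) \<and> (\<forall>n E \<rho>. n0 W \<le> n \<longrightarrow> E0 W \<subseteq> E \<longrightarrow> good_labelling R (words_upto n E) \<rho> \<longrightarrow>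
      \<rho> (subst (\<lambda>g. g) W) = \<rho> [])"
    by (elim exE)
  have n0: "\<And>W. W \<in> L0 \<Longrightarrow> finite (E0 W)"
    "\<And>W n E \<rho>. W \<in> L0 \<Longrightarrow> n0 W \<le> n \<Longrightarrow> E0 W \<subseteq> E \<Longrightarrow> good_labelling R (words_upto n E) \<rho> \<Longrightarrow> \<rho> (subst (\<lambda>g. g) W) = \<rho> []"
    using n0E0 by simp_all
  let ?s = "subst (\<lambda>g. g) :: 'e word word \<Rightarrow> 'e word"
  \<comment> \<open>Large enough for the derivations behind the finitely many relations in
    \<open>L0\<close>, and for each \<open>g\<close> followed by its inverse.\<close>
  define n where "n = (\<Sum>W\<in>L0. n0 W + length (?s W)) + (\<Sum>g\<in>gs. 2 * length g)"
  define E where "E = (\<Union>W\<in>L0. E0 W \<union> fst ` set (?s W)) \<union> (\<Union>g\<in>gs. fst ` set g)"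
  have finE: "finite E" using L0(2) n0(1) fings by (auto simp: E_def)
  let ?P = "words_upto n E"
  have nW: "n0 W + length (?s W) \<le> n" if "W \<in> L0" for W
    using member_le_sum[OF that, of "\<lambda>W. n0 W + length (?s W)"] L0(2) by (simp add: n_def)
  have ng: "2 * length g \<le> n" if "g \<in> gs" for g
    using member_le_sum[OF that, of "\<lambda>g. 2 * length g"] fings by (simp add: n_def)
  have closedW: "\<rho> (?s W) = \<rho> []" if "W \<in> L0" "good_labelling R ?P \<rho>" for W \<rho>
    by (rule n0(2)[OF that(1) _ _ that(2)]) (use nW[OF that(1)] that(1) in \<open>auto simp: E_def\<close>)
  have WP: "?s W \<in> ?P" if "W \<in> L0" for W
    using nW[OF that] that by (auto simp: words_upto_def E_def)
  have gP: "g @ winv g \<in> ?P" if "g \<in> gs" for g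
    using ng[OF that] that fst_set_winv[of g] by (auto simp: words_upto_def E_def image_Un)
  have finP: "finite ?P" by (rule finite_words_upto[OF finE])
  define Inv where "Inv \<rho> \<longleftrightarrow> good_labelling R ?P \<rho> \<and> label_indep R (word_graph ?P \<rho>) \<and> (\<forall>g\<in>gs. \<rho> g = \<rho> [])" for \<rho>
  have "Inv (\<lambda>_. 0)"
    unfolding Inv_def good_labelling_def using label_indep_base[OF finR finP]
    by (auto simp: monotone_edges_def word_graph_def word_edge_def)
  then have "\<exists>\<rho>. Inv \<rho> \<and> (\<forall>\<rho>'. Inv \<rho>' \<longrightarrow> card (\<rho>' ` ?P) \<le> card (\<rho> ` ?P))"
    by (rule ex_has_greatest_nat[where b = "Suc (card ?P)" and f = "\<lambda>\<rho>. card (\<rho> ` ?P)"])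
      (auto simp: less_Suc_eq_le intro!: card_image_le[OF finP])
  then obtain \<rho> where inv: "Inv \<rho>" and max: "\<And>\<rho>'. Inv \<rho>' \<Longrightarrow> card (\<rho>' ` ?P) \<le> card (\<rho> ` ?P)"
    by (elim exE conjE) (erule that, simp)
  let ?D = "word_graph ?P \<rho>"
  have good: "good_labelling R ?P \<rho>" using inv by (simp add: Inv_def)
  have finD: "finite ?D" by (rule finite_word_graph[OF finP])
  have "H1_trivial R ?D"
    unfolding H1_trivial_def
  proof (intro allI impI)
    fix h :: "'e edge \<Rightarrow> rat" assume h: "\<forall>\<pi>\<in>cells ?D R. word_sum h \<pi> = 0"
    obtain d k where d: "d > 0" "\<And>y. y \<in> ?D \<Longrightarrow> of_int d * h y = of_int (k y)"
      using common_denominator[OF finD, of h] by blast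
    have "cyclic_cover R n E \<rho> k"
    proof
      fix \<pi> assume \<pi>: "\<pi> \<in> cells ?D R"
      have "(of_int (word_sum k \<pi>) :: rat) = word_sum (\<lambda>y. of_int d * h y + 0 * h y) \<pi>"
        unfolding word_sum_of_int[symmetric] using \<pi> d(2) by (intro word_sum_cong) (auto simp: cells_def)
      also have "\<dots> = 0" unfolding word_sum_linear using h \<pi> by simp
      finally show "word_sum k \<pi> = 0" by simp
    qed (use finR finE good in auto)
    then interpret cyclic_cover R n E \<rho> k .
    have fg: "f g = f []" if "g \<in> gs" for g
    proof -
      \<comment> \<open>The increments of \<open>f\<close> along the loops \<open>gs\<close> respect
        the relations in \<open>L0\<close>, hence all relations; they form a character and
        vanish.\<close>
      define \<psi> where "\<psi> g = (if g \<in> gs then of_int (f g - f []) else 0 :: rat)" for g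
      have "word_sum \<psi> W = 0" if W: "W \<in> L0" for W
      proof -
        have Wg: "fst ` set W \<subseteq> gs" using W L0(1) by (auto simp: L_def)
        have "f (?s W) = f [] + word_sum (\<lambda>g. f g - f []) W"
          using subst_closed[OF Wg _ WP[OF W]] gP inv unfolding Inv_def by blast
        moreover have "f (?s W) = f []"
        proof -
          have "F (\<rho>' (?s W)) = F (\<rho>' [])" using closedW[OF W good'] by simp
          moreover have "[] \<in> ?P" by (simp add: words_upto_def)
          ultimately show ?thesis using WP[OF W] by simp
        qed
        ultimately have "word_sum (\<lambda>g. f g - f []) W = 0" by simp
        moreover have "word_sum \<psi> W = word_sum (\<lambda>g. of_int (f g - f [])) W"
          using Wg by (intro word_sum_cong) (auto simp: \<psi>_def)
        ultimately show ?thesis by (simp only: word_sum_of_int of_int_0)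
      qed
      then have "\<forall>w\<in>L. word_sum \<psi> w = 0" by (intro ann) (auto simp: \<psi>_def)
      then have "\<forall>g\<in>gs. \<psi> g = 0" by (intro func) (auto simp: L_def)
      then show ?thesis using that by (auto simp: \<psi>_def)
    qed
    have "Inv \<rho>'"
      unfolding Inv_def using good' label_indep' inv fg by (auto simp: Inv_def \<rho>'_def)
    then have "card (\<rho>' ` ?P) \<le> card (q ` (\<rho>' ` ?P))"
      using max by (simp add: image_image)
    \<comment> \<open>By maximality the cover has no additional vertices, so \<open>f\<close>
      depends only on the vertex below and, after division by \<open>d\<close>, is a primitive of
      \<open>h\<close>.\<close>
    then have inj: "inj_on q (\<rho>' ` ?P)"
      using finP by (intro eq_card_imp_inj_on) (auto intro!: antisym card_image_le)
    have \<rho>f: "f p = f p'" if "p \<in> ?P" "p' \<in> ?P" "\<rho> p = \<rho> p'" for p p'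
    proof -
      have "\<rho>' p = \<rho>' p'" by (rule inj_onD[OF inj]) (use that in simp_all)
      then show ?thesis using that(3) by (simp add: \<rho>'_def)
    qed
    define \<phi> where "\<phi> i = (of_int (f (SOME p. p \<in> ?P \<and> \<rho> p = i)) / of_int d :: rat)" for i
    have \<phi>: "\<phi> (\<rho> p) = of_int (f p) / of_int d" if "p \<in> ?P" for p
    proof -
      have "(SOME p'. p' \<in> ?P \<and> \<rho> p' = \<rho> p) \<in> ?P \<and> \<rho> (SOME p'. p' \<in> ?P \<and> \<rho> p' = \<rho> p) = \<rho> p"
        by (rule someI[of _ p]) (use that in simp)
      then show ?thesis unfolding \<phi>_def using \<rho>f[OF _ that] by simp
    qed
    have "h y = \<phi> (etgt y) - \<phi> (esrc y)" if y: "y \<in> ?D" for y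
    proof -
      obtain p l where pl: "y = word_edge \<rho> p l" "p @ [l] \<in> ?P" using y by (auto simp: word_graph_def)
      have p: "p \<in> ?P" using words_upto_append pl(2) by blast
      have "h y = of_int (k y) / of_int d" using d(1) d(2)[OF y] by (simp add: field_simps)
      moreover have "of_int (k y) = (if snd l then of_int (f (p @ [l])) - of_int (f p) else of_int (f p) - of_int (f (p @ [l])) :: rat)"
        using f_append[of p "[l]"] pl(1) by (simp add: word_sum_Cons)
      moreover have "\<phi> (etgt y) - \<phi> (esrc y) =
          (if snd l then of_int (f (p @ [l])) / of_int d - of_int (f p) / of_int d
           else of_int (f p) / of_int d - of_int (f (p @ [l])) / of_int d)"
        using \<phi>[OF p] \<phi>[OF pl(2)] pl(1) by (simp add: word_edge_def)
      ultimately show ?thesis by (simp add: diff_divide_distrib)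
    qed
    then show "\<exists>\<phi>. \<forall>y\<in>?D. h y = \<phi> (etgt y) - \<phi> (esrc y)" by blast
  qed
  moreover have "\<exists>i \<pi>. path i \<pi> i \<and> fst ` set \<pi> \<subseteq> ?D \<and> lab \<pi> = g" if g: "g \<in> gs" for g
  proof (intro exI conjI)
    show "path (\<rho> []) (word_path \<rho> [] g) (\<rho> [])"
      using path_word_path[of \<rho> "[]" g] inv g by (simp add: Inv_def)
    show "fst ` set (word_path \<rho> [] g) \<subseteq> ?D"
      using words_upto_append[OF gP[OF g]] by (intro word_path_graph) simp
  qed (rule lab_word_path)
  ultimately show ?thesis
    using finD good inv unfolding Inv_def good_labelling_def by blast
qed

lemma loc_indicableI:
  assumes "finite R"
    and "\<And>D i \<pi>. finite D \<Longrightarrow> monotone_edges D \<Longrightarrow> label_indep R D \<Longrightarrow> H1_trivial R D \<Longrightarrow>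
      path i \<pi> i \<Longrightarrow> fst ` set \<pi> \<subseteq> D \<Longrightarrow> null_word R (lab \<pi>)"
  shows "loc_indicable R"
  unfolding loc_indicable_def
proof (intro allI impI ballI)
  fix gs g
  assume "finite gs" and func: "\<forall>\<psi>::'a word \<Rightarrow> rat. (\<forall>W. fst ` set W \<subseteq> gs \<longrightarrow>
    null_word R (subst (\<lambda>g. g) W) \<longrightarrow> word_sum \<psi> W = 0) \<longrightarrow> (\<forall>g\<in>gs. \<psi> g = 0)" and g: "g \<in> gs"
  have "\<exists>D. finite D \<and> monotone_edges D \<and> label_indep R D \<and> H1_trivial R D \<and>
    (\<forall>g\<in>gs. \<exists>i \<pi>. path i \<pi> i \<and> fst ` set \<pi> \<subseteq> D \<and> lab \<pi> = g)"
  proof (rule tower[OF assms(1) \<open>finite gs\<close>])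
    fix \<psi> :: "'a word \<Rightarrow> rat"
    assume "\<And>W. fst ` set W \<subseteq> gs \<Longrightarrow> null_word R (subst (\<lambda>g. g) W) \<Longrightarrow> word_sum \<psi> W = 0"
    then show "\<forall>g\<in>gs. \<psi> g = 0" by (intro func[THEN spec, THEN mp] allI impI)
  qed
  then obtain D where D: "finite D" "monotone_edges D" "label_indep R D" "H1_trivial R D"
    and "\<forall>g\<in>gs. \<exists>i \<pi>. path i \<pi> i \<and> fst ` set \<pi> \<subseteq> D \<and> lab \<pi> = g" by (elim exE conjE)
  then obtain i \<pi> where "path i \<pi> i" "fst ` set \<pi> \<subseteq> D" "lab \<pi> = g" using g by meson
  then show "null_word R g" using assms(2)[OF D] by blast
qed

section \<open>Acyclic graphs with cells\<close>

text \<open>Exponent sum zero forces both signs to occur, hence two consecutive occurrences of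
  opposite sign.\<close>

lemma expo_split:
  assumes "z \<in> fst ` set \<beta>" "expo z \<beta> = 0"
  obtains \<beta>1 t \<beta>2 \<beta>3 where "\<beta> = \<beta>1 @ (z, t) # \<beta>2 @ (z, \<not> t) # \<beta>3" "z \<notin> fst ` set \<beta>2"
proof -
  have "(\<exists>\<beta>1 t \<beta>2 \<beta>3. \<beta> = \<beta>1 @ (z, t) # \<beta>2 @ (z, \<not> t) # \<beta>3 \<and> z \<notin> fst ` set \<beta>2) \<or>
      (\<exists>t. \<forall>l\<in>set \<beta>. fst l = z \<longrightarrow> snd l = t)" for \<beta>
  proof (induction \<beta>)
    case (Cons l \<beta>)
    show ?case
    proof (cases "\<exists>\<beta>1 t \<beta>2 \<beta>3. \<beta> = \<beta>1 @ (z, t) # \<beta>2 @ (z, \<not> t) # \<beta>3 \<and> z \<notin> fst ` set \<beta>2")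
      case True
      then obtain \<beta>1 t \<beta>2 \<beta>3 where "\<beta> = \<beta>1 @ (z, t) # \<beta>2 @ (z, \<not> t) # \<beta>3" "z \<notin> fst ` set \<beta>2"
        by (elim exE conjE)
      then have "l # \<beta> = (l # \<beta>1) @ (z, t) # \<beta>2 @ (z, \<not> t) # \<beta>3 \<and> z \<notin> fst ` set \<beta>2" by simp
      then show ?thesis by (intro disjI1 exI)
    next
      case False
      then obtain t where t: "\<forall>l\<in>set \<beta>. fst l = z \<longrightarrow> snd l = t" using Cons by blast
      show ?thesis
      proof (cases "fst l = z \<and> snd l \<noteq> t \<and> z \<in> fst ` set \<beta>")
        case True
        then have "z \<in> fst ` set \<beta>" by simp
        then have "\<exists>l\<in>set \<beta>. fst l = z" by (metis imageE)
        then obtain \<beta>2 l' \<beta>3 where s: "\<beta> = \<beta>2 @ l' # \<beta>3" "fst l' = z" "\<forall>l\<in>set \<beta>2. fst l \<noteq> z"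
          by (rule split_list_first_propE)
        then have "snd l' = t" using t by simp
        then have "l # \<beta> = [] @ (z, snd l) # \<beta>2 @ (z, \<not> snd l) # \<beta>3 \<and> z \<notin> fst ` set \<beta>2"
          using s True by (cases l; cases l') auto
        then show ?thesis by (intro disjI1 exI)
      next
        case False
        have "\<exists>t'. \<forall>l'\<in>set (l # \<beta>). fst l' = z \<longrightarrow> snd l' = t'"
        proof (cases "z \<in> fst ` set \<beta>")
          case True
          then show ?thesis using t False by (intro exI[of _ t]) auto
        next
          case F: False
          then show ?thesis by (intro exI[of _ "snd l"]) force
        qed
        then show ?thesis by (rule disjI2)
      qed
    qed
  qed simp
  moreover have "expo z \<beta> \<noteq> 0" if "\<forall>l\<in>set \<beta>. fst l = z \<longrightarrow> snd l = t" "z \<in> fst ` set \<beta>" for t \<beta>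
  proof -
    have "expo z \<beta> = (if t then 1 else -1) * int (length (filter (\<lambda>l. fst l = z) \<beta>))"
      using that(1) by (induction \<beta>) (auto simp: algebra_simps)
    moreover have "filter (\<lambda>l. fst l = z) \<beta> \<noteq> []" using that(2) by (auto simp: filter_empty_conv)
    ultimately show ?thesis by simp
  qed
  ultimately show thesis using that assms by metis
qed

text \<open>Unlike in \<open>expo_split\<close>, the sign of the first of the two consecutive
  occurrences is prescribed. This provides excursions in both directions through one edge.\<close>

lemma adjacent_split:
  "\<exists>\<alpha> U V. (z, a) # \<beta> @ [(z, \<not> a)] = U @ (z, a) # \<alpha> @ (z, \<not> a) # V \<and> z \<notin> fst ` set \<alpha>"
proof (induction "length \<beta>" arbitrary: \<beta> rule: less_induct)
  case less
  show ?case
  proof (cases "z \<in> fst ` set \<beta>")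
    case False
    then have "(z, a) # \<beta> @ [(z, \<not> a)] = [] @ (z, a) # \<beta> @ (z, \<not> a) # [] \<and> z \<notin> fst ` set \<beta>" by simp
    then show ?thesis by (intro exI)
  next
    case True
    then have "\<exists>l\<in>set \<beta>. fst l = z" by auto
    then obtain \<gamma> l \<gamma>' where s: "\<beta> = \<gamma> @ l # \<gamma>'" "fst l = z" "\<forall>l\<in>set \<gamma>. fst l \<noteq> z"
      by (rule split_list_first_propE)
    show ?thesis
    proof (cases "snd l = a")
      case True
      obtain \<alpha> U V where "(z, a) # \<gamma>' @ [(z, \<not> a)] = U @ (z, a) # \<alpha> @ (z, \<not> a) # V \<and> z \<notin> fst ` set \<alpha>"
        using less[of \<gamma>'] s(1) by auto
      moreover have "l = (z, a)" using True s(2) by (cases l) auto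
      ultimately have "(z, a) # \<beta> @ [(z, \<not> a)] = ((z, a) # \<gamma> @ U) @ (z, a) # \<alpha> @ (z, \<not> a) # V \<and> z \<notin> fst ` set \<alpha>"
        using s(1) by simp
      then show ?thesis by (intro exI)
    next
      case False
      then have "l = (z, \<not> a)" using s(2) by (cases l) auto
      then have "(z, a) # \<beta> @ [(z, \<not> a)] = [] @ (z, a) # \<gamma> @ (z, \<not> a) # (\<gamma>' @ [(z, \<not> a)]) \<and> z \<notin> fst ` set \<gamma>"
        using s by auto
      then show ?thesis by (intro exI)
    qed
  qed
qed

lemma word_sum_zero: "(\<And>y. y \<in> fst ` set w \<Longrightarrow> h y = 0) \<Longrightarrow> word_sum h w = 0"
  by (induction w) (auto simp: word_sum_Cons)

lemma H1_trivialD: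
  assumes "H1_trivial R S" "\<And>\<pi>. \<pi> \<in> cells S R \<Longrightarrow> word_sum h \<pi> = (0::rat)"
  shows "\<exists>f. \<forall>y\<in>S. h y = f (etgt y) - f (esrc y)"
  using assms unfolding H1_trivial_def by simp

lemma path_split_opposite:
  assumes "path i (\<beta>1 @ (z, t) # \<beta>2 @ (z, \<not> t) # \<beta>3) j"
  shows "path (if t then etgt z else esrc z) \<beta>2 (if t then etgt z else esrc z)" "path i (\<beta>1 @ \<beta>3) j"
  using assms by (auto simp: path_append split: if_splits)

text \<open>Cut out the part between two opposite passages of an edge with exponent sum zero.\<close>

lemma closed_paths_null:
  assumes *: "\<And>i \<beta>. path i \<beta> i \<Longrightarrow> fst ` set \<beta> \<subseteq> S \<Longrightarrow>
      null_word R (lab \<beta>) \<or> (\<exists>z\<in>fst ` set \<beta>. expo z \<beta> = 0)"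
    and "path i \<beta> i" "fst ` set \<beta> \<subseteq> S"
  shows "null_word R (lab \<beta>)"
  using assms(2-)
proof (induction "length \<beta>" arbitrary: i \<beta> rule: less_induct)
  case less
  show ?case
  proof (cases "null_word R (lab \<beta>)")
    case False
    then obtain z where "z \<in> fst ` set \<beta>" "expo z \<beta> = 0" using *[OF less.prems] by blast
    then obtain \<beta>1 t \<beta>2 \<beta>3 where s: "\<beta> = \<beta>1 @ (z, t) # \<beta>2 @ (z, \<not> t) # \<beta>3" by (rule expo_split)
    have "null_word R (lab \<beta>2)"
      by (rule less.hyps[OF _ path_split_opposite(1)[OF less.prems(1)[unfolded s]]]) (use s less.prems(2) in auto)
    moreover have "null_word R (lab (\<beta>1 @ \<beta>3))"
      by (rule less.hyps[OF _ path_split_opposite(2)[OF less.prems(1)[unfolded s]]]) (use s less.prems(2) in auto)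
    then have "null_word R (lab \<beta>1 @ [(elab z, t), inv_letter (elab z, t)] @ lab \<beta>3)"
      by (intro null_cancel) simp
    ultimately have "null_word R ((lab \<beta>1 @ [(elab z, t)]) @ lab \<beta>2 @ ((elab z, \<not> t) # lab \<beta>3))"
      by (intro null_word_insert) (simp_all add: inv_letter_def)
    then show ?thesis by (simp add: s)
  qed
qed

text \<open>Without cells every cochain is a cocycle. The indicator of an edge is thus a coboundary,
  so every closed path has exponent sum zero at that edge.\<close>

lemma loc_indicable_free: "loc_indicable {}"
proof (rule loc_indicableI)
  fix D i and \<pi> :: "'a edge word"
  assume D: "H1_trivial {} D" and \<pi>: "path i \<pi> i" "fst ` set \<pi> \<subseteq> D"
  show "null_word {} (lab \<pi>)"
  proof (rule closed_paths_null[OF _ \<pi>])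
    fix i \<beta> assume \<beta>: "path i \<beta> i" "fst ` set \<beta> \<subseteq> D"
    have "expo z \<beta> = 0" for z
    proof -
      have "\<exists>f. \<forall>y\<in>D. (if y = z then 1 else 0 :: rat) = f (etgt y) - f (esrc y)"
        by (rule H1_trivialD[OF D]) (simp add: cells_def)
      then obtain f where f: "\<forall>y\<in>D. (if y = z then 1 else 0 :: rat) = f (etgt y) - f (esrc y)" by (elim exE)
      have "word_sum (\<lambda>y. if y = z then 1 else 0 :: rat) \<beta> = f i - f i"
        by (rule word_sum_coboundary[OF \<beta>(1)]) (use f \<beta>(2) in blast)
      then show ?thesis by (simp add: word_sum_single)
    qed
    then show "null_word {} (lab \<beta>) \<or> (\<exists>z\<in>fst ` set \<beta>. expo z \<beta> = 0)"
      by (cases "\<beta> = []") (simp_all add: null_Nil)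
  qed
qed simp

text \<open>The assumption \<open>red\<close> is stated for \<open>r @ r\<close> so as to cover the
  cyclic word \<open>r\<close>. It says that \<open>r\<close> is cyclically reduced with
  \<open>x\<close> as a stable letter over the group of \<open>R\<close>: \<open>x\<close> and its
  inverse never enclose an \<open>x\<close>-free word that is trivial there.\<close>

locale added_relator =
  fixes R :: "'e word set" and r :: "'e word" and x :: 'e and D :: "'e edge set"
  assumes finR: "finite R" and finD: "finite D"
    and mono: "monotone_edges D"
    and xfree: "\<And>s. s \<in> R \<Longrightarrow> x \<notin> fst ` set s"
    and indW: "\<And>p. prime p \<Longrightarrow> indep p (insert r R) UNIV (\<lambda>r e. expo e r)"
    and xr: "expo x r \<noteq> 0"
    and lind: "label_indep (insert r R) D"
    and H1D: "H1_trivial (insert r R) D"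
    and li: "loc_indicable R"
    and red: "\<And>u a v s. r @ r = u @ (x, s) # a @ (x, \<not> s) # v \<Longrightarrow> x \<notin> fst ` set a \<Longrightarrow> \<not> null_word R a"
begin

abbreviation "R1 \<equiv> insert r R"

lemma fin_cells: "S \<subseteq> D \<Longrightarrow> R' \<subseteq> R1 \<Longrightarrow> finite (cells S R')"
  using finR finD by (intro finite_cells) (auto intro: finite_subset)

lemma cells_R1: "cells S R1 = cells S R \<union> cells S {r}"
  by (auto simp: cells_def)

lemma cells_R_xfree: "\<pi> \<in> cells S R \<Longrightarrow> y \<in> fst ` set \<pi> \<Longrightarrow> elab y \<noteq> x"
proof
  assume \<pi>: "\<pi> \<in> cells S R" "y \<in> fst ` set \<pi>" "elab y = x"
  then have "x \<in> fst ` set (lab \<pi>)" by (force simp: lab_def)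
  then show False using xfree[of "lab \<pi>"] \<pi>(1) by (simp add: cells_def)
qed

lemma indep_prime: "prime p \<Longrightarrow> indep p (cells D R1) D (\<lambda>\<pi> y. expo y \<pi>)"
  using lind[unfolded label_indep_def, rule_format, OF subset_refl indW[of p]] by simp

lemma indep_x: "indep 0 (cells D {r}) {y\<in>D. elab y = x} (\<lambda>\<pi> y. expo y \<pi>)"
proof -
  have "indep 0 {r} {x} (\<lambda>r e. expo e r)" using xr by (simp add: indep_def)
  then show ?thesis
    using lind[unfolded label_indep_def, rule_format, of "{r}" 0 "{x}"] by simp
qed

text \<open>The words \<open>g y\<close> label loops through single edges, based at \<open>c\<close>
  by means of the paths \<open>\<kappa>\<close>; in a product along a path consecutive
  \<open>\<kappa>\<close> cancel. The context \<open>X\<close>, \<open>Y\<close> lets the induction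
  work inside a larger word.\<close>

lemma null_telescope:
  assumes base: "\<And>v. v \<in> V \<Longrightarrow> path c (\<kappa> v) v"
    and g: "\<And>y. g y = lab (\<kappa> (esrc y)) @ [(elab y, True)] @ winv (lab (\<kappa> (etgt y)))"
    and "path u \<pi> v"
  shows "null_word R (X @ subst g \<pi> @ Y) \<longleftrightarrow> null_word R (X @ lab (\<kappa> u) @ lab \<pi> @ winv (lab (\<kappa> v)) @ Y)"
  using assms(3)
proof (induction u \<pi> v arbitrary: X rule: path.induct)
  case (1 i j)
  then show ?case
    using null_word_insert_iff[OF null_word_winv[of R "lab (\<kappa> j)"], of X Y] by simp
next
  case (2 i y s \<pi> j)
  show ?case
  proof (cases s)
    case True
    then have "null_word R (X @ subst g ((y, s) # \<pi>) @ Y) \<longleftrightarrow>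
        null_word R ((X @ g y) @ lab (\<kappa> (etgt y)) @ lab \<pi> @ winv (lab (\<kappa> j)) @ Y)"
      using 2(1)[of "X @ g y"] 2(3) by simp
    also have "\<dots> \<longleftrightarrow> null_word R ((X @ lab (\<kappa> (esrc y)) @ [(elab y, True)]) @ (winv (lab (\<kappa> (etgt y))) @ lab (\<kappa> (etgt y))) @ lab \<pi> @ winv (lab (\<kappa> j)) @ Y)"
      by (simp add: g)
    also have "\<dots> \<longleftrightarrow> null_word R ((X @ lab (\<kappa> (esrc y)) @ [(elab y, True)]) @ lab \<pi> @ winv (lab (\<kappa> j)) @ Y)"
      by (rule null_word_insert_iff[OF null_word_winv'])
    finally show ?thesis using 2(3) True by simp
  next
    case False
    then have "null_word R (X @ subst g ((y, s) # \<pi>) @ Y) \<longleftrightarrow>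
        null_word R ((X @ winv (g y)) @ lab (\<kappa> (esrc y)) @ lab \<pi> @ winv (lab (\<kappa> j)) @ Y)"
      using 2(2)[of "X @ winv (g y)"] 2(3) by simp
    also have "\<dots> \<longleftrightarrow> null_word R ((X @ lab (\<kappa> (etgt y)) @ [(elab y, False)]) @ (winv (lab (\<kappa> (esrc y))) @ lab (\<kappa> (esrc y))) @ lab \<pi> @ winv (lab (\<kappa> j)) @ Y)"
      by (simp add: g inv_letter_def)
    also have "\<dots> \<longleftrightarrow> null_word R ((X @ lab (\<kappa> (etgt y)) @ [(elab y, False)]) @ lab \<pi> @ winv (lab (\<kappa> j)) @ Y)"
      by (rule null_word_insert_iff[OF null_word_winv'])
    finally show ?thesis using 2(3) False by simp
  qed
qed

text \<open>The group of \<open>x\<close>-free loops at \<open>c\<close> is finitely generated. A character of it is a cocycle on the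
  \<open>x\<close>-free edges. It extends over the \<open>x\<close>-edges because the \<open>x\<close>-parts of the cells over \<open>r\<close> are
  independent, and is therefore a coboundary.\<close>

lemma xfree_loops_null:
  assumes \<beta>: "path c \<beta> c" "fst ` set \<beta> \<subseteq> D" "\<And>y. y \<in> fst ` set \<beta> \<Longrightarrow> elab y \<noteq> x"
  shows "null_word R (lab \<beta>)"
proof -
  define A where "A = {y\<in>D. elab y \<noteq> x}"
  define V where "V = {v. \<exists>\<kappa>. path c \<kappa> v \<and> fst ` set \<kappa> \<subseteq> A}"
  \<comment> \<open>The trivial path is chosen at \<open>c\<close> so that a loop at
    \<open>c\<close> telescopes to exactly its own label.\<close>
  have "\<forall>v\<in>V. \<exists>\<kappa>. path c \<kappa> v \<and> fst ` set \<kappa> \<subseteq> A \<and> (v = c \<longrightarrow> \<kappa> = [])"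
  proof
    fix v assume "v \<in> V"
    then obtain \<kappa> where \<kappa>: "path c \<kappa> v" "fst ` set \<kappa> \<subseteq> A" unfolding V_def by blast
    show "\<exists>\<kappa>. path c \<kappa> v \<and> fst ` set \<kappa> \<subseteq> A \<and> (v = c \<longrightarrow> \<kappa> = [])"
    proof (cases "v = c")
      case True
      then show ?thesis by (intro exI[of _ "[]"]) simp
    next
      case False
      then show ?thesis using \<kappa> by (intro exI[of _ \<kappa>]) simp
    qed
  qed
  from bchoice[OF this] obtain \<kappa>
    where \<kappa>': "\<forall>v\<in>V. path c (\<kappa> v) v \<and> fst ` set (\<kappa> v) \<subseteq> A \<and> (v = c \<longrightarrow> \<kappa> v = [])" by (elim exE)
  have \<kappa>: "\<And>v. v \<in> V \<Longrightarrow> path c (\<kappa> v) v" "\<And>v. v \<in> V \<Longrightarrow> fst ` set (\<kappa> v) \<subseteq> A"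
    using \<kappa>' by blast+
  have cV: "c \<in> V" unfolding V_def by (intro CollectI exI[of _ "[]"]) simp
  have \<kappa>c: "\<kappa> c = []" using \<kappa>' cV by blast
  have V_step: "esrc y \<in> V \<longleftrightarrow> etgt y \<in> V" if "y \<in> A" for y
  proof
    assume "esrc y \<in> V"
    then have "path c (\<kappa> (esrc y) @ [(y, True)]) (etgt y)" "fst ` set (\<kappa> (esrc y) @ [(y, True)]) \<subseteq> A"
      using \<kappa> that by (auto simp: path_append)
    then show "etgt y \<in> V" unfolding V_def by blast
  next
    assume "etgt y \<in> V"
    then have "path c (\<kappa> (etgt y) @ [(y, False)]) (esrc y)" "fst ` set (\<kappa> (etgt y) @ [(y, False)]) \<subseteq> A"
      using \<kappa> that by (auto simp: path_append)
    then show "esrc y \<in> V" unfolding V_def by blast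
  qed
  define AR where "AR = {y\<in>A. esrc y \<in> V}"
  define g where "g y = lab (\<kappa> (esrc y)) @ [(elab y, True)] @ winv (lab (\<kappa> (etgt y)))" for y
  have V_path: "v \<in> V \<and> fst ` set \<pi> \<subseteq> AR" if "path u \<pi> v" "fst ` set \<pi> \<subseteq> A" "u \<in> V" for u \<pi> v
    using that
  proof (induction u \<pi> v rule: path.induct)
    case (2 i y s \<pi> j)
    then show ?case using V_step[of y] by (cases s) (auto simp: AR_def)
  qed simp
  have V_path': "fst ` set \<pi> \<inter> AR = {}" if "path u \<pi> v" "fst ` set \<pi> \<subseteq> A" "u \<notin> V" for u \<pi> v
    using that
  proof (induction u \<pi> v rule: path.induct)
    case (2 i y s \<pi> j)
    then show ?case using V_step[of y] by (cases s) (auto simp: AR_def)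
  qed simp
  note tele = null_telescope[OF \<kappa>(1) g_def]
  \<comment> \<open>\<open>loc_indicable\<close> takes words as letters, so a path in the edges is
    rewritten as a word in the letters \<open>g y\<close>.\<close>
  define ren where "ren = map (\<lambda>(y :: 'e edge, s :: bool). (g y, s))"
  have ren: "subst (\<lambda>g. g) (ren \<pi>) = subst g \<pi>" "word_sum \<psi> (ren \<pi>) = word_sum (\<lambda>y. \<psi> (g y)) \<pi>"
    "fst ` set (ren \<pi>) = g ` fst ` set \<pi>" for \<pi> and \<psi> :: "'e word \<Rightarrow> rat"
    by (induction \<pi>) (auto simp: ren_def)
  have "\<forall>h\<in>g ` AR. null_word R h"
  proof (rule li[unfolded loc_indicable_def, THEN spec, THEN mp, THEN mp])
    show "finite (g ` AR)" using finD by (simp add: AR_def A_def)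
    show "\<forall>\<psi>::'e word \<Rightarrow> rat. (\<forall>W. fst ` set W \<subseteq> g ` AR \<longrightarrow> null_word R (subst (\<lambda>g. g) W) \<longrightarrow>
        word_sum \<psi> W = 0) \<longrightarrow> (\<forall>w\<in>g ` AR. \<psi> w = 0)"
  proof (intro allI impI ballI)
    fix \<psi> :: "'e word \<Rightarrow> rat" and w
    assume \<psi>: "\<forall>W. fst ` set W \<subseteq> g ` AR \<longrightarrow> null_word R (subst (\<lambda>g. g) W) \<longrightarrow> word_sum \<psi> W = 0"
      and "w \<in> g ` AR"
    then obtain y where y: "y \<in> AR" "w = g y" by blast
    have \<psi>0: "word_sum (\<lambda>y. \<psi> (g y)) \<pi> = 0" if "fst ` set \<pi> \<subseteq> AR" "null_word R (subst g \<pi>)" for \<pi>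
      using \<psi>[rule_format, of "ren \<pi>"] that unfolding ren by blast
    define h where "h y = (if y \<in> AR then \<psi> (g y) else 0)" for y
    define Yx where "Yx = {y\<in>D. elab y = x}"
    \<comment> \<open>On every cell over \<open>r\<close> the values on the \<open>x\<close>-edges
      are to cancel the contribution of the other edges.\<close>
    obtain h2 :: "'e edge \<Rightarrow> rat" where h2: "\<And>\<pi>. \<pi> \<in> cells D {r} \<Longrightarrow>
        (\<Sum>y\<in>Yx. h2 y * of_int (expo y \<pi>)) = - word_sum h \<pi>"
      using dual_functional[OF indep_x, of "\<lambda>\<pi>. - word_sum h \<pi>"] fin_cells[of D "{r}"] finD
      unfolding Yx_def by (auto elim!: exE)
    define h' where "h' y = (if y \<in> Yx then h2 y else h y)" for y
    have "word_sum h' \<pi> = 0" if \<pi>: "\<pi> \<in> cells D R1" for \<pi>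
    proof (cases "\<pi> \<in> cells D R")
      case True
      have A: "fst ` set \<pi> \<subseteq> A" using True cells_R_xfree[OF True] by (auto simp: A_def cells_def)
      have "word_sum h' \<pi> = word_sum h \<pi>"
        using A by (intro word_sum_cong) (auto simp: h'_def Yx_def A_def)
      also have "\<dots> = 0"
      proof (cases "pstart \<pi> \<in> V")
        case V: True
        have AR: "fst ` set \<pi> \<subseteq> AR" using V_path[OF cells_path[OF True] A V] by simp
        have "word_sum h \<pi> = word_sum (\<lambda>y. \<psi> (g y)) \<pi>"
          using AR by (intro word_sum_cong) (auto simp: h_def)
        also have "\<dots> = 0"
        proof (rule \<psi>0[OF AR])
          have "null_word R (lab \<pi>)" using True by (intro null_word_relator) (simp add: cells_def)
          then have "null_word R (lab (\<kappa> (pstart \<pi>)) @ lab \<pi> @ winv (lab (\<kappa> (pstart \<pi>))))"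
            by (rule null_word_insert[OF _ null_word_winv])
          then show "null_word R (subst g \<pi>)"
            using tele[OF _ cells_path[OF True], of V "[]" "[]"] by simp
        qed
        finally show ?thesis .
      next
        case False
        then show ?thesis
          using V_path'[OF cells_path[OF True] A] by (intro word_sum_zero) (auto simp: h_def)
      qed
      finally show ?thesis .
    next
      case False
      then have \<pi>r: "\<pi> \<in> cells D {r}" using \<pi> cells_R1 by blast
      have sub: "fst ` set \<pi> \<subseteq> D" using \<pi> by (simp add: cells_def)
      have "word_sum h' \<pi> = (\<Sum>y\<in>D. h' y * of_int (expo y \<pi>))" by (rule word_sum_expo[OF finD sub])
      also have "\<dots> = (\<Sum>y\<in>D. (if y \<in> Yx then h2 y * of_int (expo y \<pi>) else 0) + h y * of_int (expo y \<pi>))"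
        by (intro sum.cong) (auto simp: h'_def h_def AR_def A_def Yx_def)
      also have "\<dots> = (\<Sum>y\<in>D. (if y \<in> Yx then h2 y * of_int (expo y \<pi>) else 0)) + word_sum h \<pi>"
        unfolding sum.distrib word_sum_expo[OF finD sub] ..
      also have "(\<Sum>y\<in>D. (if y \<in> Yx then h2 y * of_int (expo y \<pi>) else 0)) = (\<Sum>y\<in>Yx. h2 y * of_int (expo y \<pi>))"
        using finD by (subst sum.inter_filter[symmetric]) (auto simp: Yx_def intro!: sum.cong)
      finally show ?thesis using h2[OF \<pi>r] by simp
    qed
    then have "\<exists>f. \<forall>y\<in>D. h' y = f (etgt y) - f (esrc y)" by (rule H1_trivialD[OF H1D])
    then obtain f where f: "\<forall>y\<in>D. h' y = f (etgt y) - f (esrc y)" by (elim exE)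
    have yA: "y \<in> A" "esrc y \<in> V" "etgt y \<in> V" using y(1) V_step[of y] by (simp_all add: AR_def)
    \<comment> \<open>This loop has label \<open>g y\<close>, so followed by the inverse letter of
      \<open>y\<close> it gives a relation. Hence \<open>\<psi> (g y)\<close> is the value of the
      coboundary \<open>h'\<close> on a loop.\<close>
    define \<chi> where "\<chi> = \<kappa> (esrc y) @ [(y, True)] @ winv (\<kappa> (etgt y))"
    have \<chi>p: "path c \<chi> c" unfolding \<chi>_def
      using \<kappa>(1)[OF yA(2)] path_winv[OF \<kappa>(1)[OF yA(3)]] by (auto simp: path_append)
    have \<chi>A: "fst ` set \<chi> \<subseteq> A" unfolding \<chi>_def using \<kappa>(2)[OF yA(2)] \<kappa>(2)[OF yA(3)] yA(1)
      by (simp add: image_Un)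
    have \<chi>AR: "fst ` set \<chi> \<subseteq> AR" using V_path[OF \<chi>p \<chi>A cV] by simp
    have "lab \<chi> = g y" by (simp add: \<chi>_def g_def)
    then have "null_word R ([] @ subst g \<chi> @ winv (g y))"
      using tele[OF _ \<chi>p, of V "[]" "winv (g y)"] \<kappa>c null_word_winv[of R "g y"] by simp
    then have "word_sum (\<lambda>y. \<psi> (g y)) (\<chi> @ [(y, False)]) = 0"
      using \<chi>AR y(1) by (intro \<psi>0) auto
    moreover have "word_sum (\<lambda>y. \<psi> (g y)) \<chi> = word_sum h' \<chi>"
      using \<chi>AR by (intro word_sum_cong) (auto simp: h'_def h_def AR_def A_def Yx_def)
    moreover have "word_sum h' \<chi> = f c - f c"
      using \<chi>A f by (intro word_sum_coboundary[OF \<chi>p]) (auto simp: A_def)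
    ultimately show "\<psi> w = 0" using y(2) by simp
  qed
  qed
  moreover have "null_word R (subst g \<pi>)" if "\<forall>y\<in>fst ` set \<pi>. null_word R (g y)" for \<pi>
    using that
  proof (induction \<pi>)
    case (Cons l \<pi>)
    then show ?case by (cases l) (auto intro!: null_word_append null_word_winvI)
  qed (simp add: null_Nil)
  moreover have "fst ` set \<beta> \<subseteq> A" using \<beta>(2,3) unfolding A_def by blast
  then have "fst ` set \<beta> \<subseteq> AR" using V_path[OF \<beta>(1) _ cV] by simp
  ultimately have "null_word R (subst g \<beta>)" by blast
  then show ?thesis using tele[OF _ \<beta>(1), of V "[]" "[]"] \<kappa>c by simp
qed

subsection \<open>Extremal edges of the new cells\<close>

definition xs :: "'e edge word \<Rightarrow> 'e edge set" where
  "xs \<pi> = {y \<in> fst ` set \<pi>. elab y = x}"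

text \<open>\<open>\<sigma> = 1\<close> selects a highest \<open>x\<close>-edge and
  \<open>\<sigma> = -1\<close> a lowest one; the induction behind \<open>ext_expo_nonzero\<close>
  alternates between the two.\<close>

definition ext :: "int \<Rightarrow> 'e edge word \<Rightarrow> 'e edge" where
  "ext \<sigma> \<pi> = (SOME y. y \<in> xs \<pi> \<and> (\<forall>z\<in>xs \<pi>. \<sigma> * esrc z \<le> \<sigma> * esrc y))"

lemma finite_xs: "finite (xs \<pi>)"
  by (simp add: xs_def)

lemma xs_nonempty:
  assumes "\<pi> \<in> cells D {r}"
  shows "xs \<pi> \<noteq> {}"
proof -
  have "x \<in> fst ` set r" using xr expo_eq_0 by metis
  moreover have "r = lab \<pi>" using assms by (simp add: cells_def)
  ultimately show ?thesis by (force simp: xs_def lab_def)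
qed

lemma ext:
  assumes "\<pi> \<in> cells D {r}"
  shows "ext \<sigma> \<pi> \<in> xs \<pi>" "\<And>z. z \<in> xs \<pi> \<Longrightarrow> \<sigma> * esrc z \<le> \<sigma> * esrc (ext \<sigma> \<pi>)"
proof -
  have "\<exists>y. y \<in> xs \<pi> \<and> (\<forall>z\<in>xs \<pi>. \<sigma> * esrc z \<le> \<sigma> * esrc y)"
  proof -
    let ?I = "(\<lambda>z. \<sigma> * esrc z) ` xs \<pi>"
    have "Max ?I \<in> ?I" using xs_nonempty[OF assms] finite_xs by (intro Max_in) auto
    then obtain y where "y \<in> xs \<pi>" "Max ?I = \<sigma> * esrc y" by blast
    moreover have "\<forall>z\<in>xs \<pi>. \<sigma> * esrc z \<le> Max ?I"
      using finite_xs by (intro ballI Max_ge) auto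
    ultimately show ?thesis by metis
  qed
  from someI_ex[OF this]
  show "ext \<sigma> \<pi> \<in> xs \<pi>" "\<And>z. z \<in> xs \<pi> \<Longrightarrow> \<sigma> * esrc z \<le> \<sigma> * esrc (ext \<sigma> \<pi>)"
    unfolding ext_def by blast+
qed

lemma ext_path: "\<pi> \<in> cells D {r} \<Longrightarrow> ext \<sigma> \<pi> \<in> fst ` set \<pi> \<and> elab (ext \<sigma> \<pi>) = x \<and> ext \<sigma> \<pi> \<in> D"
  using ext(1)[of \<pi> \<sigma>] by (auto simp: xs_def cells_def)

text \<open>Order preservation of the labels propagates \<open>i < i'\<close> along two readings of
  the same word.\<close>

lemma path_shift:
  assumes "path i \<pi> j" "path i' \<pi>' j'" "fst ` set \<pi> \<subseteq> D" "fst ` set \<pi>' \<subseteq> D" "lab \<pi> = lab \<pi>'" "i < i'"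
  shows "list_all2 (\<lambda>l l'. elab (fst l) = elab (fst l') \<and> esrc (fst l) < esrc (fst l')) \<pi> \<pi>'"
  using assms
proof (induction \<pi> arbitrary: i i' \<pi>')
  case Nil
  then show ?case by (cases \<pi>') (auto simp: lab_def)
next
  case (Cons l \<pi>)
  obtain y s where l: "l = (y, s)" by (cases l)
  obtain z \<pi>2 where p': "\<pi>' = (z, s) # \<pi>2" "elab y = elab z" "lab \<pi> = lab \<pi>2"
    using Cons.prems(5) by (cases \<pi>') (auto simp: l lab_def)
  have "y \<in> D" "z \<in> D" using Cons.prems by (auto simp: l p')
  then have less: "esrc y < esrc z \<longleftrightarrow> etgt y < etgt z"
    by (rule monotone_edges_less[OF mono _ _ p'(2)])
  show ?case
  proof (cases s)
    case True
    then show ?thesis using Cons.IH[of "etgt y" "etgt z" \<pi>2] Cons.prems less p' by (auto simp: l)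
  next
    case False
    then show ?thesis using Cons.IH[of "esrc y" "esrc z" \<pi>2] Cons.prems less p' by (auto simp: l)
  qed
qed

lemma xs_shift:
  assumes "\<pi> \<in> cells D {r}" "\<pi>' \<in> cells D {r}" "pstart \<pi> < pstart \<pi>'"
  shows "y \<in> xs \<pi> \<Longrightarrow> \<exists>z\<in>xs \<pi>'. esrc y < esrc z" "z \<in> xs \<pi>' \<Longrightarrow> \<exists>y\<in>xs \<pi>. esrc y < esrc z"
proof -
  have A: "list_all2 (\<lambda>l l'. elab (fst l) = elab (fst l') \<and> esrc (fst l) < esrc (fst l')) \<pi> \<pi>'"
    by (rule path_shift[OF cells_path[OF assms(1)] cells_path[OF assms(2)] _ _ _ assms(3)])
      (use assms(1,2) in \<open>auto simp: cells_def\<close>)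
  note A = A[unfolded list_all2_conv_all_nth]
  { assume "y \<in> xs \<pi>"
    then obtain k where "k < length \<pi>" "y = fst (\<pi> ! k)" "elab y = x"
      unfolding xs_def by (auto simp: in_set_conv_nth)
    then have "fst (\<pi>' ! k) \<in> xs \<pi>' \<and> esrc y < esrc (fst (\<pi>' ! k))" using A by (auto simp: xs_def)
    then show "\<exists>z\<in>xs \<pi>'. esrc y < esrc z" by blast }
  { assume "z \<in> xs \<pi>'"
    then obtain k where "k < length \<pi>'" "z = fst (\<pi>' ! k)" "elab z = x"
      unfolding xs_def by (auto simp: in_set_conv_nth)
    then have "fst (\<pi> ! k) \<in> xs \<pi> \<and> esrc (fst (\<pi> ! k)) < esrc z" using A by (auto simp: xs_def)
    then show "\<exists>y\<in>xs \<pi>. esrc y < esrc z" by blast }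
qed

text \<open>Moving the start in direction \<open>\<sigma>\<close> moves every \<open>x\<close>-edge
  in that direction, so the extremal one leaves the range of the earlier cell.\<close>

lemma ext_notin:
  assumes "\<pi> \<in> cells D {r}" "\<pi>' \<in> cells D {r}" "\<sigma> = 1 \<or> \<sigma> = -1" "\<sigma> * pstart \<pi> < \<sigma> * pstart \<pi>'"
  shows "ext \<sigma> \<pi>' \<notin> fst ` set \<pi>"
proof
  assume "ext \<sigma> \<pi>' \<in> fst ` set \<pi>"
  then have 1: "ext \<sigma> \<pi>' \<in> xs \<pi>" using ext_path[OF assms(2)] by (simp add: xs_def)
  have "\<exists>z\<in>xs \<pi>'. \<sigma> * esrc (ext \<sigma> \<pi>') < \<sigma> * esrc z"
    using assms(3)
  proof
    assume "\<sigma> = 1"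
    then show ?thesis using xs_shift(1)[OF assms(1,2) _ 1] assms(4) by simp
  next
    assume "\<sigma> = -1"
    then show ?thesis using xs_shift(2)[OF assms(2,1) _ 1] assms(4) by simp
  qed
  then show False using ext(2)[OF assms(2), of _ \<sigma>] by fastforce
qed

lemma pstart_inj:
  assumes "\<pi> \<in> cells D {r}" "\<pi>' \<in> cells D {r}" "pstart \<pi> = pstart \<pi>'"
  shows "\<pi> = \<pi>'"
  by (rule path_unique[OF mono cells_path[OF assms(1)] cells_path[OF assms(2), folded assms(3)]])
    (use assms(1,2) in \<open>auto simp: cells_def\<close>)

text \<open>The system is triangular: the extremal edge of a cell lies on no cell that starts before
  it in direction \<open>\<tau>\<close>. Taking the cells in this order, the value at that edge is
  adjusted without disturbing the earlier cells.\<close>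

lemma triangular_solve:
  fixes h0 :: "'e edge \<Rightarrow> rat"
  assumes "finite C" "C \<subseteq> cells D {r}" "\<And>\<pi>. \<pi> \<in> C \<Longrightarrow> expo (ext \<tau> \<pi>) \<pi> \<noteq> 0" "\<tau> = 1 \<or> \<tau> = -1"
  shows "\<exists>h. (\<forall>y. y \<notin> ext \<tau> ` C \<longrightarrow> h y = h0 y) \<and> (\<forall>\<pi>\<in>C. word_sum h \<pi> = 0)"
  using assms(1,2,3)
proof (induction C rule: finite_ranking_induct[where f = "\<lambda>\<pi>. \<tau> * pstart \<pi>"])
  case empty
  then show ?case by auto
next
  case (insert \<pi> C)
  then obtain h where h: "\<forall>y. y \<notin> ext \<tau> ` C \<longrightarrow> h y = h0 y" "\<forall>\<pi>\<in>C. word_sum h \<pi> = 0" by auto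
  show ?case
  proof (cases "\<pi> \<in> C")
    case True
    then show ?thesis using h by (intro exI[of _ h]) (simp add: insert_absorb)
  next
    case False
    let ?m = "ext \<tau> \<pi>"
    have e: "expo ?m \<pi> \<noteq> 0" using insert.prems(2) by simp
    let ?h = "h(?m := h ?m - word_sum h \<pi> / of_int (expo ?m \<pi>))"
    have "word_sum ?h \<pi> = 0" using e by (simp add: word_sum_upd)
    moreover have "word_sum ?h \<pi>' = 0" if \<pi>': "\<pi>' \<in> C" for \<pi>'
    proof -
      have c: "\<pi>' \<in> cells D {r}" "\<pi> \<in> cells D {r}" using insert.prems(1) \<pi>' by auto
      have "\<tau> * pstart \<pi>' \<noteq> \<tau> * pstart \<pi>" using pstart_inj[OF c] False \<pi>' assms(4) by auto
      then have "\<tau> * pstart \<pi>' < \<tau> * pstart \<pi>"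
        by (rule order.not_eq_order_implies_strict[OF _ insert.hyps(2)[OF \<pi>']])
      then have "?m \<notin> fst ` set \<pi>'" by (rule ext_notin[OF c assms(4)])
      then show ?thesis using h(2) \<pi>' by (simp add: word_sum_upd expo_eq_0)
    qed
    ultimately have "\<forall>\<pi>'\<in>insert \<pi> C. word_sum ?h \<pi>' = 0" by blast
    moreover have "\<forall>y. y \<notin> ext \<tau> ` insert \<pi> C \<longrightarrow> ?h y = h0 y"
    proof (intro allI impI)
      fix y assume "y \<notin> ext \<tau> ` insert \<pi> C"
      then have "y \<noteq> ?m" "y \<notin> ext \<tau> ` C" by blast+
      then show "?h y = h0 y" using h(1)[rule_format, of y] by simp
    qed
    ultimately show ?thesis by (intro exI conjI)
  qed
qed

text \<open>The indicator of \<open>z\<close> is made into a cocycle by changing it on extremal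
  edges only, which \<open>\<beta>\<close> avoids. It is then a coboundary and vanishes on
  \<open>\<beta>\<close>, where it counts \<open>z\<close>.\<close>

lemma expo_zero_off_ext:
  assumes S: "S \<subseteq> D" "H1_trivial R1 S"
    and \<tau>: "\<tau> = 1 \<or> \<tau> = -1" "\<And>\<pi>. \<pi> \<in> cells S {r} \<Longrightarrow> expo (ext \<tau> \<pi>) \<pi> \<noteq> 0"
    and \<beta>: "path i \<beta> i" "fst ` set \<beta> \<subseteq> S" "\<And>\<pi>. \<pi> \<in> cells S {r} \<Longrightarrow> ext \<tau> \<pi> \<notin> fst ` set \<beta>"
    and z: "elab z = x"
  shows "expo z \<beta> = 0"
proof (cases "z \<in> fst ` set \<beta>")
  case True
  have sub: "cells S {r} \<subseteq> cells D {r}" using S(1) by (intro cells_mono) auto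
  obtain h where h: "\<forall>y. y \<notin> ext \<tau> ` cells S {r} \<longrightarrow> h y = (if y = z then 1 else 0 :: rat)"
    "\<forall>\<pi>\<in>cells S {r}. word_sum h \<pi> = 0"
    using triangular_solve[OF fin_cells[OF S(1), of "{r}"] sub \<tau>(2,1), of "\<lambda>y. if y = z then 1 else 0"] by auto
  have "word_sum h \<pi> = 0" if \<pi>: "\<pi> \<in> cells S R1" for \<pi>
  proof (cases "\<pi> \<in> cells S {r}")
    case True
    then show ?thesis using h(2) by blast
  next
    case False
    then have \<pi>R: "\<pi> \<in> cells S R" using \<pi> cells_R1 by blast
    show ?thesis
    proof (rule word_sum_zero)
      fix y assume "y \<in> fst ` set \<pi>"
      then have yx: "elab y \<noteq> x" by (rule cells_R_xfree[OF \<pi>R])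
      then have ye: "y \<notin> ext \<tau> ` cells S {r}" using ext_path sub by blast
      show "h y = 0" using h(1)[rule_format, OF ye] yx z by (cases "y = z") simp_all
    qed
  qed
  then have "\<exists>f. \<forall>y\<in>S. h y = f (etgt y) - f (esrc y)" by (rule H1_trivialD[OF S(2)])
  then obtain f where f: "\<forall>y\<in>S. h y = f (etgt y) - f (esrc y)" by (elim exE)
  have "word_sum h \<beta> = f i - f i" by (rule word_sum_coboundary[OF \<beta>(1)]) (use f \<beta>(2) in blast)
  moreover have "word_sum h \<beta> = word_sum (\<lambda>y. if y = z then 1 else 0) \<beta>"
  proof (rule word_sum_cong)
    fix y assume "y \<in> fst ` set \<beta>"
    then have "y \<notin> ext \<tau> ` cells S {r}" using \<beta>(3) by blast
    then show "h y = (if y = z then 1 else 0)" by (rule h(1)[rule_format])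
  qed
  ultimately show ?thesis by (simp add: word_sum_single)
qed (rule expo_eq_0)

text \<open>Since the lower groups see the reduced relator faithfully, no cell can leave an \<open>x\<close>-edge and
  come back through it along a path on which all exponent sums vanish.\<close>

lemma no_excursion:
  assumes \<pi>: "\<pi> \<in> cells D {r}" "\<pi> @ \<pi> = U @ (y, s) # \<beta> @ (y, \<not> s) # V" "elab y = x"
    and zero: "\<And>i \<beta>' z. path i \<beta>' i \<Longrightarrow> fst ` set \<beta>' \<subseteq> fst ` set \<beta> \<Longrightarrow> elab z = x \<Longrightarrow> expo z \<beta>' = 0"
  shows False
proof -
  have pp: "path (pstart \<pi>) (\<pi> @ \<pi>) (pstart \<pi>)" using cells_path[OF \<pi>(1)] by (auto simp: path_append)
  have lr: "r = lab \<pi>" using \<pi>(1) by (simp add: cells_def)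
  have *: "False" if "\<pi> @ \<pi> = U @ (y, s) # \<gamma> @ (y, \<not> s) # V" "elab y = x" "fst ` set \<gamma> \<subseteq> fst ` set \<beta>" for U y s \<gamma> V
    using that
  proof (induction "length \<gamma>" arbitrary: U y s \<gamma> V rule: less_induct)
    case less
    define c where "c = (if s then etgt y else esrc y)"
    have c: "path c \<gamma> c" unfolding c_def by (rule path_split_opposite(1)) (rule pp[unfolded less.prems(1)])
    have "fst ` set (\<pi> @ \<pi>) \<subseteq> D" using \<pi>(1) by (auto simp: cells_def)
    then have \<gamma>D: "fst ` set \<gamma> \<subseteq> D" unfolding less.prems(1) by (simp add: image_Un)
    show ?case
    proof (cases "\<exists>z\<in>fst ` set \<gamma>. elab z = x")
      case False
      have "null_word R (lab \<gamma>)" by (rule xfree_loops_null[OF c \<gamma>D]) (use False in blast)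
      moreover have "x \<notin> fst ` set (lab \<gamma>)" using False by (force simp: lab_def)
      moreover have "lab (\<pi> @ \<pi>) = lab (U @ (y, s) # \<gamma> @ (y, \<not> s) # V)" using less.prems(1) by simp
      then have "r @ r = lab U @ (x, s) # lab \<gamma> @ (x, \<not> s) # lab V" using less.prems(2) by (simp add: lr)
      ultimately show False using red by blast
    next
      case True
      then obtain z where z: "z \<in> fst ` set \<gamma>" "elab z = x" by blast
      \<comment> \<open>Two opposite passages of \<open>z\<close> enclose a shorter excursion of the
        same kind; the descent stops at an \<open>x\<close>-free loop.\<close>
      have "expo z \<gamma> = 0" by (rule zero[OF c less.prems(3) z(2)])
      then obtain \<beta>1 t \<beta>2 \<beta>3 where s: "\<gamma> = \<beta>1 @ (z, t) # \<beta>2 @ (z, \<not> t) # \<beta>3"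
        by (rule expo_split[OF z(1)])
      show False
      proof (rule less.hyps[of \<beta>2 "U @ (y, s) # \<beta>1" z t "\<beta>3 @ (y, \<not> s) # V"])
        show "fst ` set \<beta>2 \<subseteq> fst ` set \<beta>" using less.prems(3) unfolding s by (simp add: image_Un)
      qed (use s z less.prems(1) in simp_all)
    qed
  qed
  show False by (rule *[OF \<pi>(2,3) subset_refl])
qed

text \<open>A rational collapse: \<open>M\<close> lies on the single cell \<open>\<pi>\<close>, so a
  cocycle on the smaller graph extends by the value at \<open>M\<close> that makes it vanish on
  \<open>\<pi>\<close>.\<close>

lemma H1_remove:
  assumes S: "S \<subseteq> D" "H1_trivial R1 S" and \<pi>: "\<pi> \<in> cells S R1" "expo M \<pi> \<noteq> 0"
    and only: "\<And>\<pi>'. \<pi>' \<in> cells S R1 \<Longrightarrow> \<pi>' \<noteq> \<pi> \<Longrightarrow> M \<notin> fst ` set \<pi>'"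
  shows "H1_trivial R1 (S - {M})"
  unfolding H1_trivial_def
proof (intro allI impI)
  fix h :: "'e edge \<Rightarrow> rat" assume h: "\<forall>\<pi>\<in>cells (S - {M}) R1. word_sum h \<pi> = 0"
  let ?h = "h(M := h M - word_sum h \<pi> / of_int (expo M \<pi>))"
  have "word_sum ?h \<pi>' = 0" if "\<pi>' \<in> cells S R1" for \<pi>'
  proof (cases "\<pi>' = \<pi>")
    case True
    then show ?thesis using \<pi>(2) by (simp add: word_sum_upd)
  next
    case False
    have M: "M \<notin> fst ` set \<pi>'" by (rule only[OF that False])
    then have "\<pi>' \<in> cells (S - {M}) R1" using that by (auto simp: cells_def)
    then show ?thesis using h M by (simp add: word_sum_upd expo_eq_0)
  qed
  then have "\<exists>f. \<forall>y\<in>S. ?h y = f (etgt y) - f (esrc y)" by (rule H1_trivialD[OF S(2)])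
  then obtain f where f: "\<forall>y\<in>S. ?h y = f (etgt y) - f (esrc y)" by (elim exE)
  have "h y = f (etgt y) - f (esrc y)" if "y \<in> S - {M}" for y
    using f[rule_format, of y] that by simp
  then show "\<exists>f. \<forall>y\<in>S - {M}. h y = f (etgt y) - f (esrc y)" by (intro exI ballI)
qed

section \<open>Top cells and their extremal edges\<close>

definition top_cell :: "int \<Rightarrow> 'e edge set \<Rightarrow> 'e edge word \<Rightarrow> bool" where
  "top_cell \<sigma> S \<pi> \<longleftrightarrow> \<pi> \<in> cells S {r} \<and> (\<forall>\<pi>'\<in>cells S {r}. \<pi>' \<noteq> \<pi> \<longrightarrow> \<sigma> * pstart \<pi>' < \<sigma> * pstart \<pi>)"

lemma ex_top_cell:
  assumes "S \<subseteq> D" "cells S {r} \<noteq> {}" "\<sigma> = 1 \<or> \<sigma> = -1"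
  shows "\<exists>\<pi>. top_cell \<sigma> S \<pi>"
proof -
  let ?I = "(\<lambda>\<pi>. \<sigma> * pstart \<pi>) ` cells S {r}"
  have fin: "finite ?I" using fin_cells[OF assms(1), of "{r}"] by simp
  have "Max ?I \<in> ?I" using fin assms(2) by (intro Max_in) auto
  then obtain \<pi> where \<pi>: "\<pi> \<in> cells S {r}" "Max ?I = \<sigma> * pstart \<pi>" by blast
  have "\<sigma> * pstart \<pi>' < \<sigma> * pstart \<pi>" if "\<pi>' \<in> cells S {r}" "\<pi>' \<noteq> \<pi>" for \<pi>'
  proof -
    have sub: "cells S {r} \<subseteq> cells D {r}" using assms(1) by (intro cells_mono) auto
    have "\<sigma> * pstart \<pi>' \<le> \<sigma> * pstart \<pi>" unfolding \<pi>(2)[symmetric] using fin that(1) by (intro Max_ge) auto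
    moreover have "pstart \<pi>' \<noteq> pstart \<pi>" using pstart_inj[of \<pi>' \<pi>] sub that \<pi>(1) by blast
    ultimately show ?thesis using assms(3) by auto
  qed
  then show ?thesis using \<pi>(1) unfolding top_cell_def by blast
qed

lemma top_cell_only:
  assumes "S \<subseteq> D" "\<sigma> = 1 \<or> \<sigma> = -1" "top_cell \<sigma> S \<pi>" "\<pi>' \<in> cells S R1" "\<pi>' \<noteq> \<pi>"
  shows "ext \<sigma> \<pi> \<notin> fst ` set \<pi>'"
proof (cases "\<pi>' \<in> cells S {r}")
  case True
  have sub: "cells S {r} \<subseteq> cells D {r}" using assms(1) by (intro cells_mono) auto
  show ?thesis
    by (rule ext_notin[OF _ _ assms(2)]) (use True sub assms(3,5) in \<open>auto simp: top_cell_def\<close>)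
next
  case False
  then have "\<pi>' \<in> cells S R" using assms(4) cells_R1 by blast
  moreover have "elab (ext \<sigma> \<pi>) = x"
    using assms(1,3) ext_path cells_mono[OF assms(1) subset_refl] unfolding top_cell_def by blast
  ultimately show ?thesis using cells_R_xfree by blast
qed

text \<open>If the top edge \<open>M\<close> of the top cell had exponent sum zero, it would separate the graph. One of
  the two sides is again acyclic, but the top cell enters and leaves both sides through \<open>M\<close>.\<close>

lemma top_expo_nonzero:
  assumes S: "S \<subseteq> D" "H1_trivial R1 S" and \<sigma>: "\<sigma> = 1 \<or> \<sigma> = -1" and top: "top_cell \<sigma> S \<pi>"
    and IH: "\<And>S' \<pi>'. S' \<subset> S \<Longrightarrow> H1_trivial R1 S' \<Longrightarrow> \<pi>' \<in> cells S' {r} \<Longrightarrow> expo (ext (- \<sigma>) \<pi>') \<pi>' \<noteq> 0"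
  shows "expo (ext \<sigma> \<pi>) \<pi> \<noteq> 0"
proof
  define M where "M = ext \<sigma> \<pi>"
  assume "expo (ext \<sigma> \<pi>) \<pi> = 0"
  then have e0: "expo M \<pi> = 0" by (simp add: M_def)
  have \<pi>S: "\<pi> \<in> cells S {r}" using top by (simp add: top_cell_def)
  have subD: "cells S {r} \<subseteq> cells D {r}" using S(1) by (intro cells_mono) auto
  have \<pi>D: "\<pi> \<in> cells D {r}" using \<pi>S subD by blast
  have M\<pi>: "M \<in> fst ` set \<pi>" and Mx: "elab M = x" using ext_path[OF \<pi>D, of \<sigma>] by (simp_all add: M_def)
  have MS: "M \<in> S" using M\<pi> \<pi>S by (auto simp: cells_def)
  have only: "M \<notin> fst ` set \<pi>'" if "\<pi>' \<in> cells S R1" "\<pi>' \<noteq> \<pi>" for \<pi>'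
    unfolding M_def by (rule top_cell_only[OF S(1) \<sigma> top that])
  \<comment> \<open>\<open>M\<close> lies on no other cell and has sum zero on \<open>\<pi>\<close>,
    so its indicator is a cocycle. Its primitive \<open>f\<close> is constant along all other edges
    and jumps across \<open>M\<close>, and so tells the two sides apart.\<close>
  have "\<exists>f. \<forall>y\<in>S. (if y = M then 1 else 0 :: rat) = f (etgt y) - f (esrc y)"
  proof (rule H1_trivialD[OF S(2)])
    fix \<pi>' assume "\<pi>' \<in> cells S R1"
    then have "expo M \<pi>' = 0" using only e0 expo_eq_0 by metis
    then show "word_sum (\<lambda>y. if y = M then 1 else 0 :: rat) \<pi>' = 0" by (simp add: word_sum_single)
  qed
  then obtain f where f: "\<forall>y\<in>S. (if y = M then 1 else 0 :: rat) = f (etgt y) - f (esrc y)" by (elim exE)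
  define v1 where "v1 = f (etgt M)"
  define v0 where "v0 = f (esrc M)"
  have v: "v1 = v0 + 1" using f[rule_format, OF MS] by (simp add: v1_def v0_def)
  define Z where "Z v = {y\<in>S. y \<noteq> M \<and> f (esrc y) = v}" for v
  have fM: "f (etgt y) = f (esrc y)" if "y \<in> S" "y \<noteq> M" for y
    using f[rule_format, OF that(1)] that(2) by simp
  have zone: "f j = f i \<and> fst ` set \<alpha> \<subseteq> Z (f i)" if "path i \<alpha> j" "fst ` set \<alpha> \<subseteq> S" "M \<notin> fst ` set \<alpha>" for i \<alpha> j
    using that
  proof (induction i \<alpha> j rule: path.induct)
    case (2 i y s \<alpha> j)
    have y: "y \<in> S" "y \<noteq> M" using 2 by auto
    show ?case using 2 fM[OF y] y by (cases s) (auto simp: Z_def)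
  qed simp
  have Z_less: "Z v \<subset> S" for v using MS by (auto simp: Z_def)
  have ZD: "Z v \<subseteq> D" for v using S(1) by (auto simp: Z_def)
  \<comment> \<open>Cells other than \<open>\<pi>\<close> stay on one side. Two cocycles, one on
    each side and neither a coboundary, could be combined nontrivially to vanish on
    \<open>\<pi>\<close> as well, and the combination would be a coboundary.\<close>
  have ZH1: "H1_trivial R1 (Z v1) \<or> H1_trivial R1 (Z v0)"
  proof (rule ccontr)
    assume "\<not> ?thesis"
    then obtain h1 h0 :: "'e edge \<Rightarrow> rat" where
      h1: "\<forall>\<pi>\<in>cells (Z v1) R1. word_sum h1 \<pi> = 0" "\<not> (\<exists>f. \<forall>y\<in>Z v1. h1 y = f (etgt y) - f (esrc y))" and
      h0: "\<forall>\<pi>\<in>cells (Z v0) R1. word_sum h0 \<pi> = 0" "\<not> (\<exists>f. \<forall>y\<in>Z v0. h0 y = f (etgt y) - f (esrc y))"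
      unfolding H1_trivial_def by blast
    define H where "H v h y = (if y \<in> Z v then h y else 0)" for v and h :: "'e edge \<Rightarrow> rat" and y
    have Hcell: "word_sum (H v h) \<pi>' = 0"
      if h: "\<forall>\<pi>\<in>cells (Z v) R1. word_sum h \<pi> = 0" and \<pi>': "\<pi>' \<in> cells S R1" "\<pi>' \<noteq> \<pi>" for v h \<pi>'
    proof -
      have sub: "fst ` set \<pi>' \<subseteq> Z (f (pstart \<pi>'))"
        using zone[OF cells_path[OF \<pi>'(1)]] only[OF \<pi>'] \<pi>'(1) by (simp add: cells_def)
      show ?thesis
      proof (cases "f (pstart \<pi>') = v")
        case True
        have "\<pi>' \<in> cells (Z v) R1" using \<pi>'(1) sub True by (auto simp: cells_def)
        moreover have "word_sum (H v h) \<pi>' = word_sum h \<pi>'"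
        proof (rule word_sum_cong)
          fix y assume "y \<in> fst ` set \<pi>'"
          then have "y \<in> Z v" using sub True by blast
          then show "H v h y = h y" by (simp add: H_def)
        qed
        ultimately show ?thesis using h by simp
      next
        case False
        show ?thesis
        proof (rule word_sum_zero)
          fix y assume "y \<in> fst ` set \<pi>'"
          then have "y \<in> Z (f (pstart \<pi>'))" using sub by blast
          then have "y \<notin> Z v" using False by (simp add: Z_def)
          then show "H v h y = 0" by (simp add: H_def)
        qed
      qed
    qed
    define a1 where "a1 = word_sum (H v1 h1) \<pi>"
    define a0 where "a0 = word_sum (H v0 h0) \<pi>"
    have cob: "\<exists>f. \<forall>y\<in>S. b * H v1 h1 y + c * H v0 h0 y = f (etgt y) - f (esrc y)" if "b * a1 + c * a0 = 0" for b c
    proof (rule H1_trivialD[OF S(2)])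
      fix \<pi>' assume \<pi>': "\<pi>' \<in> cells S R1"
      show "word_sum (\<lambda>y. b * H v1 h1 y + c * H v0 h0 y) \<pi>' = 0"
      proof (cases "\<pi>' = \<pi>")
        case True
        then show ?thesis using that unfolding word_sum_linear by (simp add: a1_def a0_def)
      next
        case False
        then show ?thesis unfolding word_sum_linear using Hcell[OF h1(1) \<pi>'] Hcell[OF h0(1) \<pi>'] by simp
      qed
    qed
    show False
    proof (cases "a0 = 0")
      case True
      have "\<exists>f. \<forall>y\<in>S. 0 * H v1 h1 y + 1 * H v0 h0 y = f (etgt y) - f (esrc y)"
        by (rule cob) (simp add: True)
      then obtain g where g: "\<forall>y\<in>S. 0 * H v1 h1 y + 1 * H v0 h0 y = g (etgt y) - g (esrc y)"
        by (elim exE)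
      have "h0 y = g (etgt y) - g (esrc y)" if y: "y \<in> Z v0" for y
      proof -
        have "y \<in> S" using y by (simp add: Z_def)
        from g[rule_format, OF this] show ?thesis using y by (simp add: H_def)
      qed
      then show False using h0(2) by blast
    next
      case False
      have "\<exists>f. \<forall>y\<in>S. 1 * H v1 h1 y + (- a1 / a0) * H v0 h0 y = f (etgt y) - f (esrc y)"
        by (rule cob) (simp add: False)
      then obtain g where g: "\<forall>y\<in>S. 1 * H v1 h1 y + (- a1 / a0) * H v0 h0 y = g (etgt y) - g (esrc y)"
        by (elim exE)
      have "h1 y = g (etgt y) - g (esrc y)" if y: "y \<in> Z v1" for y
      proof -
        have "y \<in> S" "y \<notin> Z v0" using y v by (simp_all add: Z_def)
        from g[rule_format, OF this(1)] this(2) show ?thesis using y by (simp add: H_def)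
      qed
      then show False using h1(2) by blast
    qed
  qed
  have pp: "path (pstart \<pi>) (\<pi> @ \<pi>) (pstart \<pi>)" using cells_path[OF \<pi>S] by (auto simp: path_append)
  have excursion: "\<not> H1_trivial R1 (Z (f (if s then etgt M else esrc M)))"
    if dec: "\<pi> @ \<pi> = U @ (M, s) # \<alpha> @ (M, \<not> s) # V" "M \<notin> fst ` set \<alpha>" for U s \<alpha> V
  proof
    define c where "c = (if s then etgt M else esrc M)"
    assume "H1_trivial R1 (Z (f (if s then etgt M else esrc M)))"
    then have H: "H1_trivial R1 (Z (f c))" by (simp add: c_def)
    have c: "path c \<alpha> c" unfolding c_def by (rule path_split_opposite(1)) (rule pp[unfolded dec(1)])
    have "fst ` set (\<pi> @ \<pi>) \<subseteq> S" using \<pi>S by (auto simp: cells_def)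
    then have "fst ` set \<alpha> \<subseteq> S" unfolding dec(1) by (simp add: image_Un)
    then have \<alpha>Z: "fst ` set \<alpha> \<subseteq> Z (f c)" using zone[OF c] dec(2) by simp
    have "fst ` set \<alpha> \<subseteq> fst ` set (\<pi> @ \<pi>)" unfolding dec(1) by auto
    then have \<alpha>\<pi>: "fst ` set \<alpha> \<subseteq> fst ` set \<pi>" by auto
    show False
    proof (rule no_excursion[OF \<pi>D dec(1) Mx])
      fix i \<beta>' z assume \<beta>': "path i \<beta>' i" "fst ` set \<beta>' \<subseteq> fst ` set \<alpha>" and z: "elab z = x"
      show "expo z \<beta>' = 0"
      proof (rule expo_zero_off_ext[OF ZD H _ _ \<beta>'(1) _ _ z])
        show "- \<sigma> = 1 \<or> - \<sigma> = -1" using \<sigma> by auto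
        show "expo (ext (- \<sigma>) \<pi>') \<pi>' \<noteq> 0" if "\<pi>' \<in> cells (Z (f c)) {r}" for \<pi>'
          by (rule IH[OF Z_less H that])
        show "fst ` set \<beta>' \<subseteq> Z (f c)" using \<beta>'(2) \<alpha>Z by blast
        \<comment> \<open>Cells on this side avoid \<open>M\<close>, hence differ from
          \<open>\<pi>\<close> and start before it in direction \<open>\<sigma>\<close>; their
          extremal edges in the opposite direction therefore miss \<open>\<pi>\<close>.\<close>
        show "ext (- \<sigma>) \<pi>' \<notin> fst ` set \<beta>'" if \<pi>': "\<pi>' \<in> cells (Z (f c)) {r}" for \<pi>'
        proof -
          have "cells (Z (f c)) {r} \<subseteq> cells S {r}" using Z_less by (intro cells_mono) auto
          then have \<pi>'S: "\<pi>' \<in> cells S {r}" using \<pi>' by blast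
          have "M \<notin> fst ` set \<pi>'" using \<pi>' by (auto simp: cells_def Z_def)
          then have "\<pi>' \<noteq> \<pi>" using M\<pi> by blast
          then have "\<sigma> * pstart \<pi>' < \<sigma> * pstart \<pi>" using top \<pi>'S by (simp add: top_cell_def)
          then have "ext (- \<sigma>) \<pi>' \<notin> fst ` set \<pi>"
            by (intro ext_notin[OF \<pi>D]) (use \<pi>'S subD \<sigma> in auto)
          then show ?thesis using \<beta>'(2) \<alpha>\<pi> by blast
        qed
      qed
    qed
  qed
  obtain \<pi>1 t \<pi>2 \<pi>3 where s: "\<pi> = \<pi>1 @ (M, t) # \<pi>2 @ (M, \<not> t) # \<pi>3"
    by (rule expo_split[OF M\<pi> e0])
  \<comment> \<open>Between the two passages of \<open>M\<close> the path runs on one side; the rest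
    of \<open>\<pi>\<close>, read around its end, joins the passages in the opposite order. This
    gives an excursion on each side.\<close>
  have 1: "\<pi> @ \<pi> = \<pi>1 @ ((M, t) # \<pi>2 @ [(M, \<not> t)]) @ (\<pi>3 @ \<pi>)" by (simp add: s)
  have 2: "\<pi> @ \<pi> = (\<pi>1 @ (M, t) # \<pi>2) @ ((M, \<not> t) # (\<pi>3 @ \<pi>1) @ [(M, \<not> \<not> t)]) @ (\<pi>2 @ (M, \<not> t) # \<pi>3)" by (simp add: s)
  obtain U \<alpha> V where a: "(M, t) # \<pi>2 @ [(M, \<not> t)] = U @ (M, t) # \<alpha> @ (M, \<not> t) # V" "M \<notin> fst ` set \<alpha>"
    using adjacent_split[of M t \<pi>2] by (elim exE conjE)
  obtain U' \<alpha>' V' where b: "(M, \<not> t) # (\<pi>3 @ \<pi>1) @ [(M, \<not> \<not> t)] = U' @ (M, \<not> t) # \<alpha>' @ (M, \<not> \<not> t) # V'" "M \<notin> fst ` set \<alpha>'"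
    using adjacent_split[of M "\<not> t" "\<pi>3 @ \<pi>1"] by (elim exE conjE)
  have "\<not> H1_trivial R1 (Z (f (if t then etgt M else esrc M)))"
    by (rule excursion[of "\<pi>1 @ U" t \<alpha> "V @ \<pi>3 @ \<pi>", OF _ a(2)]) (simp only: 1 a(1) append_assoc append_Cons)
  moreover have "\<not> H1_trivial R1 (Z (f (if \<not> t then etgt M else esrc M)))"
    by (rule excursion[of "(\<pi>1 @ (M, t) # \<pi>2) @ U'" "\<not> t" \<alpha>' "V' @ \<pi>2 @ (M, \<not> t) # \<pi>3", OF _ b(2)])
      (subst 2, subst b(1), simp)
  ultimately show False using ZH1 by (cases t) (auto simp: v1_def v0_def)
qed

text \<open>For the top cell the smaller graphs enter with the opposite sign. For any other cell the
  top cell is first collapsed through its extremal edge, which the other cell avoids.\<close>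

lemma ext_expo_nonzero:
  assumes "S \<subseteq> D" "H1_trivial R1 S" "\<pi> \<in> cells S {r}" "\<sigma> = 1 \<or> \<sigma> = -1"
  shows "expo (ext \<sigma> \<pi>) \<pi> \<noteq> 0"
  using finite_subset[OF assms(1) finD] assms
proof (induction S arbitrary: \<pi> \<sigma> rule: finite_psubset_induct)
  case (psubset S)
  obtain \<pi>0 where top: "top_cell \<sigma> S \<pi>0" using ex_top_cell[OF psubset.prems(1) _ psubset.prems(4)] psubset.prems(3) by blast
  have e: "expo (ext \<sigma> \<pi>0) \<pi>0 \<noteq> 0"
  proof (rule top_expo_nonzero[OF psubset.prems(1,2,4) top])
    fix S' \<pi>' assume "S' \<subset> S" "H1_trivial R1 S'" "\<pi>' \<in> cells S' {r}"
    then show "expo (ext (- \<sigma>) \<pi>') \<pi>' \<noteq> 0"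
      using psubset.IH[of S' \<pi>' "- \<sigma>"] psubset.prems(1,4) by auto
  qed
  show ?case
  proof (cases "\<pi> = \<pi>0")
    case False
    let ?M = "ext \<sigma> \<pi>0"
    have sub: "cells S {r} \<subseteq> cells S R1" by (intro cells_mono) auto
    have \<pi>0S: "\<pi>0 \<in> cells S {r}" using top by (simp add: top_cell_def)
    have MS: "?M \<in> S" using \<pi>0S ext_path[of \<pi>0 \<sigma>] psubset.prems(1) by (auto simp: cells_def)
    have only: "?M \<notin> fst ` set \<pi>'" if "\<pi>' \<in> cells S R1" "\<pi>' \<noteq> \<pi>0" for \<pi>'
      by (rule top_cell_only[OF psubset.prems(1,4) top that])
    have "H1_trivial R1 (S - {?M})"
      by (rule H1_remove[OF psubset.prems(1,2) _ e only]) (use sub \<pi>0S in blast)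
    moreover have "?M \<notin> fst ` set \<pi>" using only[OF _ False] sub psubset.prems(3) by blast
    then have "\<pi> \<in> cells (S - {?M}) {r}"
      using psubset.prems(3) unfolding cells_def by blast
    ultimately show ?thesis
      using psubset.IH[of "S - {?M}" \<pi> \<sigma>] MS psubset.prems(1,4) by blast
  qed (use e in simp)
qed

text \<open>A functional killing all cells is a coboundary and kills every loop, so by duality a
  loop is a rational combination of cells. Independence modulo all primes makes it integral.\<close>

lemma closed_path_combination:
  assumes S: "S \<subseteq> D" "H1_trivial R1 S" and \<zeta>: "path i \<zeta> i" "fst ` set \<zeta> \<subseteq> S"
  shows "\<exists>g. \<forall>y\<in>S. expo y \<zeta> = (\<Sum>\<pi>\<in>cells S R1. g \<pi> * expo y \<pi>)"
proof -
  have finS: "finite S" using S(1) finD finite_subset by blast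
  have finC: "finite (cells S R1)" by (rule fin_cells[OF S(1) subset_refl])
  have "\<not> (\<exists>h. (\<forall>\<pi>\<in>cells S R1. (\<Sum>y\<in>S. h y * of_int (expo y \<pi>)) = 0) \<and> (\<Sum>y\<in>S. h y * of_int (expo y \<zeta>)) \<noteq> (0::rat))"
  proof
    assume "\<exists>h. (\<forall>\<pi>\<in>cells S R1. (\<Sum>y\<in>S. h y * of_int (expo y \<pi>)) = 0) \<and> (\<Sum>y\<in>S. h y * of_int (expo y \<zeta>)) \<noteq> (0::rat)"
    then obtain h :: "'e edge \<Rightarrow> rat" where h: "\<forall>\<pi>\<in>cells S R1. (\<Sum>y\<in>S. h y * of_int (expo y \<pi>)) = 0"
      "(\<Sum>y\<in>S. h y * of_int (expo y \<zeta>)) \<noteq> 0" by (elim exE conjE)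
    have "\<exists>f. \<forall>y\<in>S. h y = f (etgt y) - f (esrc y)"
    proof (rule H1_trivialD[OF S(2)])
      fix \<pi> assume \<pi>: "\<pi> \<in> cells S R1"
      then have "fst ` set \<pi> \<subseteq> S" by (simp add: cells_def)
      then show "word_sum h \<pi> = 0" using h(1)[rule_format, OF \<pi>] word_sum_expo[OF finS, of \<pi> h] by simp
    qed
    then obtain f where f: "\<forall>y\<in>S. h y = f (etgt y) - f (esrc y)" by (elim exE)
    have "word_sum h \<zeta> = f i - f i" by (rule word_sum_coboundary[OF \<zeta>(1)]) (use f \<zeta>(2) in blast)
    then show False using h(2) word_sum_expo[OF finS \<zeta>(2), of h] by simp
  qed
  then have "\<exists>q. \<forall>y\<in>S. (of_int (expo y \<zeta>) :: rat) = (\<Sum>\<pi>\<in>cells S R1. q \<pi> * of_int (expo y \<pi>))"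
    using combination_or_functional[OF finC finS, of "\<lambda>y. of_int (expo y \<zeta>)" "\<lambda>\<pi> y. of_int (expo y \<pi>)"] by (elim disjE) simp_all
  then obtain q :: "'e edge word \<Rightarrow> rat" where q: "\<forall>y\<in>S. of_int (expo y \<zeta>) = (\<Sum>\<pi>\<in>cells S R1. q \<pi> * of_int (expo y \<pi>))"
    by (elim exE)
  obtain d f where d: "d > 0" "\<forall>\<pi>\<in>cells S R1. of_int d * q \<pi> = (of_int (f \<pi>) :: rat)"
    using common_denominator[OF finC, of q] by (elim exE conjE)
  have ind: "indep p (cells S R1) S (\<lambda>\<pi> y. expo y \<pi>)" if "prime p" for p
  proof -
    have i: "indep p (cells S R1) D (\<lambda>\<pi> y. expo y \<pi>)"
      by (rule indep_subset[OF indep_prime[OF that] cells_mono[OF S(1) subset_refl] fin_cells[OF subset_refl subset_refl]])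
    show ?thesis
      unfolding indep_def
    proof (intro allI impI ballI)
      fix k \<pi> assume k: "\<forall>y\<in>S. p dvd (\<Sum>\<pi>\<in>cells S R1. k \<pi> * expo y \<pi>)" and \<pi>: "\<pi> \<in> cells S R1"
      show "p dvd k \<pi>"
      proof (rule indepD[OF i _ \<pi>])
        fix y
        show "p dvd (\<Sum>\<pi>\<in>cells S R1. k \<pi> * expo y \<pi>)"
        proof (cases "y \<in> S")
          case False
          have "k \<pi> * expo y \<pi> = 0" if "\<pi> \<in> cells S R1" for \<pi>
          proof -
            have "y \<notin> fst ` set \<pi>" using that False by (auto simp: cells_def)
            then show ?thesis by (simp add: expo_eq_0)
          qed
          then show ?thesis by (simp add: sum.neutral)
        qed (use k in blast)
      qed
    qed
  qed
  show ?thesis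
  proof (rule integral_combination[OF ind d(1)])
    fix y assume y: "y \<in> S"
    have "(of_int (d * expo y \<zeta>) :: rat) = (\<Sum>\<pi>\<in>cells S R1. of_int d * q \<pi> * of_int (expo y \<pi>))"
      using q[rule_format, OF y] by (simp add: sum_distrib_left mult.assoc)
    also have "\<dots> = (\<Sum>\<pi>\<in>cells S R1. of_int (f \<pi>) * of_int (expo y \<pi>))"
      by (intro sum.cong refl) (simp only: d(2)[rule_format])
    also have "\<dots> = of_int (\<Sum>\<pi>\<in>cells S R1. f \<pi> * expo y \<pi>)" by simp
    finally show "d * expo y \<zeta> = (\<Sum>\<pi>\<in>cells S R1. f \<pi> * expo y \<pi>)" by (simp only: of_int_eq_iff)
  qed
qed

lemma rotate_to:
  assumes "path i \<beta> i" "M \<in> fst ` set \<beta>"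
  shows "\<exists>\<beta>'. path (esrc M) \<beta>' (esrc M) \<and> fst ` set \<beta>' = fst ` set \<beta> \<and> expo M \<beta>' = expo M \<beta> \<and>
    (null_word R1 (lab \<beta>') \<longleftrightarrow> null_word R1 (lab \<beta>))"
proof -
  have rot: "null_word R1 (u @ v) \<longleftrightarrow> null_word R1 (v @ u)" for u v using null_word_rotate by blast
  obtain s where "(M, s) \<in> set \<beta>" using assms(2) by auto
  then obtain \<beta>1 \<beta>2 where \<beta>: "\<beta> = \<beta>1 @ (M, s) # \<beta>2" by (meson split_list)
  show ?thesis
  proof (cases s)
    case True
    let ?b = "((M, s) # \<beta>2) @ \<beta>1"
    have "path (esrc M) ?b (esrc M)" using assms(1) unfolding \<beta> by (auto simp: path_append True)
    moreover have "null_word R1 (lab ?b) \<longleftrightarrow> null_word R1 (lab \<beta>)"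
      unfolding \<beta> lab_simps(2)[of \<beta>1] lab_simps(2)[of _ \<beta>1] by (rule rot)
    moreover have "fst ` set ?b = fst ` set \<beta>" unfolding \<beta> by auto
    moreover have "expo M ?b = expo M \<beta>" unfolding \<beta> by simp
    ultimately show ?thesis by (intro exI conjI)
  next
    case False
    let ?b = "\<beta>2 @ (\<beta>1 @ [(M, s)])"
    have "path (esrc M) ?b (esrc M)" using assms(1) unfolding \<beta> by (auto simp: path_append False)
    moreover have "null_word R1 (lab ?b) \<longleftrightarrow> null_word R1 (lab \<beta>)"
      using rot[of "lab \<beta>2" "lab (\<beta>1 @ [(M, s)])"] unfolding \<beta> by simp
    moreover have "fst ` set ?b = fst ` set \<beta>" unfolding \<beta> by auto
    moreover have "expo M ?b = expo M \<beta>" unfolding \<beta> by simp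
    ultimately show ?thesis by (intro exI conjI)
  qed
qed

text \<open>Cells over \<open>r\<close> are collapsed one by one from the top; when none is left,
  loops are cut into \<open>x\<close>-free ones.\<close>

lemma acyclic_loops_null:
  assumes "S \<subseteq> D" "H1_trivial R1 S" "path i \<beta> i" "fst ` set \<beta> \<subseteq> S"
  shows "null_word R1 (lab \<beta>)"
  using finite_subset[OF assms(1) finD] assms
proof (induction S arbitrary: i \<beta> rule: finite_psubset_induct)
  case (psubset S)
  note S = psubset.prems(1,2)
  have sub: "cells S {r} \<subseteq> cells S R1" by (intro cells_mono) auto
  show ?case
  proof (cases "cells S {r} = {}")
    case True
    show ?thesis
    proof (rule closed_paths_null[OF _ psubset.prems(3,4)])
      fix i \<beta> assume \<beta>: "path i \<beta> i" "fst ` set \<beta> \<subseteq> S"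
      show "null_word R1 (lab \<beta>) \<or> (\<exists>z\<in>fst ` set \<beta>. expo z \<beta> = 0)"
      proof (cases "\<exists>z\<in>fst ` set \<beta>. elab z = x")
        case False
        have "null_word R (lab \<beta>)"
          by (rule xfree_loops_null[OF \<beta>(1)]) (use \<beta>(2) S(1) False in blast)+
        then show ?thesis using null_word_mono[of R "lab \<beta>" R1] by blast
      next
        case z: True
        then obtain z where z: "z \<in> fst ` set \<beta>" "elab z = x" by blast
        have "expo z \<beta> = 0"
          by (rule expo_zero_off_ext[where \<tau> = 1, OF S _ _ \<beta> _ z(2)]) (use True in simp_all)
        then show ?thesis using z(1) by blast
      qed
    qed
  next
    case False
    then obtain \<pi> where top: "top_cell 1 S \<pi>" using ex_top_cell[OF S(1), of 1] by blast
    define M where "M = ext 1 \<pi>"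
    have \<pi>S: "\<pi> \<in> cells S {r}" using top by (simp add: top_cell_def)
    have \<pi>D: "\<pi> \<in> cells D {r}" using \<pi>S cells_mono[OF S(1) subset_refl] by blast
    have M\<pi>: "M \<in> fst ` set \<pi>" using ext_path[OF \<pi>D, of 1] by (simp add: M_def)
    have MS: "M \<in> S" using M\<pi> \<pi>S by (auto simp: cells_def)
    have e: "expo M \<pi> \<noteq> 0" unfolding M_def by (rule ext_expo_nonzero[OF S \<pi>S]) simp
    have only: "M \<notin> fst ` set \<pi>'" if "\<pi>' \<in> cells S R1" "\<pi>' \<noteq> \<pi>" for \<pi>'
      unfolding M_def by (rule top_cell_only[OF S(1) _ top that]) simp
    have H1': "H1_trivial R1 (S - {M})"
      by (rule H1_remove[OF S _ e only]) (use sub \<pi>S in blast)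
    have IH: "null_word R1 (lab \<beta>)" if "path i \<beta> i" "fst ` set \<beta> \<subseteq> S" "M \<notin> fst ` set \<beta>" for i \<beta>
      by (rule psubset.IH[OF _ _ H1' that(1)]) (use MS S(1) that in auto)
    \<comment> \<open>Such a loop is cut at opposite passages of \<open>M\<close> into loops that
      avoid \<open>M\<close>.\<close>
    have zero: "null_word R1 (lab \<beta>)" if "path i \<beta> i" "fst ` set \<beta> \<subseteq> S" "expo M \<beta> = 0" for i \<beta>
      using that
    proof (induction "length \<beta>" arbitrary: i \<beta> rule: less_induct)
      case less
      show ?case
      proof (cases "M \<in> fst ` set \<beta>")
        case True
        then obtain \<beta>1 t \<beta>2 \<beta>3 where s: "\<beta> = \<beta>1 @ (M, t) # \<beta>2 @ (M, \<not> t) # \<beta>3" "M \<notin> fst ` set \<beta>2"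
          using less.prems(3) by (rule expo_split)
        have "null_word R1 (lab \<beta>2)"
          by (rule IH[OF path_split_opposite(1)[OF less.prems(1)[unfolded s]] _ s(2)]) (use s less.prems(2) in auto)
        moreover have "expo M \<beta>2 = 0" using s(2) by (rule expo_eq_0)
        then have "null_word R1 (lab (\<beta>1 @ \<beta>3))"
          by (intro less.hyps[OF _ path_split_opposite(2)[OF less.prems(1)[unfolded s(1)]]])
            (use s(1) less.prems(2,3) in \<open>auto split: if_splits\<close>)
        then have "null_word R1 (lab \<beta>1 @ [(elab M, t), inv_letter (elab M, t)] @ lab \<beta>3)"
          by (intro null_cancel) simp
        ultimately have "null_word R1 ((lab \<beta>1 @ [(elab M, t)]) @ lab \<beta>2 @ ((elab M, \<not> t) # lab \<beta>3))"
          by (intro null_word_insert) (simp_all add: inv_letter_def)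
        then show ?thesis by (simp add: s)
      qed (rule IH[OF less.prems(1,2)])
    qed
    have unit: "\<bar>expo M \<pi>\<bar> = 1"
    proof -
      define V where "V = {v. \<exists>\<kappa>. path (etgt M) \<kappa> v \<and> fst ` set \<kappa> \<subseteq> S - {M}}"
      have tV: "etgt M \<in> V" unfolding V_def by (intro CollectI exI[of _ "[]"]) simp
      have V_step: "esrc y \<in> V \<longleftrightarrow> etgt y \<in> V" if y: "y \<in> S - {M}" for y
      proof
        assume "esrc y \<in> V"
        then obtain \<kappa> where "path (etgt M) \<kappa> (esrc y)" "fst ` set \<kappa> \<subseteq> S - {M}" unfolding V_def by blast
        then have "path (etgt M) (\<kappa> @ [(y, True)]) (etgt y)" "fst ` set (\<kappa> @ [(y, True)]) \<subseteq> S - {M}"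
          using y by (auto simp: path_append)
        then show "etgt y \<in> V" unfolding V_def by blast
      next
        assume "etgt y \<in> V"
        then obtain \<kappa> where "path (etgt M) \<kappa> (etgt y)" "fst ` set \<kappa> \<subseteq> S - {M}" unfolding V_def by blast
        then have "path (etgt M) (\<kappa> @ [(y, False)]) (esrc y)" "fst ` set (\<kappa> @ [(y, False)]) \<subseteq> S - {M}"
          using y by (auto simp: path_append)
        then show "esrc y \<in> V" unfolding V_def by blast
      qed
      \<comment> \<open>Otherwise the coboundary of the indicator of \<open>V\<close> would be the
        indicator of \<open>M\<close>, forcing \<open>expo M \<pi> = 0\<close>.\<close>
      have "esrc M \<in> V"
      proof (rule ccontr)
        assume n: "esrc M \<notin> V"
        let ?f = "\<lambda>v. of_bool (v \<in> V) :: int"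
        have "word_sum (\<lambda>y. ?f (etgt y) - ?f (esrc y)) \<pi> = ?f (pstart \<pi>) - ?f (pstart \<pi>)"
          by (rule word_sum_coboundary[OF cells_path[OF \<pi>S]]) simp
        moreover have "word_sum (\<lambda>y. ?f (etgt y) - ?f (esrc y)) \<pi> = word_sum (\<lambda>y. if y = M then 1 else 0) \<pi>"
        proof (rule word_sum_cong)
          fix y assume "y \<in> fst ` set \<pi>"
          then have "y \<in> S" using \<pi>S by (auto simp: cells_def)
          then show "?f (etgt y) - ?f (esrc y) = (if y = M then 1 else 0)"
            using V_step[of y] n tV by (cases "y = M") simp_all
        qed
        ultimately show False using e by (simp add: word_sum_single)
      qed
      then obtain \<kappa> where \<kappa>: "path (etgt M) \<kappa> (esrc M)" "fst ` set \<kappa> \<subseteq> S - {M}" unfolding V_def by blast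
      have "M \<notin> fst ` set \<kappa>" using \<kappa>(2) by blast
      then have \<zeta>: "path (esrc M) ((M, True) # \<kappa>) (esrc M)" "fst ` set ((M, True) # \<kappa>) \<subseteq> S" "expo M ((M, True) # \<kappa>) = 1"
        using \<kappa> MS by (auto simp: expo_eq_0)
      obtain g where g: "\<forall>y\<in>S. expo y ((M, True) # \<kappa>) = (\<Sum>\<pi>\<in>cells S R1. g \<pi> * expo y \<pi>)"
        using closed_path_combination[OF S \<zeta>(1,2)] by (elim exE)
      \<comment> \<open>Only \<open>\<pi>\<close> contributes at \<open>M\<close>, so the loop
        crossing \<open>M\<close> once shows that \<open>expo M \<pi>\<close> divides
        \<open>1\<close>.\<close>
      have "1 = (\<Sum>\<pi>\<in>cells S R1. g \<pi> * expo M \<pi>)" using g[rule_format, OF MS] \<zeta>(3) by simp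
      also have "\<dots> = (\<Sum>\<pi>'\<in>cells S R1. if \<pi>' = \<pi> then g \<pi> * expo M \<pi> else 0)"
        using only by (intro sum.cong refl) (simp add: expo_eq_0)
      also have "\<dots> = g \<pi> * expo M \<pi>" using fin_cells[OF S(1) subset_refl] sub \<pi>S by (subst sum.delta) auto
      finally have "expo M \<pi> dvd 1" by (metis dvd_triv_right)
      then show ?thesis by (simp add: zdvd1_eq)
    qed
    obtain \<omega> where \<omega>: "path (esrc M) \<omega> (esrc M)" "fst ` set \<omega> = fst ` set \<pi>" "expo M \<omega> = expo M \<pi>"
      "null_word R1 (lab \<omega>) \<longleftrightarrow> null_word R1 (lab \<pi>)"
      using rotate_to[OF cells_path[OF \<pi>S] M\<pi>] by (elim exE conjE)
    have "null_word R1 (lab \<pi>)" using \<pi>S by (intro null_word_relator) (simp add: cells_def)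
    then have \<omega>0: "null_word R1 (lab \<omega>)" using \<omega>(4) by simp
    have \<omega>S: "fst ` set \<omega> \<subseteq> S" using \<omega>(2) \<pi>S by (simp add: cells_def)
    have based: "null_word R1 (lab \<beta>)" if "path (esrc M) \<beta> (esrc M)" "fst ` set \<beta> \<subseteq> S" for \<beta>
      using that
    proof (induction "nat \<bar>expo M \<beta>\<bar>" arbitrary: \<beta>)
      case 0
      then show ?case by (intro zero) simp_all
    next
      case (Suc n)
      \<comment> \<open>The null loop \<open>\<omega>\<close> crosses \<open>M\<close> with exponent
        sum \<open>1\<close> or \<open>-1\<close>, so appending it or its inverse brings
        \<open>expo M \<beta>\<close> one step closer to \<open>0\<close>.\<close>
      define \<omega>' where "\<omega>' = (if (expo M \<beta> > 0) = (expo M \<omega> > 0) then winv \<omega> else \<omega>)"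
      have \<omega>': "path (esrc M) \<omega>' (esrc M)" "fst ` set \<omega>' \<subseteq> S" "null_word R1 (lab \<omega>')"
        using \<omega>(1) path_winv[OF \<omega>(1)] \<omega>S \<omega>0 null_word_winvI[OF \<omega>0] by (simp_all add: \<omega>'_def)
      have "expo M \<beta> \<noteq> 0" using Suc.hyps(2) by auto
      then have "n = nat \<bar>expo M (\<beta> @ \<omega>')\<bar>"
        using Suc.hyps(2) unit \<omega>(3) by (auto simp: \<omega>'_def abs_if split: if_splits)
      moreover have "path (esrc M) (\<beta> @ \<omega>') (esrc M)" using Suc.prems(1) \<omega>'(1) by (auto simp: path_append)
      moreover have "fst ` set (\<beta> @ \<omega>') \<subseteq> S" using Suc.prems(2) \<omega>'(2) by (simp add: image_Un)
      ultimately have "null_word R1 (lab (\<beta> @ \<omega>'))" by (rule Suc.hyps(1))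
      then show ?case using null_word_delete[OF \<omega>'(3), of "lab \<beta>" "[]"] by simp
    qed
    show ?thesis
    proof (cases "M \<in> fst ` set \<beta>")
      case True
      obtain \<beta>' where "path (esrc M) \<beta>' (esrc M)" "fst ` set \<beta>' = fst ` set \<beta>" "expo M \<beta>' = expo M \<beta>"
        "null_word R1 (lab \<beta>') \<longleftrightarrow> null_word R1 (lab \<beta>)"
        using rotate_to[OF psubset.prems(3) True] by (elim exE conjE)
      then show ?thesis using based[of \<beta>'] psubset.prems(4) by simp
    qed (rule IH[OF psubset.prems(3,4)])
  qed
qed

end

section \<open>Adding a relator\<close>

lemma loc_indicable_cong:
  assumes "\<And>w. null_word R w \<longleftrightarrow> null_word R' w"
  shows "loc_indicable R \<longleftrightarrow> loc_indicable R'"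
  unfolding loc_indicable_def assms ..

lemma loc_indicable_insert_reduced:
  fixes R :: "'e word set"
  assumes "finite R" "\<And>s. s \<in> R \<Longrightarrow> x \<notin> fst ` set s"
    and "\<And>p. prime p \<Longrightarrow> indep p (insert r R) UNIV (\<lambda>r e. expo e r)"
    and "expo x r \<noteq> 0" "loc_indicable R"
    and "\<And>u a v s. r @ r = u @ (x, s) # a @ (x, \<not> s) # v \<Longrightarrow> x \<notin> fst ` set a \<Longrightarrow> \<not> null_word R a"
  shows "loc_indicable (insert r R)"
proof (rule loc_indicableI)
  fix D i and \<pi> :: "'e edge word"
  assume D: "finite D" "monotone_edges D" "label_indep (insert r R) D" "H1_trivial (insert r R) D"
    and \<pi>: "path i \<pi> i" "fst ` set \<pi> \<subseteq> D"
  interpret added_relator R r x D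
    by (rule added_relator.intro, fact assms(1), fact D(1), fact D(2), fact assms(2), fact assms(3),
        fact assms(4), fact D(3), fact D(4), fact assms(5), fact assms(6))
  show "null_word (insert r R) (lab \<pi>)"
    by (rule acyclic_loops_null[OF subset_refl D(4) \<pi>])
qed (use assms(1) in simp)

text \<open>The subword cannot be longer than a full turn: its first letter would recur in it,
  although \<open>a\<close> is free of \<open>x\<close> and the last letter has the other
  sign.\<close>

lemma cyclic_subword:
  assumes "r @ r = u @ (x, s) # a @ (x, \<not> s) # v" "x \<notin> fst ` set a"
  shows "\<exists>p q b. r = p @ q \<and> q @ p = (x, s) # a @ (x, \<not> s) # b"
proof -
  let ?A = "(x, s) # a @ [(x, \<not> s)]"
  have rr: "r @ r = u @ (?A @ v)" using assms(1) by simp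
  have inside: ?thesis if "r = us @ ?A @ v" for us
    using that by (intro exI[of _ us] exI[of _ "?A @ v"] exI[of _ "v @ us"]) simp
  from rr obtain us where "r = u @ us \<and> us @ r = ?A @ v \<or> r @ us = u \<and> r = us @ ?A @ v"
    unfolding append_eq_append_conv2 by (elim exE)
  then show ?thesis
  proof
    assume c: "r = u @ us \<and> us @ r = ?A @ v"
    show ?thesis
    proof (cases us)
      case Nil
      then have "r = [] @ ?A @ v" using conjunct2[OF c] by simp
      then show ?thesis by (rule inside)
    next
      case (Cons l us')
      have "us @ (u @ us) = ?A @ v" using c by (elim conjE) (simp only:)
      then have "?A @ v = (us @ u) @ us" by simp
      then obtain ws where ws: "?A = (us @ u) @ ws \<and> ws @ v = us \<or> ?A @ ws = us @ u \<and> v = ws @ us"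
        unfolding append_eq_append_conv2 by (elim exE)
      have "\<exists>b. us @ u = ?A @ b"
        using ws
      proof
        assume A: "?A = (us @ u) @ ws \<and> ws @ v = us"
        show ?thesis
        proof (cases ws)
          case Nil
          then show ?thesis using A by (intro exI[of _ "[]"]) simp
        next
          case W: (Cons l' ws')
          have ll: "l' = l" "l = (x, s)" using A W Cons by auto
          have eq: "a @ [(x, \<not> s)] = (us' @ u) @ (x, s) # ws'" using A W Cons ll by simp
          have False
          proof (cases ws' rule: rev_cases)
            case Nil
            then show ?thesis using eq by simp
          next
            case (snoc zs z)
            then have "a = (us' @ u) @ (x, s) # zs" using eq by simp
            then show ?thesis using assms(2) by simp
          qed
          then show ?thesis ..
        qed
      next
        assume "?A @ ws = us @ u \<and> v = ws @ us"
        then show ?thesis by (intro exI[of _ ws]) simp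
      qed
      then obtain b where "us @ u = ?A @ b" by (elim exE)
      then show ?thesis using conjunct1[OF c] by (intro exI[of _ u] exI[of _ us] exI[of _ b]) simp
    qed
  next
    assume "r @ us = u \<and> r = us @ ?A @ v"
    then have "r = us @ ?A @ v" by simp
    then show ?thesis by (rule inside)
  qed
qed

text \<open>Cancelling a subword \<open>x a x\<inverse>\<close> with \<open>a\<close> trivial modulo \<open>R\<close> changes neither the group nor the
  homology, so the relator may be assumed reduced over the group of \<open>R\<close>.\<close>

lemma loc_indicable_insert:
  fixes R :: "'e word set"
  assumes R: "finite R" "\<And>s. s \<in> R \<Longrightarrow> x \<notin> fst ` set s"
    and ind: "\<And>p. prime p \<Longrightarrow> indep p (insert r R) UNIV (\<lambda>r e. expo e r)"
    and xr: "expo x r \<noteq> 0" and li: "loc_indicable R"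
  shows "loc_indicable (insert r R)"
proof -
  define Q where "Q r' \<longleftrightarrow> expo x r' \<noteq> 0 \<and> (\<forall>p. prime p \<longrightarrow> indep p (insert r' R) UNIV (\<lambda>r e. expo e r)) \<and>
     (\<forall>w. null_word (insert r' R) w \<longleftrightarrow> null_word (insert r R) w)" for r'
  \<comment> \<open>Each cancellation removes two letters over \<open>x\<close>, so a relator with
    the fewest of them is reduced.\<close>
  define cnt where "cnt w = length (filter (\<lambda>l. fst l = x) w)" for w :: "'e word"
  have "Q r" using ind xr by (simp add: Q_def)
  then have "\<exists>r'. Q r' \<and> (\<forall>r''. Q r'' \<longrightarrow> cnt r' \<le> cnt r'')" by (rule ex_has_least_nat)
  then obtain r' where r': "Q r'" and min: "\<And>r''. Q r'' \<Longrightarrow> cnt r' \<le> cnt r''" by (elim exE conjE) (erule that, simp)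
  have "loc_indicable (insert r' R)"
  proof (rule loc_indicable_insert_reduced[OF R _ _ li])
    show "expo x r' \<noteq> 0" using r' by (simp add: Q_def)
    show "indep p (insert r' R) UNIV (\<lambda>r e. expo e r)" if "prime p" for p using r' that by (simp add: Q_def)
    fix u a v s
    assume "r' @ r' = u @ (x, s) # a @ (x, \<not> s) # v" and a: "x \<notin> fst ` set a"
    then obtain p q b where pq: "r' = p @ q" "q @ p = (x, s) # a @ (x, \<not> s) # b"
      using cyclic_subword by (metis (no_types))
    show "\<not> null_word R a"
    proof
      assume null: "null_word R a"
      let ?A = "[(x, s)] @ a @ [(x, \<not> s)]"
      have qp: "q @ p = ?A @ b" using pq(2) by simp
      have A: "null_word R' ?A" if "R \<subseteq> R'" for R'
        by (rule null_word_insert[OF null_word_mono[OF null that]])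
          (use null_word_winv[of R' "[(x, s)]"] in \<open>simp add: inv_letter_def\<close>)
      have ex: "expo y r' = expo y b + expo y a" for y
      proof -
        have "expo y r' = expo y (q @ p)" by (simp add: pq(1))
        then show ?thesis unfolding qp by simp
      qed
      have exb: "expo x b \<noteq> 0" using r' ex[of x] a by (simp add: Q_def expo_eq_0)
      have notR: "b \<notin> R" "r' \<notin> R" using R(2) exb r' expo_eq_0 unfolding Q_def by metis+
      obtain \<mu> where \<mu>: "\<And>y. expo y a = (\<Sum>s\<in>R. \<mu> s * expo y s)" using null_word_expo[OF null R(1)] by blast
      have "indep p (insert b R) UNIV (\<lambda>r e. expo e r)" if p: "prime p" for p
        unfolding indep_def
      proof (intro allI impI)
        fix k assume k: "\<forall>y\<in>UNIV. p dvd (\<Sum>c\<in>insert b R. k c * expo y c)"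
        \<comment> \<open>In exponents \<open>b\<close> is \<open>r'\<close> minus \<open>a\<close>,
          and \<open>a\<close> is a combination of members of \<open>R\<close>; a dependence
          involving \<open>b\<close> is rewritten as one involving \<open>r'\<close>.\<close>
        define k' where "k' c = (if c = r' then k b else k c - k b * \<mu> c)" for c
        have eq: "(\<Sum>c\<in>insert r' R. k' c * expo y c) = (\<Sum>c\<in>insert b R. k c * expo y c)" for y
        proof -
          have "(\<Sum>c\<in>R. k' c * expo y c) = (\<Sum>c\<in>R. k c * expo y c - k b * (\<mu> c * expo y c))"
            using notR by (intro sum.cong) (auto simp: k'_def algebra_simps)
          also have "\<dots> = (\<Sum>c\<in>R. k c * expo y c) - k b * expo y a"
            by (simp add: sum_subtractf sum_distrib_left \<mu>)
          finally show ?thesis using R(1) notR by (simp add: k'_def ex algebra_simps)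
        qed
        have i: "indep p (insert r' R) UNIV (\<lambda>r e. expo e r)" using r' p by (simp add: Q_def)
        have d: "p dvd k' c" if "c \<in> insert r' R" for c
          by (rule indepD[OF i _ that]) (use k eq in simp)
        have kb: "p dvd k b" using d[of r'] by (simp add: k'_def)
        show "\<forall>c\<in>insert b R. p dvd k c"
        proof
          fix c assume c: "c \<in> insert b R"
          show "p dvd k c"
          proof (cases "c = b")
            case False
            then have "c \<in> R" "c \<noteq> r'" using c notR by auto
            then have "p dvd k c - k b * \<mu> c" using d[of c] by (simp add: k'_def)
            moreover have "p dvd k b * \<mu> c" using kb by simp
            ultimately have "p dvd (k c - k b * \<mu> c) + k b * \<mu> c" by (rule dvd_add)
            then show ?thesis by simp
          qed (use kb in simp)
        qed
      qed
      moreover have "null_word (insert b R) w \<longleftrightarrow> null_word (insert r' R) w" for w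
      proof
        have "null_word (insert b R) (?A @ b)"
          by (rule null_word_append[OF A]) (auto intro: null_word_relator)
        then have "null_word (insert b R) r'" unfolding pq(1) qp[symmetric] by (rule null_word_rotate)
        then show "null_word (insert r' R) w" if "null_word (insert b R) w"
          using that
        proof -
          have "null_word (insert r' R) (q @ p)"
            by (rule null_word_rotate) (use pq(1) in \<open>auto intro: null_word_relator\<close>)
          then have "null_word (insert r' R) ([] @ ?A @ b)" unfolding qp by simp
          then have "null_word (insert r' R) b"
            using null_word_delete[OF A, of "insert r' R" "[]" b] by auto
          then show ?thesis
            by (intro null_word_trans[OF that]) (auto intro: null_word_relator)
        qed
        show "null_word (insert b R) w" if "null_word (insert r' R) w"
          by (rule null_word_trans[OF that])
            (use \<open>null_word (insert b R) r'\<close> in \<open>auto intro: null_word_relator\<close>)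
      qed
      ultimately have "Q b" using exb r' by (simp add: Q_def)
      then have "cnt r' \<le> cnt b" by (rule min)
      moreover have "cnt r' = cnt (q @ p)" by (simp add: cnt_def pq(1))
      ultimately show False unfolding qp by (simp add: cnt_def)
    qed
  qed
  then show ?thesis using loc_indicable_cong[of "insert r' R" "insert r R"] r' by (simp add: Q_def)
qed

section \<open>Lifting words along a weight\<close>

text \<open>For nonnegative weights the tag is the level of the lower end, for a generator and for
  its inverse alike. Started at level \<open>0\<close> it is the I-value, so the letters on the
  lowest level form the multiset of minima.\<close>

fun lift :: "('a \<Rightarrow> int) \<Rightarrow> int \<Rightarrow> 'a word \<Rightarrow> ('a \<times> int) word" where
  "lift wt i [] = []"
| "lift wt i ((y, True) # w) = ((y, i), True) # lift wt (i + wt y) w"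
| "lift wt i ((y, False) # w) = ((y, i - wt y), False) # lift wt (i - wt y) w"

lemma lift_append: "lift wt i (u @ v) = lift wt i u @ lift wt (i + word_sum wt u) v"
  by (induction wt i u rule: lift.induct) (auto simp: algebra_simps)

lemma lift_winv: "lift wt (i + word_sum wt u) (winv u) = winv (lift wt i u)"
proof (induction wt i u rule: lift.induct)
  case (2 wt i y w)
  then show ?case by (simp add: lift_append inv_letter_def add.assoc[symmetric])
next
  case (3 wt i y w)
  have "i + word_sum wt ((y, False) # w) = i - wt y + word_sum wt w" by simp
  then show ?case using 3 by (simp only:) (simp add: lift_append inv_letter_def)
qed simp

lemma expo_lift: "expo (y, s) (lift wt i w) = expo_at wt y (s - i) w"
  by (induction wt i w rule: lift.induct) (auto simp: algebra_simps)

lemma lift_project: "map (\<lambda>((y, i), s). (y, s)) (lift wt i w) = w"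
  by (induction wt i w rule: lift.induct) auto

lemma lift_inj:
  assumes "lift wt i u = lift wt j v" "u \<noteq> []"
  shows "u = v" "i = j"
proof -
  show "u = v" using assms(1) lift_project by metis
  then show "i = j" using assms by (cases u; cases "snd (hd u)") auto
qed

text \<open>Relators have weight \<open>0\<close>, so inserting one does not shift the levels of
  what follows.\<close>

lemma null_word_lift:
  assumes "null_word R w" "\<And>r. r \<in> R \<Longrightarrow> word_sum wt r = 0"
  shows "null_word {lift wt i r | i r. r \<in> R} (lift wt i w)"
proof -
  let ?R = "{lift wt i r | i r. r \<in> R}" and ?h = "\<lambda>u. i + word_sum wt u"
  have cancel: "\<exists>l'. lift wt i (u @ [l, inv_letter l] @ v) = lift wt i u @ [l', inv_letter l'] @ lift wt (?h u) v" for u l v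
  proof -
    obtain y s where l: "l = (y, s)" by (cases l)
    show ?thesis
    proof (cases s)
      case True
      show ?thesis by (rule exI[of _ "((y, ?h u), True)"]) (simp add: lift_append l True inv_letter_def)
    next
      case False
      show ?thesis by (rule exI[of _ "((y, ?h u - wt y), False)"]) (simp add: lift_append l False inv_letter_def)
    qed
  qed
  have relator: "lift wt i (u @ r @ v) = lift wt i u @ lift wt (?h u) r @ lift wt (?h u) v" "lift wt (?h u) r \<in> ?R"
    if "r \<in> R" for u r v
    using assms(2)[OF that] that by (auto simp: lift_append)
  show ?thesis
    using assms(1)
  proof induction
    case null_Nil
    show ?case by (simp add: null_word.null_Nil)
  next
    case (null_cancel u v l)
    obtain l' where l': "lift wt i (u @ [l, inv_letter l] @ v) = lift wt i u @ [l', inv_letter l'] @ lift wt (?h u) v"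
      using cancel[of u l v] by (elim exE)
    have "null_word ?R (lift wt i u @ lift wt (?h u) v)" using null_cancel.IH by (simp only: lift_append)
    then show ?case unfolding l' by (rule null_word.null_cancel)
  next
    case (null_uncancel u l v)
    obtain l' where l': "lift wt i (u @ [l, inv_letter l] @ v) = lift wt i u @ [l', inv_letter l'] @ lift wt (?h u) v"
      using cancel[of u l v] by (elim exE)
    show ?case unfolding lift_append using null_uncancel.IH unfolding l' by (rule null_word.null_uncancel)
  next
    case (null_insert u v r)
    have "null_word ?R (lift wt i u @ lift wt (?h u) v)" using null_insert.IH by (simp only: lift_append)
    then show ?case unfolding relator(1)[OF null_insert.hyps(2)]
      by (rule null_word.null_insert[OF _ relator(2)[OF null_insert.hyps(2)]])
  next
    case (null_delete u r v)
    show ?case unfolding lift_append[of wt i u v] using null_delete.IH unfolding relator(1)[OF null_delete.hyps(2)]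
      by (rule null_word.null_delete[OF _ relator(2)[OF null_delete.hyps(2)]])
  qed
qed

text \<open>As in \<open>indep_D'\<close>, a relation between lifts is arranged by relator and level
  and handed to \<open>indep_cover\<close>. The empty word is excluded because its lifts to
  different levels coincide.\<close>

lemma indep_lift:
  assumes ind: "indep p C UNIV (\<lambda>c y. expo y c)" and C: "finite C" "[] \<notin> C"
    and Q: "finite Q" "\<And>q. q \<in> Q \<Longrightarrow> \<exists>c\<in>C. \<exists>t. q = lift wt t c"
  shows "indep p Q UNIV (\<lambda>q y. expo y q)"
  unfolding indep_def
proof (intro allI impI ballI)
  fix k q0 assume k: "\<forall>y\<in>UNIV. p dvd (\<Sum>q\<in>Q. k q * expo y q)" and q0: "q0 \<in> Q"
  obtain c0 t0 where c0: "c0 \<in> C" "q0 = lift wt t0 c0" using Q(2)[OF q0] by blast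
  define K where "K c t = (if lift wt t c \<in> Q then k (lift wt t c) else 0)" for c t
  define hgt where "hgt q = (SOME t. \<exists>c\<in>C. q = lift wt t c)" for q
  have hgt: "hgt (lift wt t c) = t" if "c \<in> C" for c t
    unfolding hgt_def
  proof (rule some_equality)
    fix t' assume "\<exists>c'\<in>C. lift wt t c = lift wt t' c'"
    then obtain c' where "lift wt t c = lift wt t' c'" by blast
    then show "t' = t" using lift_inj(2)[of wt t c t' c'] that C(2) by metis
  qed (use that in blast)
  define T where "T = hgt ` Q"
  have finT: "finite T" using Q(1) by (simp add: T_def)
  have KT: "K c t = 0" if "c \<in> C" "t \<notin> T" for c t
    using that hgt[OF that(1), of t] unfolding K_def T_def by force
  define bd where "bd c = (SOME b. b \<ge> 0 \<and> (\<forall>y d. expo_at wt y d c \<noteq> 0 \<longrightarrow> \<bar>d\<bar> \<le> b))" for c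
  have bd: "expo_at wt y d c \<noteq> 0 \<Longrightarrow> \<bar>d\<bar> \<le> bd c" for y d c
    using someI_ex[OF expo_at_bound[of wt c]] unfolding bd_def by blast
  define D where "D = (\<Union>c\<in>C. {- bd c..bd c})"
  have finD: "finite D" using C by (simp add: D_def)
  have D: "d \<in> D" if "c \<in> C" "expo_at wt y d c \<noteq> 0" for c y d
    using bd[OF that(2)] that(1) by (force simp: D_def)
  have sumQ: "(\<Sum>c\<in>C. \<Sum>d\<in>D. expo_at wt y d c * K c (s - d)) = (\<Sum>q\<in>Q. k q * expo (y, s) q)" for y s
  proof -
    have "(\<Sum>d\<in>D. expo_at wt y d c * K c (s - d)) = (\<Sum>t\<in>T. K c t * expo (y, s) (lift wt t c))" if c: "c \<in> C" for c
    proof -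
      have "(\<Sum>d\<in>D. expo_at wt y d c * K c (s - d)) = (\<Sum>d\<in>(\<lambda>t. s - t) ` T. expo_at wt y d c * K c (s - d))"
      proof (rule sum.mono_neutral_cong)
        show "expo_at wt y d c * K c (s - d) = 0" if "d \<in> (\<lambda>t. s - t) ` T - D" for d
          using D[OF c] that by force
        show "expo_at wt y d c * K c (s - d) = 0" if "d \<in> D - (\<lambda>t. s - t) ` T" for d
        proof -
          have "s - d \<notin> T" using that by (auto simp: image_iff)
          then show ?thesis using KT[OF c] by simp
        qed
      qed (use finD finT in auto)
      also have "\<dots> = (\<Sum>t\<in>T. expo_at wt y (s - t) c * K c t)"
        by (subst sum.reindex) (auto simp: inj_on_def)
      finally show ?thesis by (simp add: expo_lift mult.commute)
    qed
    then have "(\<Sum>c\<in>C. \<Sum>d\<in>D. expo_at wt y d c * K c (s - d)) = (\<Sum>c\<in>C. \<Sum>t\<in>T. K c t * expo (y, s) (lift wt t c))"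
      by (rule sum.cong[OF refl])
    also have "\<dots> = (\<Sum>(c, t)\<in>C \<times> T. K c t * expo (y, s) (lift wt t c))" by (rule sum.cartesian_product)
    also have "\<dots> = (\<Sum>(c, t)\<in>{(c, t)\<in>C \<times> T. lift wt t c \<in> Q}. k (lift wt t c) * expo (y, s) (lift wt t c))"
      using C(1) finT by (intro sum.mono_neutral_cong_right) (auto simp: K_def split: if_splits)
    also have "\<dots> = (\<Sum>q\<in>Q. k q * expo (y, s) q)"
    proof (rule sum.reindex_bij_witness[of _ "\<lambda>q. (map (\<lambda>((y, i), s). (y, s)) q, hgt q)" "\<lambda>(c, t). lift wt t c"])
      fix q assume q: "q \<in> Q"
      then obtain c t where ct: "c \<in> C" "q = lift wt t c" using Q(2) by blast
      have m: "map (\<lambda>((y, i), s). (y, s)) q = c" unfolding ct(2) by (rule lift_project)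
      have h: "hgt q = t" unfolding ct(2) by (rule hgt[OF ct(1)])
      show "(case (map (\<lambda>((y, i), s). (y, s)) q, hgt q) of (c, t) \<Rightarrow> lift wt t c) = q" unfolding m h by (simp add: ct(2))
      show "(map (\<lambda>((y, i), s). (y, s)) q, hgt q) \<in> {(c, t) \<in> C \<times> T. lift wt t c \<in> Q}"
        unfolding m using q ct h by (force simp: T_def)
    qed (auto simp: lift_project hgt)
    finally show ?thesis .
  qed
  obtain B where B: "\<And>t. t \<in> T \<Longrightarrow> \<bar>t\<bar> \<le> int B"
  proof
    fix t assume "t \<in> T"
    then have "nat \<bar>t\<bar> \<le> Max (insert 0 ((\<lambda>t. nat \<bar>t\<bar>) ` T))" using finT by (intro Max_ge) auto
    then show "\<bar>t\<bar> \<le> int (Max (insert 0 ((\<lambda>t. nat \<bar>t\<bar>) ` T)))" by linarith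
  qed
  have "p dvd K c0 t0"
  proof (rule indep_cover[where k = K and c = c0 and t = t0 and n = "2 * B + 1" and a = "- int B" and h = wt, OF ind C(1) finD])
    show "d \<in> D" if "c \<in> C" "expo_at wt y d c \<noteq> 0" for c y d using that by (rule D)
    fix c t assume c: "c \<in> C" and t: "t \<notin> {- int B..<- int B + int (2 * B + 1)}"
    have "t \<notin> T" using B[of t] t by auto
    then show "p dvd K c t" using KT[OF c] by simp
  next
    fix y s show "p dvd (\<Sum>c\<in>C. \<Sum>d\<in>D. expo_at wt y d c * K c (s - d))"
      unfolding sumQ using k by blast
  qed (rule c0)
  then show "p dvd k q0" using q0 c0 by (simp add: K_def)
qed

lemma length_lift [simp]: "length (lift wt i w) = length w"
  by (induction wt i w rule: lift.induct) auto

lemma lift_shift: "((y, s), b) \<in> set (lift wt i w) \<longleftrightarrow> ((y, s - i), b) \<in> set (lift wt 0 w)"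
proof -
  have "lift wt (i + d) w = map (\<lambda>((y, s), b). ((y, s + d), b)) (lift wt i w)" for i d
    by (induction wt i w rule: lift.induct) (auto simp: algebra_simps)
  from this[of 0 i] show ?thesis by force
qed

text \<open>A lift with minimal level \<open>l\<close> has no letters below level \<open>l\<close>, so adding the relators level by
  level, from above, and within a level in the given order, each \<open>(x j, l)\<close> is new.\<close>

lemma loc_indicable_levels:
  fixes w :: "nat \<Rightarrow> 'a word" and lo :: "nat \<Rightarrow> int"
  assumes ind: "\<And>p. prime p \<Longrightarrow> indep p (w ` {1..k}) UNIV (\<lambda>c y. expo y c)" and ne: "[] \<notin> w ` {1..k}"
    and low: "\<And>j y s b. j \<in> {1..k} \<Longrightarrow> ((y, s), b) \<in> set (lift wt 0 (w j)) \<Longrightarrow> lo j \<le> s"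
    and ex: "\<And>j. j \<in> {1..k} \<Longrightarrow> expo (x j, lo j) (lift wt 0 (w j)) \<noteq> 0"
    and new: "\<And>i j. i \<in> {1..k} \<Longrightarrow> j \<in> {1..k} \<Longrightarrow> i < j \<Longrightarrow> (x j, lo i) \<notin> fst ` set (lift wt 0 (w i))"
    and Q: "finite Q" "Q \<subseteq> {lift wt i c | i c. c \<in> w ` {1..k}}"
  shows "\<exists>Q'. Q \<subseteq> Q' \<and> Q' \<subseteq> {lift wt i c | i c. c \<in> w ` {1..k}} \<and> loc_indicable Q'"
proof -
  \<comment> \<open>Indexing by minimal level: the lowest letters of \<open>\<rho> j l\<close> lie
    on level \<open>l\<close>.\<close>
  define \<rho> where "\<rho> j l = lift wt (l - lo j) (w j)" for j l
  have \<rho>low: "l \<le> s" if j: "j \<in> {1..k}" and ys: "(y, s) \<in> fst ` set (\<rho> j l)" for j l y s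
  proof -
    obtain b where "((y, s), b) \<in> set (\<rho> j l)" using ys by auto
    then have "((y, s - (l - lo j)), b) \<in> set (lift wt 0 (w j))" unfolding \<rho>_def by (rule iffD1[OF lift_shift])
    from low[OF j this] show ?thesis by simp
  qed
  have \<rho>new: "(x j, l) \<notin> fst ` set (\<rho> i l)" if "i \<in> {1..k}" "j \<in> {1..k}" "i < j" for i j l
  proof
    assume "(x j, l) \<in> fst ` set (\<rho> i l)"
    then obtain b where "((x j, l), b) \<in> set (\<rho> i l)" by auto
    then have "((x j, l - (l - lo i)), b) \<in> set (lift wt 0 (w i))" unfolding \<rho>_def by (rule iffD1[OF lift_shift])
    then show False using new[OF that] by force
  qed
  have \<rho>ex: "expo (x j, l) (\<rho> j l) \<noteq> 0" if "j \<in> {1..k}" for j l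
    using ex[OF that] by (simp add: \<rho>_def expo_lift)
  have "\<forall>q\<in>Q. \<exists>l. \<exists>j\<in>{1..k}. q = \<rho> j l"
  proof
    fix q assume "q \<in> Q"
    then obtain i j where "j \<in> {1..k}" "q = lift wt i (w j)" using Q(2) by blast
    then show "\<exists>l. \<exists>j\<in>{1..k}. q = \<rho> j l" by (intro exI[of _ "i + lo j"] bexI[of _ j]) (simp_all add: \<rho>_def)
  qed
  from bchoice[OF this] obtain lev where lev: "\<forall>q\<in>Q. \<exists>j\<in>{1..k}. q = \<rho> j (lev q)" by (elim exE)
  define N where "N = Max (insert 0 (lev ` Q))"
  define N0 where "N0 = Min (insert 0 (lev ` Q))"
  have NN: "N0 \<le> lev q \<and> lev q \<le> N" if "q \<in> Q" for q
    using that Q(1) by (simp add: N_def N0_def)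
  have N00: "N0 \<le> N" using Q(1) by (auto simp: N_def N0_def Min_le_iff)
  \<comment> \<open>Stages of the construction: \<open>j\<close> runs through the relators on level
    \<open>N - int m\<close>, and the full stage \<open>Rel m k\<close> is the start
    \<open>Rel (Suc m) 0\<close> of the next level.\<close>
  define Rel where "Rel m j = (\<lambda>z. \<rho> (fst z) (snd z)) ` ({1..k} \<times> {N - int m<..N}) \<union> (\<lambda>i. \<rho> i (N - int m)) ` {1..j}" for m j
  have RelI1: "\<rho> i l \<in> Rel m j" if "i \<in> {1..k}" "N - int m < l" "l \<le> N" for i l m j
    unfolding Rel_def by (intro UnI1 image_eqI[of _ _ "(i, l)"]) (use that in simp_all)
  have RelI2: "\<rho> i (N - int m) \<in> Rel m j" if "i \<in> {1..j}" for i m j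
    unfolding Rel_def by (intro UnI2 imageI that)
  have RelE: "(\<exists>i l. i \<in> {1..k} \<and> N - int m < l \<and> l \<le> N \<and> q = \<rho> i l) \<or> (\<exists>i. i \<in> {1..j} \<and> q = \<rho> i (N - int m))"
    if "q \<in> Rel m j" for q m j
    using that unfolding Rel_def
  proof
    assume "q \<in> (\<lambda>z. \<rho> (fst z) (snd z)) ` ({1..k} \<times> {N - int m<..N})"
    then obtain z where "q = \<rho> (fst z) (snd z)" "z \<in> {1..k} \<times> {N - int m<..N}" by (rule imageE)
    then show ?thesis by (intro disjI1 exI[of _ "fst z"] exI[of _ "snd z"]) auto
  next
    assume "q \<in> (\<lambda>i. \<rho> i (N - int m)) ` {1..j}"
    then obtain i where "q = \<rho> i (N - int m)" "i \<in> {1..j}" by (rule imageE)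
    then show ?thesis by (intro disjI2 exI[of _ i] conjI)
  qed
  have fin: "finite (Rel m j)" for m j
    by (simp add: Rel_def)
  have sub: "Rel m j \<subseteq> {lift wt i c | i c. c \<in> w ` {1..k}}" if "j \<le> k" for m j
  proof
    fix q assume "q \<in> Rel m j"
    from RelE[OF this] have "\<exists>i l. i \<in> {1..k} \<and> q = \<rho> i l"
    proof (elim disjE exE conjE)
      fix i l assume "i \<in> {1..k}" "q = \<rho> i l"
      then show ?thesis by (intro exI conjI)
    next
      fix i assume "i \<in> {1..j}" "q = \<rho> i (N - int m)"
      then show ?thesis using that by (intro exI[of _ i] exI[of _ "N - int m"]) simp
    qed
    then obtain i l where "i \<in> {1..k}" "q = \<rho> i l" by (elim exE conjE)
    then show "q \<in> {lift wt i c | i c. c \<in> w ` {1..k}}" unfolding \<rho>_def by blast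
  qed
  have step: "loc_indicable (Rel m (Suc j))" if li: "loc_indicable (Rel m j)" and j: "Suc j \<le> k" for m j
  proof -
    let ?r = "\<rho> (Suc j) (N - int m)" and ?x = "(x (Suc j), N - int m)"
    have eq: "Rel m (Suc j) = insert ?r (Rel m j)"
      by (simp add: Rel_def atLeastAtMostSuc_conv)
    have "?x \<notin> fst ` set q" if q: "q \<in> Rel m j" for q
    proof -
      consider i l where "i \<in> {1..k}" "N - int m < l" "q = \<rho> i l" | i where "i \<in> {1..j}" "q = \<rho> i (N - int m)"
        using RelE[OF q] by (elim disjE exE conjE)
      then show ?thesis
      proof cases
        case 1
        then show ?thesis using \<rho>low[of i "x (Suc j)" "N - int m" l] by auto
      next
        case 2
        then show ?thesis using \<rho>new[of i "Suc j" "N - int m"] j by auto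
      qed
    qed
    moreover have "indep p (insert ?r (Rel m j)) UNIV (\<lambda>r e. expo e r)" if "prime p" for p
      unfolding eq[symmetric]
    proof (rule indep_lift[OF ind[OF that] _ ne fin])
      fix q assume "q \<in> Rel m (Suc j)"
      then show "\<exists>c\<in>w ` {1..k}. \<exists>t. q = lift wt t c" using sub[OF j] by blast
    qed simp
    ultimately show ?thesis
      unfolding eq by (intro loc_indicable_insert[OF fin _ _ _ li, of ?x]) (use \<rho>ex j in auto)
  qed
  have row: "loc_indicable (Rel m j)" if "loc_indicable (Rel m 0)" "j \<le> k" for m j
    using that(2)
  proof (induction j)
    case (Suc j)
    then show ?case by (intro step) simp_all
  qed (rule that(1))
  have all: "loc_indicable (Rel m 0)" for m
  proof (induction m)
    case 0
    have "Rel 0 0 = {}" by (simp add: Rel_def)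
    then show ?case by (simp add: loc_indicable_free)
  next
    case (Suc m)
    have "Rel (Suc m) 0 = Rel m k"
    proof (intro equalityI subsetI)
      fix q assume "q \<in> Rel (Suc m) 0"
      from RelE[OF this] obtain i l where il: "i \<in> {1..k}" "N - int (Suc m) < l" "l \<le> N" "q = \<rho> i l"
        by (elim disjE exE conjE) simp_all
      then consider "l = N - int m" | "N - int m < l" by linarith
      then show "q \<in> Rel m k"
      proof cases
        case 1
        then show ?thesis using RelI2[OF il(1)] il(4) by simp
      next
        case 2
        then show ?thesis using RelI1[OF il(1) _ il(3)] il(4) by simp
      qed
    next
      fix q assume "q \<in> Rel m k"
      from RelE[OF this] show "q \<in> Rel (Suc m) 0"
      proof (elim disjE exE conjE)
        fix i l assume "i \<in> {1..k}" "N - int m < l" "l \<le> N" "q = \<rho> i l"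
        then show ?thesis using RelI1[of i "Suc m" l 0] by simp
      next
        fix i assume "i \<in> {1..k}" "q = \<rho> i (N - int m)"
        then show ?thesis using RelI1[of i "Suc m" "N - int m" 0] by simp
      qed
    qed
    then show ?case using row[OF Suc.IH, of k] by simp
  qed
  \<comment> \<open>The number of levels from \<open>N\<close> down to \<open>N0\<close>, both
    included.\<close>
  let ?m = "nat (N - N0 + 1)"
  have "Q \<subseteq> Rel ?m 0"
  proof
    fix q assume q: "q \<in> Q"
    then obtain j where j: "j \<in> {1..k}" "q = \<rho> j (lev q)" using lev by blast
    have "N - int ?m < lev q" "lev q \<le> N" using NN[OF q] N00 by auto
    then have "\<rho> j (lev q) \<in> Rel ?m 0" by (rule RelI1[OF j(1)])
    then show "q \<in> Rel ?m 0" by (simp only: j(2)[symmetric])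
  qed
  then show ?thesis using all[of ?m] sub[of 0 ?m] by (intro exI[of _ "Rel ?m 0"] conjI) simp_all
qed

section \<open>Minimal levels\<close>

lemma I_value_Cons: "u \<noteq> [] \<Longrightarrow> I_value (word_sum wt) (l # u) = word_sum wt [l] + I_value (word_sum wt) u"
  by (cases l) (auto simp: I_value_def)

lemma lift_nth:
  assumes "n < length w"
  shows "lift wt i w ! n = ((fst (w ! n), i + I_value (word_sum wt) (take (Suc n) w)), snd (w ! n))"
  using assms
proof (induction wt i w arbitrary: n rule: lift.induct)
  case (2 wt i y w)
  show ?case
  proof (cases n)
    case (Suc n')
    then have "take (Suc n') w \<noteq> []" using 2(2) by (cases w) auto
    then show ?thesis using 2 Suc I_value_Cons[of "take (Suc n') w" wt "(y, True)"] by simp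
  qed (simp add: I_value_def)
next
  case (3 wt i y w)
  show ?case
  proof (cases n)
    case (Suc n')
    then have "take (Suc n') w \<noteq> []" using 3(2) by (cases w) auto
    then show ?thesis using 3 Suc I_value_Cons[of "take (Suc n') w" wt "(y, False)"] by simp
  qed (simp add: I_value_def)
qed simp

lemma initial_subwords_take: "initial_subwords r = (\<lambda>n. take (Suc n) r) ` {..<length r}"
proof (intro equalityI subsetI)
  fix u assume "u \<in> initial_subwords r"
  then have u: "u \<noteq> []" "prefix u r" by (auto simp: initial_subwords_def)
  then have t: "u = take (length u) r" "length u \<le> length r" by (auto simp: prefix_def)
  have "Suc (length u - 1) = length u" using u(1) by (cases u) simp_all
  then have "u = take (Suc (length u - 1)) r" "length u - 1 < length r" using t by (simp, linarith)
  then show "u \<in> (\<lambda>n. take (Suc n) r) ` {..<length r}"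
    by (intro image_eqI[of _ _ "length u - 1"]) simp_all
next
  fix u assume "u \<in> (\<lambda>n. take (Suc n) r) ` {..<length r}"
  then show "u \<in> initial_subwords r" by (auto simp: initial_subwords_def take_is_prefix)
qed

lemma inj_take_Suc: "inj_on (\<lambda>n. take (Suc n) r) {..<length r}"
proof (rule inj_onI)
  fix m n assume "m \<in> {..<length r}" "n \<in> {..<length r}" "take (Suc m) r = take (Suc n) r"
  then have "length (take (Suc m) r) = length (take (Suc n) r)" "m < length r" "n < length r" by simp_all
  then show "m = n" by simp
qed

lemma finite_initial_subwords: "finite (initial_subwords r)"
  by (simp add: initial_subwords_take)

lemma expo_count: "expo y w = int (card {n. n < length w \<and> w ! n = (y, True)}) - int (card {n. n < length w \<and> w ! n = (y, False)})"
proof -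
  have "expo y w = int (length (filter (\<lambda>l. l = (y, True)) w)) - int (length (filter (\<lambda>l. l = (y, False)) w))"
    by (induction w) auto
  then show ?thesis by (simp only: length_filter_conv_card)
qed

text \<open>\<open>W\<close> is the weight read off in the group and is known to be additive only on
  words over the generators \<open>X\<close>; \<open>wt\<close> extends it to a weight of all
  letters.\<close>

locale weighted_relator =
  fixes W :: "'a word \<Rightarrow> int" and wt :: "'a \<Rightarrow> int" and X :: "'a set" and r :: "'a word"
  assumes W: "\<And>u. fst ` set u \<subseteq> X \<Longrightarrow> W u = word_sum wt u"
    and r: "fst ` set r \<subseteq> X" "r \<noteq> []" "word_sum wt r = 0"
    and wt: "\<And>y. y \<in> X \<Longrightarrow> wt y \<ge> 0"
begin

lemma initial_subwords_X: "u \<in> initial_subwords r \<Longrightarrow> fst ` set u \<subseteq> X"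
proof -
  assume "u \<in> initial_subwords r"
  then have "set u \<subseteq> set r" by (auto simp: initial_subwords_def dest: set_mono_prefix)
  then show ?thesis using r(1) by blast
qed

lemma I_value_W: "u \<in> initial_subwords r \<Longrightarrow> I_value W u = I_value (word_sum wt) u"
proof -
  assume u: "u \<in> initial_subwords r"
  have "fst ` set (butlast u) \<subseteq> X" using initial_subwords_X[OF u] by (auto dest: in_set_butlastD)
  then show ?thesis using initial_subwords_X[OF u] by (simp add: I_value_def W)
qed

lemma lift_nth_W: "n < length r \<Longrightarrow> lift wt 0 r ! n = ((fst (r ! n), I_value W (take (Suc n) r)), snd (r ! n))"
  using lift_nth[of n r wt 0] I_value_W[of "take (Suc n) r"] by (auto simp: initial_subwords_take)

abbreviation "m \<equiv> min_I_value W r"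

lemma m_le: "u \<in> initial_subwords r \<Longrightarrow> m \<le> I_value W u"
  unfolding min_I_value_def using finite_initial_subwords by (intro Min_le) auto

lemma lift_low: "((y, s), b) \<in> set (lift wt 0 r) \<Longrightarrow> m \<le> s"
proof -
  assume "((y, s), b) \<in> set (lift wt 0 r)"
  then obtain n where n: "n < length r" "lift wt 0 r ! n = ((y, s), b)" by (auto simp: in_set_conv_nth)
  then have "s = I_value W (take (Suc n) r)" using lift_nth_W by simp
  then show ?thesis using m_le n(1) by (simp add: initial_subwords_take)
qed

text \<open>The condition on the two counts in weak concatenability thus becomes a nonzero exponent
  sum of a letter on the lowest level.\<close>

lemma expo_min_count: "expo (y, m) (lift wt 0 r) = int (min_count W r y True) - int (min_count W r y False)"
proof -
  have "card {n. n < length r \<and> lift wt 0 r ! n = ((y, m), b)} = min_count W r y b" for b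
  proof -
    let ?P = "\<lambda>u. (\<exists>w. u = w @ [(y, b)]) \<and> I_value W u = m"
    have "?P (take (Suc n) r) \<longleftrightarrow> lift wt 0 r ! n = ((y, m), b)" if "n < length r" for n
    proof -
      have "(\<exists>w. take (Suc n) r = w @ [(y, b)]) \<longleftrightarrow> r ! n = (y, b)"
        using that by (auto simp: take_Suc_conv_app_nth)
      then show ?thesis using lift_nth_W[OF that] by (cases "r ! n") auto
    qed
    moreover have "{u \<in> initial_subwords r. ?P u} = (\<lambda>n. take (Suc n) r) ` {n. n < length r \<and> ?P (take (Suc n) r)}"
      unfolding initial_subwords_take by auto
    ultimately have "{u \<in> initial_subwords r. ?P u} = (\<lambda>n. take (Suc n) r) ` {n. n < length r \<and> lift wt 0 r ! n = ((y, m), b)}"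
      by (simp only: cong: conj_cong)
    moreover have "inj_on (\<lambda>n. take (Suc n) r) {n. n < length r \<and> lift wt 0 r ! n = ((y, m), b)}"
      by (rule inj_on_subset[OF inj_take_Suc]) auto
    ultimately show ?thesis by (simp add: min_count_def card_image)
  qed
  then show ?thesis by (simp add: expo_count)
qed

text \<open>An I-value is the weight of a prefix and, generators having nonnegative weight, at most
  the weight of the subword itself. The empty prefix does no harm, as the whole relator has weight
  \<open>0\<close> too.\<close>

lemma m_eq_Min: "m = Min (W ` initial_subwords r)"
proof (rule antisym)
  have ne: "W ` initial_subwords r \<noteq> {}" using r(2) by (simp add: initial_subwords_take lessThan_empty_iff)
  have fin: "finite (W ` initial_subwords r)" using finite_initial_subwords by blast
  have last: "u = butlast u @ [last u]" "fst ` set (butlast u) \<subseteq> X" "fst (last u) \<in> X" if "u \<in> initial_subwords r" for u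
    using that initial_subwords_X[OF that] by (auto simp: initial_subwords_def dest: in_set_butlastD)
  show "m \<le> Min (W ` initial_subwords r)"
  proof (rule Min.boundedI[OF fin ne])
    fix z assume "z \<in> W ` initial_subwords r"
    then obtain u where u: "u \<in> initial_subwords r" "z = W u" by blast
    have "I_value W u \<le> W u"
    proof (cases "snd (last u)")
      case True
      have "W u = word_sum wt (butlast u @ [last u])" using W[OF initial_subwords_X[OF u(1)]] last(1)[OF u(1)] by simp
      also have "\<dots> = W (butlast u) + wt (fst (last u))"
        using W[OF last(2)[OF u(1)]] True by (simp add: word_sum_Cons)
      finally show ?thesis using wt[OF last(3)[OF u(1)]] True by (simp add: I_value_def)
    qed (simp add: I_value_def)
    then show "m \<le> z" using m_le[OF u(1)] u(2) by simp
  qed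
  have r_init: "r \<in> initial_subwords r" using r(2) by (simp add: initial_subwords_def)
  have "Min (W ` initial_subwords r) \<le> I_value W u" if u: "u \<in> initial_subwords r" for u
  proof (cases "snd (last u)")
    case True
    show ?thesis
    proof (cases "butlast u = []")
      case b: True
      have "Min (W ` initial_subwords r) \<le> W r" using fin r_init by (intro Min_le) auto
      also have "W r = W []" using W[OF r(1)] W[of "[]"] r(3) by simp
      finally show ?thesis using True b by (simp add: I_value_def)
    next
      case False
      have "prefix (butlast u) r" using u prefix_order.trans[OF prefixeq_butlast] by (auto simp: initial_subwords_def)
      then have "butlast u \<in> initial_subwords r" using False by (simp add: initial_subwords_def)
      then show ?thesis using fin True by (auto simp: I_value_def intro: Min_le)
    qed
  next
    case False
    then show ?thesis using fin u by (auto simp: I_value_def intro: Min_le)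
  qed
  then show "Min (W ` initial_subwords r) \<le> m"
    unfolding min_I_value_def using finite_initial_subwords ne by (intro Min.boundedI) auto
qed

lemma min_multisetI:
  assumes "(y, m) \<in> fst ` set (lift wt 0 r)"
  shows "y \<in># min_multiset W r"
proof -
  obtain b where "((y, m), b) \<in> set (lift wt 0 r)" using assms by auto
  then obtain n where n: "n < length r" "lift wt 0 r ! n = ((y, m), b)" by (auto simp: in_set_conv_nth)
  define u where "u = take (Suc n) r"
  have u: "u \<in> initial_subwords r" using n(1) by (auto simp: initial_subwords_take u_def)
  have eq: "u = take n r @ [(y, b)]" and I: "I_value W u = m"
    using n lift_nth_W[OF n(1)] by (auto simp: u_def take_Suc_conv_app_nth prod_eq_iff)
  have X: "y \<in> X" "fst ` set (take n r) \<subseteq> X" using initial_subwords_X[OF u] unfolding eq by auto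
  have "(\<exists>w x. u = w @ [(x, False)] \<and> W u = m) \<or> (\<exists>w x. u = w @ [(x, True)] \<and> W u = m + W [(x, True)])"
  proof (cases b)
    case True
    have "W u = word_sum wt u" by (rule W[OF initial_subwords_X[OF u]])
    also have "\<dots> = W (take n r) + W [(y, True)]" using W[OF X(2)] W[of "[(y, True)]"] X(1) True by (simp add: eq)
    also have "W (take n r) = m" using I True unfolding eq by (simp add: I_value_def)
    finally show ?thesis using eq True by blast
  next
    case False
    then show ?thesis using I eq by (auto simp: I_value_def)
  qed
  then have "u \<in> {u \<in> initial_subwords r.
        (\<exists>w x. u = w @ [(x, False)] \<and> W u = m) \<or> (\<exists>w x. u = w @ [(x, True)] \<and> W u = m + W [(x, True)])}"
    (is "u \<in> ?U") using u by blast
  moreover have "finite ?U" by (rule finite_subset[OF _ finite_initial_subwords[of r]]) blast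
  ultimately have "u \<in># mset_set ?U" by (simp only: elem_mset_set)
  then have "fst (last u) \<in># image_mset (\<lambda>u. fst (last u)) (mset_set ?U)" by (simp only: set_image_mset) (rule imageI)
  then have "fst (last u) \<in># min_multiset W r"
    unfolding min_multiset_def Let_def m_eq_Min[symmetric] .
  then show ?thesis by (simp add: eq)
qed

end

section \<open>Evaluating words in a group\<close>

lemma word_eval_simps:
  "word_eval G a [] = \<one>\<^bsub>G\<^esub>"
  "word_eval G a ((y, s) # w) = (if s then a y else inv\<^bsub>G\<^esub> (a y)) \<otimes>\<^bsub>G\<^esub> word_eval G a w"
  by (simp_all add: word_eval_def)

lemma word_eval_cong: "(\<And>y. y \<in> fst ` set w \<Longrightarrow> a y = b y) \<Longrightarrow> word_eval G a w = word_eval G b w"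
proof (induction w)
  case (Cons l w)
  then show ?case by (cases l) (simp add: word_eval_simps)
qed (simp add: word_eval_simps)

context group
begin

lemma word_eval_in:
  "(\<And>y. y \<in> fst ` set w \<Longrightarrow> a y \<in> carrier G) \<Longrightarrow> word_eval G a w \<in> carrier G"
  by (rule word_eval_closed[OF group_axioms, of a "fst ` set w"]) auto

lemma word_eval_append:
  assumes "\<And>y. y \<in> fst ` set u \<union> fst ` set v \<Longrightarrow> a y \<in> carrier G"
  shows "word_eval G a (u @ v) = word_eval G a u \<otimes> word_eval G a v"
  using assms
proof (induction u)
  case Nil
  then show ?case using word_eval_in[of v a] by (simp add: word_eval_simps)
next
  case (Cons l u)
  obtain y s where l: "l = (y, s)" by (cases l)
  have "a y \<in> carrier G" "word_eval G a u \<in> carrier G" "word_eval G a v \<in> carrier G"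
    using Cons.prems by (auto simp: l intro!: word_eval_in)
  then show ?case using Cons by (simp add: l word_eval_simps m_assoc)
qed

lemma word_eval_winv:
  assumes "\<And>y. y \<in> fst ` set u \<Longrightarrow> a y \<in> carrier G"
  shows "word_eval G a (winv u) = inv (word_eval G a u)"
  using assms
proof (induction u)
  case (Cons l u)
  obtain y s where l: "l = (y, s)" by (cases l)
  have c: "a y \<in> carrier G" "word_eval G a u \<in> carrier G"
    using Cons.prems by (auto simp: l intro!: word_eval_in)
  have "word_eval G a (winv u @ [inv_letter l]) = word_eval G a (winv u) \<otimes> word_eval G a [inv_letter l]"
    by (rule word_eval_append) (use Cons.prems in auto)
  then show ?case using c Cons by (auto simp: l word_eval_simps inv_letter_def inv_mult_group)
qed (simp add: word_eval_simps)

lemma null_word_eval: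
  assumes a: "\<And>y. a y \<in> carrier G" and "null_word R w" and R: "\<And>r. r \<in> R \<Longrightarrow> word_eval G a r = \<one>"
  shows "word_eval G a w = \<one>"
proof -
  have app: "word_eval G a (u @ v) = word_eval G a u \<otimes> word_eval G a v" for u v
    by (rule word_eval_append) (rule a)
  have cl: "word_eval G a u \<in> carrier G" for u
    by (rule word_eval_in) (rule a)
  have canc: "word_eval G a [l, inv_letter l] = \<one>" for l
    using a by (cases l) (simp add: word_eval_simps inv_letter_def)
  show ?thesis
    using assms(2)
  proof induction
    case null_Nil
    show ?case by (simp add: word_eval_simps)
  next
    case (null_cancel u v l)
    then show ?case unfolding app[of u] app[of "[l, inv_letter l]"] canc using cl by simp
  next
    case (null_uncancel u l v)
    then show ?case unfolding app[of u] app[of "[l, inv_letter l]"] canc using cl by simp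
  next
    case (null_insert u v r)
    then show ?case unfolding app R[OF null_insert.hyps(2)] using cl by simp
  next
    case (null_delete u r v)
    then show ?case unfolding app R[OF null_delete.hyps(2)] using cl by simp
  qed
qed

lemma word_eval_subst:
  assumes a: "\<And>y. a y \<in> carrier G"
  shows "word_eval G a (subst \<sigma> w) = word_eval G (\<lambda>y. word_eval G a (\<sigma> y)) w"
proof (induction w)
  case (Cons l w)
  obtain y s where l: "l = (y, s)" by (cases l)
  show ?case using Cons.IH a by (cases s) (simp_all add: l word_eval_simps word_eval_append word_eval_winv)
qed (simp add: word_eval_simps)

end

section \<open>Normal closures and consequences of relators\<close>

lemma null_word_cons_red: "null_word R (s @ cons_red l w @ t) \<longleftrightarrow> null_word R (s @ l # w @ t)"
proof (cases w)
  case (Cons l' w')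
  then show ?thesis
    using null_word_cancel_iff[of R s l "w' @ t"] by simp
qed simp

lemma null_word_reduce: "null_word R (s @ foldr cons_red u v @ t) \<longleftrightarrow> null_word R (s @ u @ v @ t)"
proof (induction u arbitrary: s)
  case (Cons l u)
  show ?case using Cons[of "s @ [l]"] null_word_cons_red[of R s l "foldr cons_red u v" t] by simp
qed simp

lemma mult_free_group: "u \<otimes>\<^bsub>free_group X\<^esub> v = foldr cons_red u v" "\<one>\<^bsub>free_group X\<^esub> = []"
  by (simp_all add: free_group_def)

lemma null_word_mult: "null_word R (u \<otimes>\<^bsub>free_group X\<^esub> v) \<longleftrightarrow> null_word R (u @ v)"
  using null_word_reduce[of R "[]" u v "[]"] by (simp add: mult_free_group)

lemma null_word_free_inv:
  assumes "u \<in> carrier (free_group X)" "null_word R u"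
  shows "null_word R (inv\<^bsub>free_group X\<^esub> u)"
proof -
  interpret group "free_group X" by (rule group_free_group)
  have "u \<otimes>\<^bsub>free_group X\<^esub> inv\<^bsub>free_group X\<^esub> u = []" using assms(1) by (simp add: mult_free_group(2)[of X, symmetric])
  then have "null_word R (u @ inv\<^bsub>free_group X\<^esub> u)" using null_word_mult[of R X u] null_Nil[of R] by metis
  then show ?thesis using null_word_delete[OF assms(2), of "[]"] by simp
qed

lemma normal_closure_null:
  assumes "w \<in> normal_closure (free_group X) R" "R \<subseteq> carrier (free_group X)"
  shows "null_word R w"
proof -
  interpret F: group "free_group X" by (rule group_free_group)
  have conj: "g \<otimes>\<^bsub>free_group X\<^esub> r \<otimes>\<^bsub>free_group X\<^esub> inv\<^bsub>free_group X\<^esub> g \<in> carrier (free_group X) \<and>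
      null_word R (g \<otimes>\<^bsub>free_group X\<^esub> r \<otimes>\<^bsub>free_group X\<^esub> inv\<^bsub>free_group X\<^esub> g)"
    if g: "g \<in> carrier (free_group X)" and r: "r \<in> R" for g r
  proof
    have rc: "r \<in> carrier (free_group X)" using r assms(2) by blast
    show "g \<otimes>\<^bsub>free_group X\<^esub> r \<otimes>\<^bsub>free_group X\<^esub> inv\<^bsub>free_group X\<^esub> g \<in> carrier (free_group X)" using g rc by simp
    let ?i = "inv\<^bsub>free_group X\<^esub> g"
    have "g \<otimes>\<^bsub>free_group X\<^esub> ?i = []" using g by (simp add: mult_free_group(2)[of X, symmetric])
    then have "null_word R (g @ ?i)" using null_word_mult[of R X g ?i] null_Nil[of R] by simp
    then have "null_word R (g @ r @ ?i)" using r by (intro null_insert)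
    then have "null_word R ([] @ g @ r @ ?i)" by simp
    then have "null_word R ((g \<otimes>\<^bsub>free_group X\<^esub> r) @ ?i)"
      using null_word_reduce[of R "[]" g r ?i] by (simp add: mult_free_group)
    then show "null_word R (g \<otimes>\<^bsub>free_group X\<^esub> r \<otimes>\<^bsub>free_group X\<^esub> ?i)" by (simp only: null_word_mult)
  qed
  show ?thesis
    using assms(1) unfolding normal_closure_def
  proof (induction rule: generate.induct)
    case one
    then show ?case by (simp add: mult_free_group null_Nil)
  next
    case (incl h)
    then show ?case using conj by blast
  next
    case (inv h)
    then have "h \<in> carrier (free_group X) \<and> null_word R h" using conj by blast
    then show ?case using null_word_free_inv by blast
  next
    case (eng h1 h2)
    then show ?case by (simp add: null_word_mult null_word_append)
  qed
qed

text \<open>The word is first reduced to an element of the free group, where the kernel is the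
  normal closure; reduction only cancels inverse pairs, which is allowed for any set of
  relators.\<close>

lemma presents_null_word:
  assumes "presents G a X R" "fst ` set w \<subseteq> X" "word_eval G a w = \<one>\<^bsub>G\<^esub>"
  shows "null_word R w"
proof -
  have P: "group G" "a \<in> X \<rightarrow> carrier G" "R \<subseteq> carrier (free_group X)"
    "kernel (free_group X) G (word_eval G a) = normal_closure (free_group X) R"
    using assms(1) by (simp_all add: presents_def)
  interpret group G by (rule P(1))
  let ?v = "foldr cons_red w []"
  define a' where "a' y = (if y \<in> X then a y else \<one>\<^bsub>G\<^esub>)" for y
  have a': "a' y \<in> carrier G" for y using P(2) by (auto simp: a'_def)
  have v: "?v \<in> carrier (free_group X)"
    using fst_set_foldr_cons_red[OF assms(2), of "[]"] by (simp add: free_group_def reduced_foldr_cons_red)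
  have ev: "word_eval G a u = word_eval G a' u" if "fst ` set u \<subseteq> X" for u
    by (rule word_eval_cong) (use that in \<open>auto simp: a'_def\<close>)
  have "null_word {} (winv w @ ?v @ [])" unfolding null_word_reduce using null_word_winv'[of "{}" w] by simp
  then have nv: "null_word {} (winv w @ ?v)" by simp
  have "word_eval G a' (winv w @ ?v) = \<one>\<^bsub>G\<^esub>" by (rule null_word_eval[OF a' nv]) simp
  then have "inv\<^bsub>G\<^esub> (word_eval G a' w) \<otimes>\<^bsub>G\<^esub> word_eval G a' ?v = \<one>\<^bsub>G\<^esub>"
    using a' by (simp add: word_eval_append word_eval_winv)
  moreover have "word_eval G a' w = \<one>\<^bsub>G\<^esub>" using ev[OF assms(2)] assms(3) by simp
  ultimately have "word_eval G a' ?v = \<one>\<^bsub>G\<^esub>" using word_eval_in[of ?v a'] a' by simp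
  then have "word_eval G a ?v = \<one>\<^bsub>G\<^esub>" using ev[of ?v] v by (simp add: free_group_def)
  then have "?v \<in> kernel (free_group X) G (word_eval G a)" using v by (simp add: kernel_def)
  then have "null_word R ?v" unfolding P(4) by (rule normal_closure_null[OF _ P(3)])
  then show ?thesis using null_word_reduce[of R "[]" w "[]" "[]"] by simp
qed

lemma presents_relator:
  assumes "presents G a X R" "r \<in> R"
  shows "word_eval G a r = \<one>\<^bsub>G\<^esub>"
proof -
  interpret F: group "free_group X" by (rule group_free_group)
  have r: "r \<in> carrier (free_group X)" using assms by (auto simp: presents_def)
  have "r = \<one>\<^bsub>free_group X\<^esub> \<otimes>\<^bsub>free_group X\<^esub> r \<otimes>\<^bsub>free_group X\<^esub> inv\<^bsub>free_group X\<^esub> \<one>\<^bsub>free_group X\<^esub>" using r by simp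
  then have "r \<in> normal_closure (free_group X) R"
    unfolding normal_closure_def using assms(2) by (intro generate.incl) blast
  then have "r \<in> kernel (free_group X) G (word_eval G a)" using assms(1) by (simp add: presents_def)
  then show ?thesis by (simp add: kernel_def)
qed

section \<open>The first homology group\<close>

lemma null_word_sum_dvd:
  fixes h :: "'a \<Rightarrow> int"
  assumes "null_word R w" "\<And>s. s \<in> R \<Longrightarrow> p dvd word_sum h s"
  shows "p dvd word_sum h w"
  using assms(1)
proof induction
  case null_Nil
  show ?case by simp
next
  case (null_cancel u v l)
  then show ?case by (cases l) (simp add: inv_letter_def)
next
  case (null_uncancel u l v)
  then show ?case by (cases l) (auto simp: inv_letter_def split: if_splits)
next
  case (null_insert u v r)
  have "p dvd word_sum h (u @ v) + word_sum h r" by (rule dvd_add[OF null_insert.IH assms(2)[OF null_insert.hyps(2)]])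
  then show ?case by (simp add: algebra_simps)
next
  case (null_delete u r v)
  have "p dvd word_sum h (u @ r @ v) - word_sum h r" by (rule dvd_diff[OF null_delete.IH assms(2)[OF null_delete.hyps(2)]])
  then show ?case by (simp add: algebra_simps)
qed

text \<open>Modulo \<open>p\<close>, the functional \<open>h\<close> is a homomorphism from \<open>G\<close> to the cyclic group of order
  \<open>p\<close>.\<close>

lemma word_sum_dvd_basis:
  fixes h :: "'a \<Rightarrow> int" and G :: "('g, 'm) monoid_scheme"
  assumes G: "group G" and o: "\<And>y. a y \<in> carrier G"
    and surj: "\<And>g. g \<in> carrier G \<Longrightarrow> \<exists>w. fst ` set w \<subseteq> X \<and> word_eval G a w = g"
    and triv: "\<And>w. fst ` set w \<subseteq> X \<Longrightarrow> word_eval G a w = \<one>\<^bsub>G\<^esub> \<Longrightarrow> p dvd word_sum h w"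
    and \<theta>: "\<theta> \<in> iso (free_Abelian_group I) (H1 G)"
    and basis: "\<And>i. i \<in> I \<Longrightarrow> fst ` set (b i) \<subseteq> X \<and> word_eval G a (b i) \<in> \<theta> (frag_of i) \<and> p dvd word_sum h (b i)"
    and w: "fst ` set w \<subseteq> X"
  shows "p dvd word_sum h w"
proof -
  interpret group G by (rule G)
  let ?D = "derived G (carrier G)"
  \<comment> \<open>By \<open>triv\<close>, words for the same element have sums congruent modulo
    \<open>p\<close>, so one word suffices to establish \<open>M\<close>.\<close>
  define M where "M g \<longleftrightarrow> (\<forall>w. fst ` set w \<subseteq> X \<longrightarrow> word_eval G a w = g \<longrightarrow> p dvd word_sum h w)" for g
  have ev: "word_eval G a (u @ v) = word_eval G a u \<otimes>\<^bsub>G\<^esub> word_eval G a v"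
      "word_eval G a (winv u) = inv\<^bsub>G\<^esub> (word_eval G a u)" "word_eval G a u \<in> carrier G" for u v
    using o by (simp_all add: word_eval_append word_eval_winv word_eval_in)
  have cong: "p dvd word_sum h u - word_sum h v"
    if "fst ` set u \<subseteq> X" "fst ` set v \<subseteq> X" "word_eval G a u = word_eval G a v" for u v
  proof -
    have "p dvd word_sum h (u @ winv v)" by (rule triv) (use that ev in \<open>simp_all add: image_Un\<close>)
    then show ?thesis by simp
  qed
  have MI: "M (word_eval G a u)" if "fst ` set u \<subseteq> X" "p dvd word_sum h u" for u
    unfolding M_def
  proof (intro allI impI)
    fix v assume "fst ` set v \<subseteq> X" "word_eval G a v = word_eval G a u"
    then have "p dvd (word_sum h v - word_sum h u) + word_sum h u" using cong[of v u] that by (intro dvd_add) auto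
    then show "p dvd word_sum h v" by simp
  qed
  have MD: "p dvd word_sum h u" if "M (word_eval G a u)" "fst ` set u \<subseteq> X" for u
    using that unfolding M_def by blast
  have M_mult: "M (g1 \<otimes>\<^bsub>G\<^esub> g2)" if g: "g1 \<in> carrier G" "g2 \<in> carrier G" "M g1" "M g2" for g1 g2
  proof -
    obtain u1 u2 where u: "fst ` set u1 \<subseteq> X" "word_eval G a u1 = g1" "fst ` set u2 \<subseteq> X" "word_eval G a u2 = g2"
      using surj[OF g(1)] surj[OF g(2)] by blast
    have "M (word_eval G a (u1 @ u2))"
      using MD[of u1] MD[of u2] u g by (intro MI) (simp_all add: image_Un)
    then show ?thesis by (simp add: ev u)
  qed
  have M_left: "M g1" if g: "g1 \<in> carrier G" "g2 \<in> carrier G" "M (g1 \<otimes>\<^bsub>G\<^esub> g2)" "M g2" for g1 g2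
  proof -
    obtain u1 u2 where u: "fst ` set u1 \<subseteq> X" "word_eval G a u1 = g1" "fst ` set u2 \<subseteq> X" "word_eval G a u2 = g2"
      using surj[OF g(1)] surj[OF g(2)] by blast
    have "p dvd word_sum h (u1 @ u2)" by (rule MD) (use u g in \<open>simp_all add: ev image_Un\<close>)
    moreover have "p dvd word_sum h u2" by (rule MD) (use u g in simp_all)
    ultimately have "p dvd word_sum h (u1 @ u2) - word_sum h u2" by (rule dvd_diff)
    then have "M (word_eval G a u1)" using u(1) by (intro MI) simp_all
    then show ?thesis by (simp add: u)
  qed
  have M_comm: "M d \<and> M (inv\<^bsub>G\<^esub> d)" if der: "d \<in> derived_set G (carrier G)" for d
  proof -
    obtain g1 g2 where g: "g1 \<in> carrier G" "g2 \<in> carrier G" "d = g1 \<otimes>\<^bsub>G\<^esub> g2 \<otimes>\<^bsub>G\<^esub> inv\<^bsub>G\<^esub> g1 \<otimes>\<^bsub>G\<^esub> inv\<^bsub>G\<^esub> g2"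
      using der by blast
    obtain u1 u2 where u: "fst ` set u1 \<subseteq> X" "word_eval G a u1 = g1" "fst ` set u2 \<subseteq> X" "word_eval G a u2 = g2"
      using surj[OF g(1)] surj[OF g(2)] by blast
    let ?u = "((u1 @ u2) @ winv u1) @ winv u2"
    have d: "d = word_eval G a ?u" by (simp only: ev u g(3))
    have X: "fst ` set ?u \<subseteq> X" using u by (simp add: image_Un)
    have "M (word_eval G a ?u)" "M (word_eval G a (winv ?u))" using X by (intro MI; simp add: image_Un)+
    then show ?thesis by (simp only: d ev)
  qed
  have M_der: "M d" if "d \<in> ?D" for d
    using that unfolding derived_def
  proof (induction rule: generate.induct)
    case one
    have "M (word_eval G a [])" by (rule MI) simp_all
    then show ?case by (simp add: word_eval_simps)
  next
    case (eng h1 h2)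
    have "generate G (derived_set G (carrier G)) \<subseteq> carrier G" using derived_in_carrier[OF subset_refl] by (simp add: derived_def)
    then show ?case using eng by (intro M_mult) auto
  qed (use M_comm in blast)+
  have \<theta>hom: "\<theta> \<in> hom (free_Abelian_group I) (H1 G)" and \<theta>bij: "\<theta> ` carrier (free_Abelian_group I) = carrier (H1 G)"
    using \<theta> by (auto simp: iso_def bij_betw_def)
  have normal: "?D \<lhd> G" by (rule derived_self_is_normal)
  interpret D: normal ?D G by (rule normal)
  have H1: "carrier (H1 G) = rcosets\<^bsub>G\<^esub> ?D" "\<And>A B. A \<otimes>\<^bsub>H1 G\<^esub> B = A <#>\<^bsub>G\<^esub> B" "\<one>\<^bsub>H1 G\<^esub> = ?D"
    by (simp_all add: H1_def FactGroup_def)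
  have grpH1: "group (H1 G)" unfolding H1_def by (rule D.factorgroup_is_group)
  have coset_in: "A \<subseteq> carrier G" "A \<noteq> {}" if "A \<in> carrier (H1 G)" for A
  proof -
    obtain g where g: "g \<in> carrier G" "A = ?D #>\<^bsub>G\<^esub> g" using \<open>A \<in> carrier (H1 G)\<close> unfolding H1 RCOSETS_def by blast
    show "A \<subseteq> carrier G" unfolding g(2) using g(1) D.subset by (intro r_coset_subset_G)
    show "A \<noteq> {}" using g rcos_self[OF g(1) D.subgroup_axioms] by blast
  qed
  \<comment> \<open>\<open>M\<close> spreads from the basis to all cosets: it holds on the derived
    subgroup, and differences are handled by cancelling a factor.\<close>
  have P: "Poly_Mapping.keys z \<subseteq> I \<and> (\<forall>g\<in>\<theta> z. M g)" if "Poly_Mapping.keys z \<subseteq> I" for z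
    using that
  proof (induction z rule: frag_induction)
    case zero
    have "\<theta> 0 = ?D" using hom_one[OF \<theta>hom group_free_Abelian_group grpH1] by (simp add: H1)
    then show ?case using M_der by simp
  next
    case (one i)
    have c: "\<theta> (frag_of i) \<in> carrier (H1 G)" using hom_in_carrier[OF \<theta>hom] one by simp
    have bi: "fst ` set (b i) \<subseteq> X" "word_eval G a (b i) \<in> \<theta> (frag_of i)" "p dvd word_sum h (b i)"
      using basis[OF one] by blast+
    have Mb: "M (word_eval G a (b i))" by (rule MI[OF bi(1,3)])
    have "M g" if g: "g \<in> \<theta> (frag_of i)" for g
    proof -
      have gc: "g \<in> carrier G" using coset_in(1)[OF c] g by blast
      obtain g0 where g0: "g0 \<in> carrier G" "\<theta> (frag_of i) = ?D #>\<^bsub>G\<^esub> g0" using c unfolding H1 RCOSETS_def by blast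
      have "?D #>\<^bsub>G\<^esub> g0 = ?D #>\<^bsub>G\<^esub> word_eval G a (b i)"
        using bi(2) unfolding g0(2) by (rule repr_independence[OF _ g0(1) D.subgroup_axioms])
      then have "g \<in> ?D #>\<^bsub>G\<^esub> word_eval G a (b i)" using g g0(2) by simp
      then obtain d where d: "d \<in> ?D" "g = d \<otimes>\<^bsub>G\<^esub> word_eval G a (b i)" unfolding r_coset_def by blast
      show ?thesis unfolding d(2) using d(1) D.subset M_der Mb ev by (intro M_mult) auto
    qed
    then show ?case using one by simp
  next
    case (diff z1 z2)
    have keys: "Poly_Mapping.keys (z1 - z2) \<subseteq> I" using diff keys_diff[of z1 z2] by blast
    have sum: "\<theta> (z1 - z2) \<otimes>\<^bsub>H1 G\<^esub> \<theta> z2 = \<theta> z1"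
    proof -
      have "\<theta> ((z1 - z2) \<otimes>\<^bsub>free_Abelian_group I\<^esub> z2) = \<theta> (z1 - z2) \<otimes>\<^bsub>H1 G\<^esub> \<theta> z2"
        by (rule hom_mult[OF \<theta>hom]) (use keys diff in simp_all)
      then show ?thesis by simp
    qed
    have c: "\<theta> (z1 - z2) \<in> carrier (H1 G)" "\<theta> z2 \<in> carrier (H1 G)"
      using hom_in_carrier[OF \<theta>hom] keys diff by simp_all
    have "M g" if g: "g \<in> \<theta> (z1 - z2)" for g
    proof -
      obtain g2 where g2: "g2 \<in> \<theta> z2" using coset_in(2)[OF c(2)] by blast
      have "g \<otimes>\<^bsub>G\<^esub> g2 \<in> \<theta> z1" unfolding sum[symmetric] H1(2) set_mult_def using g g2 by blast
      then show ?thesis using M_left[of g g2] coset_in(1)[OF c(1)] coset_in(1)[OF c(2)] g g2 diff by blast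
    qed
    then show ?case using keys by blast
  qed
  have "M (word_eval G a w)"
  proof -
    let ?g = "word_eval G a w"
    have "?D #>\<^bsub>G\<^esub> ?g \<in> carrier (H1 G)" unfolding H1 RCOSETS_def using ev(3) by blast
    then obtain z where "Poly_Mapping.keys z \<subseteq> I" "\<theta> z = ?D #>\<^bsub>G\<^esub> ?g" unfolding \<theta>bij[symmetric] by auto
    moreover have "?g \<in> ?D #>\<^bsub>G\<^esub> ?g" by (rule rcos_self[OF ev(3) D.subgroup_axioms])
    ultimately show ?thesis using P[of z] by blast
  qed
  then show ?thesis by (rule MD[OF _ w])
qed

text \<open>Counting homomorphisms to the cyclic group of order \<open>p\<close>: there are \<open>p ^ (n - k)\<close> of them by
  the structure of the first homology group, but at least \<open>p ^ (n - k + 1)\<close> if the exponent vectors of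
  the relators are dependent modulo \<open>p\<close>.\<close>

lemma relators_indep:
  fixes r :: "nat \<Rightarrow> nat word" and G :: "('g, 'm) monoid_scheme"
  assumes G: "group G" and o: "\<And>y. a y \<in> carrier G"
    and surj: "\<And>g. g \<in> carrier G \<Longrightarrow> \<exists>w. fst ` set w \<subseteq> {1..n} \<and> word_eval G a w = g"
    and triv: "\<And>w. fst ` set w \<subseteq> {1..n} \<Longrightarrow> word_eval G a w = \<one>\<^bsub>G\<^esub> \<Longrightarrow> null_word (r ` {1..k}) w"
    and r: "\<And>j. j \<in> {1..k} \<Longrightarrow> fst ` set (r j) \<subseteq> {1..n}"
    and iso: "H1 G \<cong> free_Abelian_group {1..n - k}" and "k \<le> n"
    and p: "prime p"
  shows "indep p {1..k} UNIV (\<lambda>j y. expo y (r j))"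
  unfolding indep_def
proof (intro allI impI ballI, rule ccontr)
  fix \<mu> :: "nat \<Rightarrow> int" and j0
  assume \<mu>: "\<forall>y\<in>UNIV. p dvd (\<Sum>j\<in>{1..k}. \<mu> j * expo y (r j))" and j0: "j0 \<in> {1..k}" "\<not> p dvd \<mu> j0"
  interpret group G by (rule G)
  have p1: "p > 1" using p prime_gt_1_int by blast
  define C where "C = {1..n} \<rightarrow>\<^sub>E {0..<p}"
  have finC: "finite C" by (simp add: C_def finite_PiE)
  have cardP: "card ({0..<p}) = nat p" by simp
  have word_sum_r: "word_sum c (r j) = (\<Sum>y\<in>{1..n}. c y * expo y (r j))" if "j \<in> {1..k}" for c :: "nat \<Rightarrow> int" and j
    using word_sum_expo[OF _ r[OF that], of c] by simp
  \<comment> \<open>Members of \<open>C\<close> are homomorphisms from the free group to the cyclic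
    group of order \<open>p\<close>; those in \<open>V\<close> kill the relators and so factor
    through \<open>G\<close>.\<close>
  define V where "V = {c\<in>C. \<forall>j\<in>{1..k}. p dvd word_sum c (r j)}"
  have finV: "finite V" using finC by (simp add: V_def)
  define \<Phi> where "\<Phi> c = restrict (\<lambda>j. word_sum c (r j) mod p) ({1..k} - {j0})" for c
  define B where "B = ({1..k} - {j0}) \<rightarrow>\<^sub>E {0..<p}"
  have finB: "finite B" by (simp add: B_def finite_PiE)
  have \<Phi>B: "\<Phi> c \<in> B" for c using p1 by (auto simp: \<Phi>_def B_def)
  \<comment> \<open>Two members of a fibre of \<open>\<Phi>\<close> differ by a homomorphism killing
    all relators but \<open>r j0\<close>. As \<open>\<mu> j0\<close> is invertible modulo
    \<open>p\<close>, the dependence makes it kill \<open>r j0\<close> as well.\<close>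
  have fiber: "card {c\<in>C. \<Phi> c = \<beta>} \<le> card V" for \<beta>
  proof (cases "\<exists>c0\<in>C. \<Phi> c0 = \<beta>")
    case True
    then obtain c0 where c0: "c0 \<in> C" "\<Phi> c0 = \<beta>" by blast
    define f where "f c = restrict (\<lambda>y. (c y - c0 y) mod p) {1..n}" for c
    have "inj_on f {c\<in>C. \<Phi> c = \<beta>}"
    proof (rule inj_onI)
      fix c d assume cd: "c \<in> {c\<in>C. \<Phi> c = \<beta>}" "d \<in> {c\<in>C. \<Phi> c = \<beta>}" "f c = f d"
      have "c y = d y" if y: "y \<in> {1..n}" for y
      proof -
        have "(c y - c0 y) mod p = (d y - c0 y) mod p" using fun_cong[OF cd(3), of y] y by (simp add: f_def)
        then have "(c y - c0 y + c0 y) mod p = (d y - c0 y + c0 y) mod p" by (rule mod_add_cong) simp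
        moreover have "c y \<in> {0..<p}" "d y \<in> {0..<p}" using cd(1,2) y by (auto simp: C_def)
        ultimately show ?thesis by simp
      qed
      then show "c = d" using cd(1,2) by (intro PiE_ext[of c "{1..n}" _ d]) (auto simp: C_def)
    qed
    moreover have "f ` {c\<in>C. \<Phi> c = \<beta>} \<subseteq> V"
    proof
      fix g assume "g \<in> f ` {c\<in>C. \<Phi> c = \<beta>}"
      then obtain c where c: "c \<in> C" "\<Phi> c = \<beta>" "g = f c" by blast
      have gC: "g \<in> C" unfolding c(3) f_def C_def using p1 by auto
      define e where "e y = c y - c0 y" for y
      have ge: "p dvd word_sum g (r j) - word_sum e (r j)" if "j \<in> {1..k}" for j
      proof -
        have "word_sum g (r j) - word_sum e (r j) = (\<Sum>y\<in>{1..n}. (g y - e y) * expo y (r j))"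
          unfolding word_sum_r[OF that] by (simp add: sum_subtractf left_diff_distrib)
        moreover have "p dvd g y - e y" if "y \<in> {1..n}" for y
        proof -
          have "g y = e y mod p" using that by (simp add: c(3) f_def e_def)
          then have "g y mod p = e y mod p" by simp
          then show ?thesis by (simp only: mod_eq_dvd_iff)
        qed
        then have "p dvd (\<Sum>y\<in>{1..n}. (g y - e y) * expo y (r j))" by (intro dvd_sum dvd_mult2)
        ultimately show ?thesis by (simp only:)
      qed
      have e0: "p dvd word_sum e (r j)" if "j \<in> {1..k}" "j \<noteq> j0" for j
      proof -
        have "\<Phi> c j = \<Phi> c0 j" using c(2) c0(2) by simp
        then have "word_sum c (r j) mod p = word_sum c0 (r j) mod p" using that by (simp add: \<Phi>_def)
        then have "p dvd word_sum c (r j) - word_sum c0 (r j)" by (simp only: mod_eq_dvd_iff)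
        moreover have "word_sum e (r j) = word_sum c (r j) - word_sum c0 (r j)"
          using word_sum_linear[of 1 c "-1" c0 "r j"] by (simp add: e_def[abs_def])
        ultimately show ?thesis by simp
      qed
      have "(\<Sum>j\<in>{1..k}. \<mu> j * word_sum e (r j)) = (\<Sum>y\<in>{1..n}. e y * (\<Sum>j\<in>{1..k}. \<mu> j * expo y (r j)))"
      proof -
        have "(\<Sum>j\<in>{1..k}. \<mu> j * word_sum e (r j)) = (\<Sum>j\<in>{1..k}. \<Sum>y\<in>{1..n}. e y * (\<mu> j * expo y (r j)))"
          by (intro sum.cong refl) (simp add: word_sum_r sum_distrib_left algebra_simps)
        also have "\<dots> = (\<Sum>y\<in>{1..n}. \<Sum>j\<in>{1..k}. e y * (\<mu> j * expo y (r j)))" by (rule sum.swap)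
        finally show ?thesis by (simp only: sum_distrib_left)
      qed
      moreover have "p dvd (\<Sum>y\<in>{1..n}. e y * (\<Sum>j\<in>{1..k}. \<mu> j * expo y (r j)))"
      proof (rule dvd_sum)
        fix y
        have "p dvd (\<Sum>j\<in>{1..k}. \<mu> j * expo y (r j))" using \<mu> by blast
        then show "p dvd e y * (\<Sum>j\<in>{1..k}. \<mu> j * expo y (r j))" by (rule dvd_mult)
      qed
      ultimately have d1: "p dvd (\<Sum>j\<in>{1..k}. \<mu> j * word_sum e (r j))" by (simp only:)
      have rem: "(\<Sum>j\<in>{1..k}. \<mu> j * word_sum e (r j)) = \<mu> j0 * word_sum e (r j0) + (\<Sum>j\<in>{1..k} - {j0}. \<mu> j * word_sum e (r j))"
        using j0(1) by (intro sum.remove) simp_all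
      have d2: "p dvd (\<Sum>j\<in>{1..k} - {j0}. \<mu> j * word_sum e (r j))"
        using e0 by (intro dvd_sum dvd_mult) auto
      have "p dvd \<mu> j0 * word_sum e (r j0)" using dvd_diff[OF d1 d2] unfolding rem by simp
      then have "p dvd word_sum e (r j0)" using j0(2) prime_dvd_mult_iff[OF p] by simp
      then have e: "p dvd word_sum e (r j)" if "j \<in> {1..k}" for j using e0 that by (cases "j = j0") auto
      have "p dvd word_sum g (r j)" if "j \<in> {1..k}" for j
        using dvd_add[OF ge[OF that] e[OF that]] by simp
      then show "g \<in> V" using gC by (simp add: V_def)
    qed
    ultimately show ?thesis using finV by (metis card_inj_on_le)
  next
    case False
    then have "{c\<in>C. \<Phi> c = \<beta>} = {}" by blast
    then show ?thesis by (simp only: card.empty)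
  qed
  have "C = (\<Union>\<beta>\<in>B. {c\<in>C. \<Phi> c = \<beta>})" using \<Phi>B by blast
  then have "card C \<le> (\<Sum>\<beta>\<in>B. card {c\<in>C. \<Phi> c = \<beta>})" using card_UN_le[OF finB, of "\<lambda>\<beta>. {c\<in>C. \<Phi> c = \<beta>}"] by simp
  also have "\<dots> \<le> card B * card V" using sum_bounded_above[of B _ "card V"] fiber by simp
  finally have CB: "card C \<le> card B * card V" .
  obtain \<theta> where \<theta>: "\<theta> \<in> iso (free_Abelian_group {1..n - k}) (H1 G)"
  proof -
    have "group (H1 G)" unfolding H1_def by (rule normal.factorgroup_is_group[OF derived_self_is_normal])
    then have "free_Abelian_group {1..n - k} \<cong> H1 G" using iso by (rule group.iso_sym)
    then show thesis using that unfolding is_iso_def by blast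
  qed
  have "\<forall>i\<in>{1..n - k}. \<exists>w. fst ` set w \<subseteq> {1..n} \<and> word_eval G a w \<in> \<theta> (frag_of i)"
  proof
    fix i assume i: "i \<in> {1..n - k}"
    have "\<theta> (frag_of i) \<in> carrier (H1 G)" using \<theta> i by (auto simp: iso_def intro: hom_in_carrier)
    then obtain g where g: "g \<in> carrier G" "\<theta> (frag_of i) = derived G (carrier G) #>\<^bsub>G\<^esub> g"
      unfolding H1_def FactGroup_def RCOSETS_def by auto
    have "g \<in> \<theta> (frag_of i)" unfolding g(2)
      using g(1) derived_is_subgroup[OF subset_refl] by (intro rcos_self)
    then show "\<exists>w. fst ` set w \<subseteq> {1..n} \<and> word_eval G a w \<in> \<theta> (frag_of i)" using surj[OF g(1)] by metis
  qed
  from bchoice[OF this] obtain b where b: "\<forall>i\<in>{1..n - k}. fst ` set (b i) \<subseteq> {1..n} \<and> word_eval G a (b i) \<in> \<theta> (frag_of i)"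
    by (elim exE)
  define \<Psi> where "\<Psi> c = restrict (\<lambda>i. word_sum c (b i) mod p) {1..n - k}" for c
  \<comment> \<open>By the structure of \<open>H1 G\<close>, values on the \<open>n - k\<close>
    basis words determine such a homomorphism.\<close>
  have "inj_on \<Psi> V"
  proof (rule inj_onI)
    fix c d assume cd: "c \<in> V" "d \<in> V" "\<Psi> c = \<Psi> d"
    define e where "e y = c y - d y" for y
    have we: "word_sum e w = word_sum c w - word_sum d w" for w
      using word_sum_linear[of 1 c "-1" d w] by (simp add: e_def[abs_def])
    have dvd: "p dvd word_sum e w" if w: "fst ` set w \<subseteq> {1..n}" for w
    proof (rule word_sum_dvd_basis[OF G o surj _ \<theta> _ w])
      fix w assume "fst ` set w \<subseteq> {1..n}" "word_eval G a w = \<one>\<^bsub>G\<^esub>"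
      then have null: "null_word (r ` {1..k}) w" by (rule triv)
      show "p dvd word_sum e w"
      proof (rule null_word_sum_dvd[OF null])
        fix s assume "s \<in> r ` {1..k}"
        then show "p dvd word_sum e s" unfolding we using cd(1,2) by (auto simp: V_def intro: dvd_diff)
      qed
    next
      fix i assume i: "i \<in> {1..n - k}"
      have "word_sum c (b i) mod p = word_sum d (b i) mod p" using fun_cong[OF cd(3), of i] i by (simp add: \<Psi>_def)
      then have "p dvd word_sum e (b i)" unfolding we by (simp only: mod_eq_dvd_iff)
      then show "fst ` set (b i) \<subseteq> {1..n} \<and> word_eval G a (b i) \<in> \<theta> (frag_of i) \<and> p dvd word_sum e (b i)"
        using b i by blast
    qed
    have "c y = d y" if y: "y \<in> {1..n}" for y
    proof -
      have "p dvd c y - d y" using dvd[of "[(y, True)]"] y by (simp add: e_def)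
      then have "c y mod p = d y mod p" by (simp only: mod_eq_dvd_iff)
      moreover have "c y \<in> {0..<p}" "d y \<in> {0..<p}" using cd(1,2) y by (auto simp: V_def C_def)
      ultimately show ?thesis by simp
    qed
    then show "c = d" using cd(1,2) by (intro PiE_ext[of c "{1..n}" _ d]) (auto simp: V_def C_def)
  qed
  moreover have "\<Psi> ` V \<subseteq> {1..n - k} \<rightarrow>\<^sub>E {0..<p}" using p1 by (auto simp: \<Psi>_def)
  ultimately have "card V \<le> card ({1..n - k} \<rightarrow>\<^sub>E {0..<p})"
    by (rule card_inj_on_le) (simp add: finite_PiE)
  then have "card V \<le> nat p ^ (n - k)" by (simp add: card_funcsetE)
  moreover have "card B = nat p ^ (k - 1)" using j0(1) by (simp add: B_def card_funcsetE)
  moreover have "card C = nat p ^ n" by (simp add: C_def card_funcsetE)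
  ultimately have "nat p ^ n \<le> nat p ^ (k - 1) * nat p ^ (n - k)" using CB by (metis le_trans mult_le_mono2)
  also have "\<dots> = nat p ^ (n - 1)" using j0(1) \<open>k \<le> n\<close> by (simp add: power_add[symmetric])
  finally have "n \<le> n - 1" using p1 by (subst (asm) power_increasing_iff) auto
  then show False using j0(1) \<open>k \<le> n\<close> by simp
qed

section \<open>Local indicability\<close>

lemma int_subgroup_generator:
  fixes S :: "int set"
  assumes "s0 \<in> S" "s0 \<noteq> 0" "\<And>a b. a \<in> S \<Longrightarrow> b \<in> S \<Longrightarrow> a - b \<in> S"
  shows "\<exists>v>0. (\<lambda>n. n * v) ` UNIV = S"
proof -
  have zero: "0 \<in> S" using assms(3)[OF assms(1,1)] by simp
  have neg: "- a \<in> S" if "a \<in> S" for a using assms(3)[OF zero that] by simp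
  have add: "a + b \<in> S" if "a \<in> S" "b \<in> S" for a b using assms(3)[OF that(1) neg[OF that(2)]] by simp
  have "\<exists>m. m > 0 \<and> int m \<in> S"
    using assms(1,2) neg[OF assms(1)] by (intro exI[of _ "nat \<bar>s0\<bar>"]) (auto simp: abs_if)
  then obtain m where m: "m > 0 \<and> int m \<in> S" "\<And>m'. m' < m \<Longrightarrow> \<not> (m' > 0 \<and> int m' \<in> S)"
    using exists_least_iff[of "\<lambda>m. m > 0 \<and> int m \<in> S"] by blast
  have nat_mult: "int n * int m \<in> S" for n
    by (induction n) (use zero add m(1) in \<open>auto simp: algebra_simps\<close>)
  have mult: "n * int m \<in> S" for n
    using nat_mult[of "nat n"] neg[OF nat_mult[of "nat (- n)"]] by (cases "n \<ge> 0") simp_all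
  have "s \<in> (\<lambda>n. n * int m) ` UNIV" if s: "s \<in> S" for s
  proof -
    have "s mod int m \<in> S" using assms(3)[OF s mult[of "s div int m"]] by (simp add: minus_div_mult_eq_mod)
    moreover have "0 \<le> s mod int m" "s mod int m < int m" using m(1) by simp_all
    ultimately have "s mod int m = 0"
    proof (cases "s mod int m = 0")
      case False
      then have "0 < nat (s mod int m)" "nat (s mod int m) < m"
        using \<open>0 \<le> s mod int m\<close> \<open>s mod int m < int m\<close> by linarith+
      then show ?thesis using m(2)[of "nat (s mod int m)"] \<open>s mod int m \<in> S\<close> \<open>0 \<le> s mod int m\<close> by simp
    qed
    then show ?thesis by (intro image_eqI[of _ _ "s div int m"]) auto
  qed
  then have "(\<lambda>n. n * int m) ` UNIV = S" using mult by blast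
  then show ?thesis using m(1) by (intro exI[of _ "int m"]) simp
qed

section \<open>Characters of finitely generated subgroups\<close>

context group
begin

lemma generate_word_eval:
  assumes "A \<subseteq> carrier G" "g \<in> generate G A"
  shows "\<exists>W. fst ` set W \<subseteq> A \<and> word_eval G (\<lambda>a. a) W = g"
  using assms(2)
proof (induction rule: generate.induct)
  case one
  show ?case by (intro exI[of _ "[]"]) (simp add: word_eval_simps)
next
  case (incl h)
  then show ?case using assms(1) by (intro exI[of _ "[(h, True)]"]) (auto simp: word_eval_simps)
next
  case (inv h)
  then show ?case using assms(1) by (intro exI[of _ "[(h, False)]"]) (auto simp: word_eval_simps)
next
  case (eng h1 h2)
  then obtain W1 W2 where W: "fst ` set W1 \<subseteq> A" "word_eval G (\<lambda>a. a) W1 = h1" "fst ` set W2 \<subseteq> A" "word_eval G (\<lambda>a. a) W2 = h2"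
    by (elim exE conjE)
  have "word_eval G (\<lambda>a. a) (W1 @ W2) = h1 \<otimes> h2"
    using W assms(1) by (subst word_eval_append) auto
  then show ?case using W by (intro exI[of _ "W1 @ W2"]) (simp add: image_Un)
qed

text \<open>Clearing denominators gives an integral character. Its image is a nonzero subgroup of
  the integers, and division by a generator makes the character onto.\<close>

lemma epi_from_functional:
  fixes \<psi> :: "'a \<Rightarrow> rat"
  assumes A: "finite A" "A \<subseteq> carrier G"
    and \<psi>: "\<And>W. fst ` set W \<subseteq> A \<Longrightarrow> word_eval G (\<lambda>a. a) W = \<one> \<Longrightarrow> word_sum \<psi> W = 0"
    and a0: "a0 \<in> A" "\<psi> a0 \<noteq> 0"
  shows "\<exists>f. f \<in> epi (subgroup_generated G A) integer_group"
proof -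
  let ?e = "word_eval G (\<lambda>a. a)"
  obtain d k where d: "d > 0" "\<forall>a\<in>A. of_int d * \<psi> a = of_int (k a)"
    using common_denominator[OF A(1), of \<psi>] by (elim exE conjE)
  have ev: "?e (u @ v) = ?e u \<otimes> ?e v" "?e (winv u) = inv (?e u)" "?e u \<in> carrier G"
    if "fst ` set u \<subseteq> A" "fst ` set v \<subseteq> A" for u v
    using that A(2) by (auto intro!: word_eval_append word_eval_winv word_eval_in)
  have k0: "word_sum k W = 0" if W: "fst ` set W \<subseteq> A" "?e W = \<one>" for W
  proof -
    have "(of_int (word_sum k W) :: rat) = word_sum (\<lambda>y. of_int d * \<psi> y + 0 * \<psi> y) W"
      unfolding word_sum_of_int[symmetric] using W(1) d(2) by (intro word_sum_cong) auto
    also have "\<dots> = 0" unfolding word_sum_linear using \<psi>[OF W] by simp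
    finally show ?thesis by simp
  qed
  have kcong: "word_sum k u = word_sum k v" if "fst ` set u \<subseteq> A" "fst ` set v \<subseteq> A" "?e u = ?e v" for u v
  proof -
    have "?e (u @ winv v) = \<one>" using ev[of u "winv v"] ev[of v v] that by simp
    then have "word_sum k (u @ winv v) = 0" using that by (intro k0) (simp_all add: image_Un)
    then show ?thesis by simp
  qed
  define w where "w g = (SOME W. fst ` set W \<subseteq> A \<and> ?e W = g)" for g
  have w: "fst ` set (w g) \<subseteq> A \<and> ?e (w g) = g" if "g \<in> generate G A" for g
    unfolding w_def by (rule someI_ex[OF generate_word_eval[OF A(2) that]])
  have carr: "carrier (subgroup_generated G A) = generate G A"
    using A(2) by (simp add: carrier_subgroup_generated Int_absorb1)
  define S where "S = {word_sum k W | W. fst ` set W \<subseteq> A}"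
  have f_word: "word_sum k (w (?e W)) = word_sum k W" "?e W \<in> generate G A" if W: "fst ` set W \<subseteq> A" for W
  proof -
    show "?e W \<in> generate G A"
      using W
    proof (induction W)
      case (Cons l W)
      obtain a s where l: "l = (a, s)" by (cases l)
      show ?case using Cons by (auto simp: l word_eval_simps intro: generate.intros)
    qed (simp add: word_eval_simps generate.one)
    then show "word_sum k (w (?e W)) = word_sum k W" using w[of "?e W"] W by (intro kcong) auto
  qed
  have "\<exists>v>0. (\<lambda>n. n * v) ` UNIV = S"
  proof (rule int_subgroup_generator)
    show "k a0 \<in> S" unfolding S_def using a0(1) by (intro CollectI exI[of _ "[(a0, True)]"]) simp
    have "of_int d * \<psi> a0 \<noteq> 0" using d(1) a0(2) by simp
    then show "k a0 \<noteq> 0" using d(2) a0(1) by auto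
    fix s t assume "s \<in> S" "t \<in> S"
    then obtain U V where "fst ` set U \<subseteq> A" "s = word_sum k U" "fst ` set V \<subseteq> A" "t = word_sum k V"
      unfolding S_def by blast
    then show "s - t \<in> S" unfolding S_def by (intro CollectI exI[of _ "U @ winv V"]) (simp add: image_Un)
  qed
  then obtain v where v: "v > 0" "(\<lambda>n. n * v) ` UNIV = S" by (elim exE conjE)
  define f where "f g = word_sum k (w g) div v" for g
  have fS: "word_sum k (w g) \<in> S" if "g \<in> generate G A" for g unfolding S_def using w[OF that] by blast
  have fv: "word_sum k (w g) = f g * v" if g: "g \<in> generate G A" for g
  proof -
    obtain n where "word_sum k (w g) = n * v" using fS[OF g] unfolding v(2)[symmetric] by blast
    then show ?thesis using v(1) by (simp add: f_def)
  qed
  have "f \<in> hom (subgroup_generated G A) integer_group"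
  proof (rule homI)
    fix g h assume gh: "g \<in> carrier (subgroup_generated G A)" "h \<in> carrier (subgroup_generated G A)"
    then have gh': "g \<in> generate G A" "h \<in> generate G A" by (simp_all only: carr)
    have W: "fst ` set (w g @ w h) \<subseteq> A" using w[OF gh'(1)] w[OF gh'(2)] by (simp add: image_Un)
    have e: "?e (w g @ w h) = g \<otimes> h" using ev(1)[of "w g" "w h"] w[OF gh'(1)] w[OF gh'(2)] by simp
    have ghc: "g \<otimes> h \<in> generate G A" using gh' by (rule generate.eng)
    have "f (g \<otimes> h) * v = word_sum k (w g) + word_sum k (w h)"
      using fv[OF ghc] f_word(1)[OF W] unfolding e by simp
    also have "\<dots> = (f g + f h) * v" using fv[OF gh'(1)] fv[OF gh'(2)] by (simp add: algebra_simps)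
    finally show "f (g \<otimes>\<^bsub>subgroup_generated G A\<^esub> h) = f g \<otimes>\<^bsub>integer_group\<^esub> f h"
      using v(1) by (simp add: integer_group_def)
  qed (simp add: integer_group_def)
  moreover have "n \<in> f ` carrier (subgroup_generated G A)" for n
  proof -
    have "n * v \<in> S" using v(2) by blast
    then obtain W where W: "fst ` set W \<subseteq> A" "word_sum k W = n * v" unfolding S_def by force
    then have "f (?e W) = n" using f_word(1)[OF W(1)] v(1) by (simp add: f_def)
    then show ?thesis using f_word(2)[OF W(1)] carr by blast
  qed
  ultimately have "f \<in> epi (subgroup_generated G A) integer_group" by (auto simp: epi_def integer_group_def)
  then show ?thesis by blast
qed

end

lemma lift_subst:
  assumes "\<And>a. a \<in> fst ` set W \<Longrightarrow> word_sum wt (\<sigma> a) = 0"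
  shows "lift wt 0 (subst \<sigma> W) = subst (\<lambda>a. lift wt 0 (\<sigma> a)) W"
  using assms
proof (induction W)
  case (Cons l W)
  obtain a s where l: "l = (a, s)" by (cases l)
  have "word_sum wt (\<sigma> a) = 0" using Cons.prems by (simp add: l)
  moreover from this have "lift wt 0 (winv (\<sigma> a)) = winv (lift wt 0 (\<sigma> a))" using lift_winv[of wt 0 "\<sigma> a"] by simp
  ultimately show ?case using Cons by (simp add: l lift_append)
qed simp

text \<open>Forgetting levels is a substitution that sends each lifted relator to the relator
  itself.\<close>

lemma null_word_unlift:
  assumes "null_word Q (lift wt i w)" "Q \<subseteq> {lift wt i c | i c. c \<in> R}"
  shows "null_word R w"
proof -
  have proj: "subst (\<lambda>y. [(fst y, True)]) (lift wt i u) = u" for i u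
    by (induction wt i u rule: lift.induct) (auto simp: inv_letter_def)
  have "null_word R (subst (\<lambda>y. [(fst y, True)]) (lift wt i w))"
  proof (rule null_word_subst[OF assms(1)])
    fix q assume "q \<in> Q"
    then obtain j c where "c \<in> R" "q = lift wt j c" using assms(2) by blast
    then show "null_word R (subst (\<lambda>y. [(fst y, True)]) q)" by (simp add: proj null_word_relator)
  qed
  then show ?thesis by (simp add: proj)
qed

text \<open>A finitely generated subgroup without characters lies in the kernel of \<open>\<phi>\<close>, hence lifts to
  the infinite cyclic cover; finitely many of its relations, and hence finitely many relators of the
  cover, show that it has no characters.\<close>

lemma locally_indicable_from_cover:
  fixes G :: "('g, 'm) monoid_scheme" and a :: "'a \<Rightarrow> 'g" and \<phi> :: "'g \<Rightarrow> int"
  assumes G: "group G" and o: "\<And>y. a y \<in> carrier G"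
    and surj: "\<And>g. g \<in> carrier G \<Longrightarrow> \<exists>w. fst ` set w \<subseteq> X \<and> word_eval G a w = g"
    and triv: "\<And>w. fst ` set w \<subseteq> X \<Longrightarrow> word_eval G a w = \<one>\<^bsub>G\<^esub> \<Longrightarrow> null_word R w"
    and R: "\<And>r. r \<in> R \<Longrightarrow> word_eval G a r = \<one>\<^bsub>G\<^esub>"
    and \<phi>: "\<And>w. \<phi> (word_eval G a w) = word_sum wt w"
    and cover: "\<And>Q. finite Q \<Longrightarrow> Q \<subseteq> {lift wt i c | i c. c \<in> R} \<Longrightarrow>
      \<exists>Q'. Q \<subseteq> Q' \<and> Q' \<subseteq> {lift wt i c | i c. c \<in> R} \<and> loc_indicable Q'"
  shows "locally_indicable G"
  unfolding locally_indicable_def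
proof (intro allI impI, elim conjE)
  interpret group G by (rule G)
  fix A assume A: "finite A" "A \<subseteq> carrier G" and nontriv: "\<not> trivial_group (subgroup_generated G A)"
  show "\<exists>f. f \<in> epi (subgroup_generated G A) integer_group"
  proof (rule ccontr)
    assume no: "\<not> ?thesis"
    let ?e = "word_eval G (\<lambda>a. a)"
    have func: "\<psi> b = 0" if "\<And>W. fst ` set W \<subseteq> A \<Longrightarrow> ?e W = \<one>\<^bsub>G\<^esub> \<Longrightarrow> word_sum \<psi> W = 0" "b \<in> A" for b and \<psi> :: "'g \<Rightarrow> rat"
      using epi_from_functional[OF A that(1,2)] no by blast
    define \<sigma> where "\<sigma> b = (SOME w. fst ` set w \<subseteq> X \<and> word_eval G a w = b)" for b
    have \<sigma>: "fst ` set (\<sigma> b) \<subseteq> X \<and> word_eval G a (\<sigma> b) = b" if "b \<in> A" for b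
      unfolding \<sigma>_def by (rule someI_ex[OF surj]) (use A(2) that in blast)
    have \<sigma>_eval: "word_eval G a (subst \<sigma> W) = ?e W" if "fst ` set W \<subseteq> A" for W
    proof -
      have "word_eval G a (subst \<sigma> W) = word_eval G (\<lambda>b. word_eval G a (\<sigma> b)) W" by (rule word_eval_subst[OF o])
      also have "\<dots> = ?e W" by (rule word_eval_cong) (use \<sigma> that in blast)
      finally show ?thesis .
    qed
    have \<sigma>_X: "fst ` set (subst \<sigma> W) \<subseteq> X" if "fst ` set W \<subseteq> A" for W
      using that
    proof (induction W)
      case (Cons l W)
      obtain b s where l: "l = (b, s)" by (cases l)
      show ?case using Cons \<sigma>[of b] by (cases s) (simp_all add: l image_Un)
    qed simp
    define L where "L = {W. fst ` set W \<subseteq> A \<and> ?e W = \<one>\<^bsub>G\<^esub>}"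
    obtain L0 where L0: "L0 \<subseteq> L" "finite L0"
      and ann: "\<And>\<psi>::'g \<Rightarrow> rat. (\<forall>g. g \<notin> A \<longrightarrow> \<psi> g = 0) \<Longrightarrow> (\<forall>w\<in>L0. word_sum \<psi> w = 0) \<Longrightarrow>
        (\<forall>w\<in>L. word_sum \<psi> w = 0)"
      using finite_annihilator[OF A(1), of L] by (elim exE conjE) (erule (1) that, simp)
    have wt0: "word_sum wt r = 0" if "r \<in> R" for r
      using \<phi>[of r] \<phi>[of "[]"] R[OF that] by (simp add: word_eval_simps)
    \<comment> \<open>\<open>\<phi>\<close> itself restricts to a character of the subgroup, so it
      vanishes on \<open>A\<close>; hence the chosen words return to level \<open>0\<close> and
      their lifts multiply.\<close>
    have \<phi>0: "word_sum wt (\<sigma> b) = 0" if b: "b \<in> A" for b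
    proof -
      have "(of_int (\<phi> b) :: rat) = 0"
      proof (rule func[OF _ b, of "\<lambda>b. of_int (\<phi> b)"])
        fix W assume W: "fst ` set W \<subseteq> A" "?e W = \<one>\<^bsub>G\<^esub>"
        have "word_sum \<phi> W = word_sum (\<lambda>b. word_sum wt (\<sigma> b)) W"
        proof (rule word_sum_cong)
          fix y assume "y \<in> fst ` set W"
          then have "y \<in> A" using W(1) by blast
          then show "\<phi> y = word_sum wt (\<sigma> y)" using \<sigma>[of y] \<phi>[of "\<sigma> y"] by simp
        qed
        also have "\<dots> = \<phi> (word_eval G a (subst \<sigma> W))" by (simp only: word_sum_subst[symmetric] \<phi>)
        also have "\<dots> = \<phi> (word_eval G a [])" using \<sigma>_eval[OF W(1)] W(2) by (simp add: word_eval_simps)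
        also have "\<dots> = 0" by (simp only: \<phi> word_sum_simps)
        finally show "word_sum (\<lambda>b. of_int (\<phi> b) :: rat) W = 0" by (simp add: word_sum_of_int)
      qed
      then have "\<phi> b = 0" by simp
      then show ?thesis using \<sigma>[OF b] \<phi>[of "\<sigma> b"] by simp
    qed
    let ?Rinf = "{lift wt i c | i c. c \<in> R}"
    let ?lf = "\<lambda>b. lift wt 0 (\<sigma> b)"
    have lifted: "lift wt 0 (subst \<sigma> W) = subst ?lf W" if "fst ` set W \<subseteq> A" for W
      by (rule lift_subst) (use \<phi>0 that in blast)
    have "\<forall>W\<in>L0. \<exists>Q. Q \<subseteq> ?Rinf \<and> finite Q \<and> null_word Q (subst ?lf W)"
    proof
      fix W assume "W \<in> L0"
      then have W: "fst ` set W \<subseteq> A" "?e W = \<one>\<^bsub>G\<^esub>" using L0(1) by (auto simp: L_def)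
      have "null_word R (subst \<sigma> W)" by (rule triv[OF \<sigma>_X[OF W(1)]]) (simp add: \<sigma>_eval[OF W(1)] W(2))
      then have "null_word ?Rinf (lift wt 0 (subst \<sigma> W))" by (rule null_word_lift) (rule wt0)
      then show "\<exists>Q. Q \<subseteq> ?Rinf \<and> finite Q \<and> null_word Q (subst ?lf W)"
        unfolding lifted[OF W(1)] by (rule null_word_finite)
    qed
    from bchoice[OF this] obtain q where q: "\<forall>W\<in>L0. q W \<subseteq> ?Rinf \<and> finite (q W) \<and> null_word (q W) (subst ?lf W)"
      by (elim exE)
    have "finite (\<Union>W\<in>L0. q W)" "(\<Union>W\<in>L0. q W) \<subseteq> ?Rinf" using q L0(2) by blast+
    from cover[OF this] obtain Q where Q: "(\<Union>W\<in>L0. q W) \<subseteq> Q" "Q \<subseteq> ?Rinf" "loc_indicable Q" by (elim exE conjE)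
    have QW: "null_word Q (subst ?lf W)" if W: "W \<in> L0" for W
    proof (rule null_word_mono)
      show "null_word (q W) (subst ?lf W)" using q W by blast
      show "q W \<subseteq> Q" using Q(1) W by blast
    qed
    have "\<forall>g\<in>?lf ` A. null_word Q g"
    proof (rule Q(3)[unfolded loc_indicable_def, THEN spec, THEN mp, THEN mp])
      show "finite (?lf ` A)" using A(1) by simp
      show "\<forall>\<psi>::('a \<times> int) word \<Rightarrow> rat. (\<forall>W. fst ` set W \<subseteq> ?lf ` A \<longrightarrow> null_word Q (subst (\<lambda>g. g) W) \<longrightarrow>
          word_sum \<psi> W = 0) \<longrightarrow> (\<forall>w\<in>?lf ` A. \<psi> w = 0)"
      proof (intro allI impI ballI)
        fix \<psi> :: "('a \<times> int) word \<Rightarrow> rat" and w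
        assume \<psi>: "\<forall>W. fst ` set W \<subseteq> ?lf ` A \<longrightarrow> null_word Q (subst (\<lambda>g. g) W) \<longrightarrow> word_sum \<psi> W = 0"
          and "w \<in> ?lf ` A"
        then obtain b where b: "b \<in> A" "w = ?lf b" by blast
        \<comment> \<open>The relations in \<open>L0\<close> hold already among the lifts over
          \<open>Q\<close>, so a functional on the lifts pulls back to one on \<open>A\<close> that
          respects \<open>L0\<close>, hence all of \<open>L\<close>.\<close>
        define \<psi>' where "\<psi>' b = (if b \<in> A then \<psi> (?lf b) else 0)" for b
        have "word_sum \<psi>' W = 0" if W: "W \<in> L0" for W
        proof -
          have WA: "fst ` set W \<subseteq> A" using W L0(1) by (auto simp: L_def)
          let ?W = "map (\<lambda>(b, s). (?lf b, s)) W"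
          have m: "subst (\<lambda>g. g) ?W = subst ?lf W" "word_sum \<psi> ?W = word_sum (\<lambda>b. \<psi> (?lf b)) W"
            "fst ` set ?W = ?lf ` fst ` set W"
            by (induction W) auto
          have "word_sum \<psi> ?W = 0"
          proof (rule \<psi>[rule_format])
            show "fst ` set ?W \<subseteq> ?lf ` A" unfolding m(3) using WA by (rule image_mono)
            show "null_word Q (subst (\<lambda>g. g) ?W)" unfolding m(1) by (rule QW[OF W])
          qed
          moreover have "word_sum \<psi>' W = word_sum (\<lambda>b. \<psi> (?lf b)) W"
          proof (rule word_sum_cong)
            fix y assume "y \<in> fst ` set W"
            then have "y \<in> A" using WA by blast
            then show "\<psi>' y = \<psi> (?lf y)" by (simp add: \<psi>'_def)
          qed
          ultimately show ?thesis by (simp only: m(2))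
        qed
        then have "\<forall>W\<in>L. word_sum \<psi>' W = 0" by (intro ann) (simp_all add: \<psi>'_def)
        then have "word_sum \<psi>' W = 0" if "fst ` set W \<subseteq> A" "?e W = \<one>\<^bsub>G\<^esub>" for W
          using that unfolding L_def by blast
        then have "\<psi>' b = 0" by (rule func[OF _ b(1)])
        then show "\<psi> w = 0" using b by (simp add: \<psi>'_def)
      qed
    qed
    have "b = \<one>\<^bsub>G\<^esub>" if b: "b \<in> A" for b
    proof -
      have "null_word Q (?lf b)" using \<open>\<forall>g\<in>?lf ` A. null_word Q g\<close> b by blast
      then have "null_word R (\<sigma> b)" by (rule null_word_unlift[OF _ Q(2)])
      then have "word_eval G a (\<sigma> b) = \<one>\<^bsub>G\<^esub>" by (rule null_word_eval[OF o]) (rule R)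
      then show ?thesis using \<sigma>[OF b] by simp
    qed
    then have "A \<subseteq> {\<one>\<^bsub>G\<^esub>}" by blast
    then show False using nontriv trivial_group_subgroup_generated by blast
  qed
qed

text \<open>A repeated relator gives a relation with coefficients \<open>1\<close> and
  \<open>-1\<close>, an empty one a relation with coefficient \<open>1\<close>; both are excluded
  modulo \<open>2\<close>.\<close>

lemma indep_family_image:
  assumes ind: "\<And>p. prime p \<Longrightarrow> indep p J UNIV (\<lambda>j y. expo y (r j))" and "finite J"
  shows "prime p \<Longrightarrow> indep p (r ` J) UNIV (\<lambda>c y. expo y c)" "[] \<notin> r ` J"
proof -
  have inj: "inj_on r J"
  proof (rule inj_onI, rule ccontr)
    fix i j assume ij: "i \<in> J" "j \<in> J" "r i = r j" "i \<noteq> j"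
    let ?k = "\<lambda>l. if l = i then 1 else if l = j then -1 else 0 :: int"
    have "(\<Sum>l\<in>J. ?k l * expo y (r l)) = 0" for y
    proof -
      have "(\<Sum>l\<in>J. ?k l * expo y (r l)) = (\<Sum>l\<in>{i, j}. ?k l * expo y (r l))"
        using ij \<open>finite J\<close> by (intro sum.mono_neutral_right) auto
      then show ?thesis using ij by simp
    qed
    then have "(2::int) dvd (\<Sum>l\<in>J. ?k l * expo y (r l))" for y by (simp only: dvd_0_right)
    then have "(2::int) dvd ?k i" by (rule indepD[OF ind[OF two_is_prime] _ ij(1), of ?k])
    then show False by simp
  qed
  show "indep p (r ` J) UNIV (\<lambda>c y. expo y c)" if p: "prime p" for p
    unfolding indep_def
  proof (intro allI impI ballI)
    fix k c assume k: "\<forall>y\<in>UNIV. p dvd (\<Sum>c\<in>r ` J. k c * expo y c)" and "c \<in> r ` J"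
    then obtain j where j: "j \<in> J" "c = r j" by blast
    have "p dvd k (r j)"
      by (rule indepD[OF ind[OF p] _ j(1), of "\<lambda>j. k (r j)"]) (use k in \<open>simp add: sum.reindex[OF inj]\<close>)
    then show "p dvd k c" by (simp add: j(2))
  qed
  show "[] \<notin> r ` J"
  proof
    assume "[] \<in> r ` J"
    then obtain j where j: "j \<in> J" "r j = []" by force
    have "(\<Sum>l\<in>J. (if l = j then 1 else 0) * expo y (r l)) = 0" for y
      by (rule sum.neutral) (simp add: j(2))
    then have "(2::int) dvd (\<Sum>l\<in>J. (if l = j then 1 else 0) * expo y (r l))" for y by (simp only: dvd_0_right)
    then have "(2::int) dvd (if j = j then 1 else 0)"
      by (rule indepD[OF ind[OF two_is_prime] _ j(1), of "\<lambda>l. if l = j then 1 else 0"])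
    then show False by simp
  qed
qed

theorem theorem2p18:
  fixes G :: "('g, 'm) monoid_scheme"
    and n k :: nat
    and a :: "nat \<Rightarrow> 'g"
    and r :: "nat \<Rightarrow> nat word"
    and \<phi> :: "'g \<Rightarrow> int"
  assumes "presents G a {1..n} (r ` {1..k})"
    and "\<forall>j\<in>{1..k}. cyclically_reduced (r j)"
    and "\<not> trivial_group (H1 G)"
    and "k \<le> n"
    and "H1 G \<cong> free_Abelian_group {1..n - k}"
    and "\<phi> \<in> epi G integer_group"
    and "weakly_concatenable G \<phi> a k r"
  shows "locally_indicable G"
proof -
  let ?X = "{1..n}"
  have P: "group G" "a \<in> ?X \<rightarrow> carrier G" "r ` {1..k} \<subseteq> carrier (free_group ?X)"
    "word_eval G a \<in> epi (free_group ?X) G" using assms(1) by (simp_all add: presents_def)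
  interpret group G by (rule P(1))
  define og where "og = orient_gens G \<phi> a"
  \<comment> \<open>Extended by the identity outside the generators, so that every word has a value
    and a weight.\<close>
  define ob where "ob y = (if y \<in> ?X then og y else \<one>\<^bsub>G\<^esub>)" for y
  define a' where "a' y = (if y \<in> ?X then a y else \<one>\<^bsub>G\<^esub>)" for y
  \<comment> \<open>This substitution inverts the generators of negative weight. It is its own
    inverse, so it translates between the two presentations in both directions.\<close>
  define \<sigma> where "\<sigma> y = [(y, \<not> \<phi> (a y) < 0)]" for y
  define w where "w j = orient_word \<phi> a (r j)" for j
  define wt where "wt y = \<phi> (ob y)" for y
  have ac: "a y \<in> carrier G" if "y \<in> ?X" for y using P(2) that by blast
  have ob: "ob y \<in> carrier G" and a': "a' y \<in> carrier G" for y
    using ac by (simp_all add: ob_def og_def orient_gens_def a'_def)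
  have ev_a': "word_eval G a u = word_eval G a' u" if "fst ` set u \<subseteq> ?X" for u
    by (rule word_eval_cong) (use that in \<open>auto simp: a'_def\<close>)
  have ev_ob: "word_eval G og u = word_eval G ob u" if "fst ` set u \<subseteq> ?X" for u
    by (rule word_eval_cong) (use that in \<open>auto simp: ob_def\<close>)
  have \<sigma>_winv: "winv (\<sigma> y) = [(y, \<phi> (a y) < 0)]" for y
    by (simp add: \<sigma>_def inv_letter_def)
  have orient: "orient_word \<phi> a u = subst \<sigma> u" "subst \<sigma> (subst \<sigma> u) = u" "fst ` set (subst \<sigma> u) = fst ` set u" for u
  proof -
    show "orient_word \<phi> a u = subst \<sigma> u"
      by (induction u) (auto simp: orient_word_def \<sigma>_winv \<sigma>_def inv_letter_def)
    show "subst \<sigma> (subst \<sigma> u) = u"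
      by (induction u) (auto simp: \<sigma>_winv \<sigma>_def inv_letter_def)
    show "fst ` set (subst \<sigma> u) = fst ` set u"
    proof (induction u)
      case (Cons l u)
      then show ?case by (cases l) (simp add: \<sigma>_def image_Un)
    qed simp
  qed
  have flip: "word_eval G ob u = word_eval G a (subst \<sigma> u)" if u: "fst ` set u \<subseteq> ?X" for u
  proof -
    have "word_eval G a (subst \<sigma> u) = word_eval G a' (subst \<sigma> u)" using ev_a' orient(3) u by metis
    also have "\<dots> = word_eval G (\<lambda>y. word_eval G a' (\<sigma> y)) u" by (rule word_eval_subst[OF a'])
    also have "\<dots> = word_eval G ob u"
    proof (rule word_eval_cong)
      fix y assume "y \<in> fst ` set u"
      then have "y \<in> ?X" using u by blast
      then show "word_eval G a' (\<sigma> y) = ob y" using ac[of y]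
        by (simp add: \<sigma>_def word_eval_simps a'_def ob_def og_def orient_gens_def)
    qed
    finally show ?thesis ..
  qed
  have rX: "fst ` set (r j) \<subseteq> ?X" if "j \<in> {1..k}" for j
  proof -
    have "r j \<in> carrier (free_group ?X)" using P(3) that by blast
    then show ?thesis by (simp add: free_group_def)
  qed
  have wX: "fst ` set (w j) \<subseteq> ?X" if "j \<in> {1..k}" for j
    using rX[OF that] by (simp add: w_def orient)
  have w1: "word_eval G ob (w j) = \<one>\<^bsub>G\<^esub>" if j: "j \<in> {1..k}" for j
  proof -
    have "word_eval G ob (w j) = word_eval G a (r j)" using flip[OF wX[OF j]] by (simp add: w_def orient)
    then show ?thesis using presents_relator[OF assms(1), of "r j"] j by simp
  qed
  have triv: "null_word (w ` {1..k}) u" if u: "fst ` set u \<subseteq> ?X" "word_eval G ob u = \<one>\<^bsub>G\<^esub>" for u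
  proof -
    have "null_word (r ` {1..k}) (subst \<sigma> u)"
      by (rule presents_null_word[OF assms(1)]) (use u flip[OF u(1)] orient(3)[of u] in simp_all)
    then have "null_word (w ` {1..k}) (subst \<sigma> (subst \<sigma> u))"
    proof (rule null_word_subst)
      fix s assume "s \<in> r ` {1..k}"
      then obtain j where "j \<in> {1..k}" "s = r j" by blast
      then show "null_word (w ` {1..k}) (subst \<sigma> s)" by (intro null_word_relator) (auto simp: w_def orient(1))
    qed
    then show ?thesis by (simp only: orient)
  qed
  have surj: "\<exists>u. fst ` set u \<subseteq> ?X \<and> word_eval G ob u = g" if "g \<in> carrier G" for g
  proof -
    have "word_eval G a ` carrier (free_group ?X) = carrier G" using P(4) by (simp add: epi_def)
    then obtain v where v: "v \<in> carrier (free_group ?X)" "g = word_eval G a v" using \<open>g \<in> carrier G\<close> by blast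
    have vX: "fst ` set v \<subseteq> ?X" using v(1) by (simp add: free_group_def)
    have "word_eval G ob (subst \<sigma> v) = g" using flip[of "subst \<sigma> v"] vX v(2) by (simp add: orient)
    then show ?thesis using vX orient(3)[of v] by (intro exI[of _ "subst \<sigma> v"]) simp
  qed
  have \<phi>hom: "\<phi> (g \<otimes>\<^bsub>G\<^esub> h) = \<phi> g + \<phi> h" if "g \<in> carrier G" "h \<in> carrier G" for g h
    using assms(6) that by (auto simp: epi_def hom_def integer_group_def)
  have \<phi>1: "\<phi> \<one>\<^bsub>G\<^esub> = 0" using \<phi>hom[of "\<one>\<^bsub>G\<^esub>" "\<one>\<^bsub>G\<^esub>"] by simp
  have \<phi>inv: "\<phi> (inv\<^bsub>G\<^esub> g) = - \<phi> g" if "g \<in> carrier G" for g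
    using \<phi>hom[of g "inv\<^bsub>G\<^esub> g"] that \<phi>1 by simp
  have \<phi>_ev: "\<phi> (word_eval G ob u) = word_sum wt u" for u
  proof (induction u)
    case (Cons l u)
    obtain y s where l: "l = (y, s)" by (cases l)
    have "word_eval G ob u \<in> carrier G" using ob by (simp add: word_eval_in)
    then show ?case using Cons ob[of y] \<phi>inv[OF ob[of y]] by (simp add: l word_eval_simps \<phi>hom wt_def)
  qed (simp add: word_eval_simps \<phi>1)
  have wt_nonneg: "0 \<le> wt y" for y
  proof (cases "y \<in> ?X")
    case True
    then show ?thesis using \<phi>inv[OF ac[OF True]] by (simp add: wt_def ob_def og_def orient_gens_def)
  next
    case False
    then show ?thesis by (simp add: wt_def ob_def \<phi>1 del: atLeastAtMost_iff)
  qed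
  have wt_w: "word_sum wt (w j) = 0" if "j \<in> {1..k}" for j
    using \<phi>_ev[of "w j"] w1[OF that] \<phi>1 by simp
  have ind: "indep p {1..k} UNIV (\<lambda>j y. expo y (w j))" if "prime p" for p
    by (rule relators_indep[OF P(1) ob surj triv wX assms(5,4) that])
  note ind_w = indep_family_image[OF ind finite_atLeastAtMost]
  define W where "W u = \<phi> (word_eval G og u)" for u
  obtain p where p: "p permutes {1..k}" and conc: "\<forall>j\<in>{1..k}. \<exists>x. x \<in># min_multiset W (w (p j)) \<and>
      x \<notin> (\<Union>s\<in>{1..<j}. set_mset (min_multiset W (w (p s)))) \<and>
      min_count W (w (p j)) x False \<noteq> min_count W (w (p j)) x True"
    using assms(7) unfolding weakly_concatenable_def weakly_concatenable_wt_def W_def[abs_def] w_def og_def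
    by (elim exE conjE)
  from bchoice[OF conc] obtain x where x: "\<forall>j\<in>{1..k}. x j \<in># min_multiset W (w (p j)) \<and>
      x j \<notin> (\<Union>s\<in>{1..<j}. set_mset (min_multiset W (w (p s)))) \<and>
      min_count W (w (p j)) (x j) False \<noteq> min_count W (w (p j)) (x j) True" by (elim exE)
  have pj: "p j \<in> {1..k}" if "j \<in> {1..k}" for j using permutes_in_image[OF p] that by blast
  \<comment> \<open>Reordering changes the family but not the set of relators, so the lifted
    relators stay the same.\<close>
  have img: "(\<lambda>j. w (p j)) ` {1..k} = w ` {1..k}" using permutes_image[OF p] by (metis image_image)
  have wr: "weighted_relator W wt ?X (w (p j))" if j: "j \<in> {1..k}" for j
  proof
    show "W u = word_sum wt u" if "fst ` set u \<subseteq> ?X" for u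
      unfolding W_def ev_ob[OF that] by (rule \<phi>_ev)
    show "w (p j) \<noteq> []" using ind_w(2) pj[OF j] by force
  qed (use wX[OF pj[OF j]] wt_w[OF pj[OF j]] wt_nonneg in auto)
  show ?thesis
  proof (rule locally_indicable_from_cover[OF P(1) ob surj triv _ \<phi>_ev])
    show "word_eval G ob s = \<one>\<^bsub>G\<^esub>" if "s \<in> w ` {1..k}" for s using that w1 by blast
    fix Q assume Q: "finite Q" "Q \<subseteq> {lift wt i c | i c. c \<in> w ` {1..k}}"
    show "\<exists>Q'. Q \<subseteq> Q' \<and> Q' \<subseteq> {lift wt i c | i c. c \<in> w ` {1..k}} \<and> loc_indicable Q'"
    proof (rule loc_indicable_levels[of "\<lambda>j. w (p j)" k wt "\<lambda>j. min_I_value W (w (p j))" x Q, unfolded img, OF ind_w])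
      show "min_I_value W (w (p j)) \<le> s" if "j \<in> {1..k}" "((y, s), b) \<in> set (lift wt 0 (w (p j)))" for j y s b
        by (rule weighted_relator.lift_low[OF wr[OF that(1)] that(2)])
      show "expo (x j, min_I_value W (w (p j))) (lift wt 0 (w (p j))) \<noteq> 0" if "j \<in> {1..k}" for j
        unfolding weighted_relator.expo_min_count[OF wr[OF that]] using x[rule_format, OF that] by simp
      show "(x j, min_I_value W (w (p i))) \<notin> fst ` set (lift wt 0 (w (p i)))"
        if ij: "i \<in> {1..k}" "j \<in> {1..k}" "i < j" for i j
      proof
        assume "(x j, min_I_value W (w (p i))) \<in> fst ` set (lift wt 0 (w (p i)))"
        then have "x j \<in># min_multiset W (w (p i))" by (rule weighted_relator.min_multisetI[OF wr[OF ij(1)]])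
        moreover have "i \<in> {1..<j}" using ij by simp
        ultimately show False using x ij(2) by blast
      qed
    qed (use Q in simp_all)
  qed
qed

end
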